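(* Let $n,r$ be positive integers and let $c_1,c_2$ be constants with $1<c_1<c_2<\frac{n}{r}-1$ such that $c_1r$ and $c_2r$ are positive integers. Let $A\in\mathbb{R}^{n\times n}$ be a symmetric matrix with eigendecomposition $$A=V\Lambda V^T=[V_1,V_2,V_3]\begin{bmatrix}\Lambda_1&0&0\\0&\Lambda_2&0\\0&0&\Lambda_3\end{bmatrix}[V_1,V_2,V_3]^T,$$ where $V\in\mathbb{R}^{n\times n}$ is orthogonal, $\Lambda$ is the diagonal matrix of the eigenvalues $\lambda_1(A),\dots,\lambda_n(A)$ of $A$ ordered so that $|\lambda_1(A)|\ge|\lambda_2(A)|\ge\dots\ge|\lambda_n(A)|$, and the blocks with subscripts $1,2,3$ have $r$, $(c_1-1)r$ and $n-c_1r$ columns respectively. Assume $\lambda_r(A)\neq0$. Let $X\in\mathbb{R}^{n\times c_2r}$ be a Gaussian matrix and define $X_i:=V_i^TX$ for $i=1,2,3$. Let $Q_\perp\in\mathbb{R}^{c_2r\times(c_2-c_1+1)r}$ be an orthogonal complement of $X_2^T\in\mathbb{R}^{c_2r\times(c_1-1)r}$, and set $$B=X_3Q_\perp(X_1Q_\perp)^\dagger\in\mathbb{R}^{(n-c_1r)\times r}.$$ Let $(X_1Q_\perp)^\dagger=\hat Q\hat R$ be the thin QR decomposition of $(X_1Q_\perp)^\dagger$ and set $U:=Q_\perp\hat Q\in\mathbb{R}^{c_2r\times r}$. Then the orthogonal projector $P=UU^T\in\mathbb{R}^{c_2r\times c_2r}$ satisfies $$\mathbb{E}\left[\|E\|_*\,\middle|\,\Omega_F\right]\le(1+\epsilon_{r,A})\,\|A-\llbracket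 A\rrbracket_r\|_*,$$ where $$E:=A-AX(PX^TAXP)^\dagger X^TA,$$ $\Omega_F$ is the event $$\Omega_F:=\left\{\big\||\Lambda_3|^{1/2}B\big\|_F^2\le0.5\,|\lambda_r(A)|\right\},$$ and $$\epsilon_{r,A}:=2b\sqrt r\left(1+\frac{|\lambda_{c_1r+1}(A)|}{|\lambda_r(A)|}+\frac{2}{\sqrt b}\right)\frac{\|\Lambda_3\|_*}{\|\Lambda_2\|_*+\|\Lambda_3\|_*},\qquad b=\frac{r}{(c_2-c_1)r-1}.$$
   Context: $\|\cdot\|_*$ is the nuclear norm (sum of singular values) and $\|\cdot\|_F$ the Frobenius norm. $M^\dagger$ denotes the Moore–Penrose pseudoinverse. $\llbracket A\rrbracket_r$ denotes the best rank-$r$ approximation of $A$ obtained from the truncated SVD. $|\Lambda_3|$ and $|\Lambda_3|^{1/2}$ are defined element-wise on the diagonal matrix $\Lambda_3$. A Gaussian matrix is a random matrix with i.i.d. centered normal entries of a common positive variance (the usual normalization is variance $1/s$, where $s=c_2r$ is the sketch size; $B$, $P$ and $E$ do not depend on this scaling). An orthogonal complement of $X_2^T$ is a matrix with orthonormal columns spanning the orthogonal complement of the column space of $X_2^T$; almost surely this complement has dimension $(c_2-c_1+1)r$. In the thin QR decomposition $\hat Q\hat R$, the factor $\hat Q\in\mathbb{R}^{(c_2-c_1+1)r\times r}$ has orthonormal columns and $\hat R\in\mathbb{R}^{r\times r}$ is upper triangular. *)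

theory Defs
  imports
    "HOL-Probability.Probability"
    "Jordan_Normal_Form.Char_Poly"
    "Jordan_Normal_Form.VS_Connect"
begin

definition orthonormal_cols :: "real mat \<Rightarrow> bool" where
  "orthonormal_cols Q \<longleftrightarrow> transpose_mat Q * Q = 1\<^sub>m (dim_col Q)"

definition col_block :: "real mat \<Rightarrow> nat \<Rightarrow> nat \<Rightarrow> real mat" where
  "col_block V a k = Matrix.mat (dim_row V) k (\<lambda>(i, j). V $$ (i, a + j))"

definition frob_norm :: "real mat \<Rightarrow> real" where
  "frob_norm M = sqrt (\<Sum>i<dim_row M. \<Sum>j<dim_col M. (M $$ (i, j))\<^sup>2)"

text \<open>The singular values are the square roots of the eigenvalues of the Gram matrix, counted with
  multiplicity. For a wide matrix this lists additional zeros, which do not affect the sum.\<close>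

definition singular_values :: "real mat \<Rightarrow> real multiset" where
  "singular_values M = image_mset sqrt (proots (char_poly (transpose_mat M * M)))"

definition nuclear_norm :: "real mat \<Rightarrow> real" where
  "nuclear_norm M = sum_mset (singular_values M)"

text \<open>The Moore-Penrose pseudoinverse is the unique matrix satisfying the four Penrose conditions.\<close>

definition is_pinv :: "real mat \<Rightarrow> real mat \<Rightarrow> bool" where
  "is_pinv M N \<longleftrightarrow> N \<in> carrier_mat (dim_col M) (dim_row M) \<and>
     M * N * M = M \<and> N * M * N = N \<and>
     transpose_mat (M * N) = M * N \<and> transpose_mat (N * M) = N * M"

definition pinv :: "real mat \<Rightarrow> real mat" where
  "pinv M = (THE N. is_pinv M N)"

definition is_svd :: "real mat \<Rightarrow> real mat \<Rightarrow> real mat \<Rightarrow> real mat \<Rightarrow> bool" where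
  "is_svd M W S Z \<longleftrightarrow>
     W \<in> carrier_mat (dim_row M) (dim_row M) \<and> orthonormal_cols W \<and>
     Z \<in> carrier_mat (dim_col M) (dim_col M) \<and> orthonormal_cols Z \<and>
     S \<in> carrier_mat (dim_row M) (dim_col M) \<and>
     (\<forall>i<dim_row M. \<forall>j<dim_col M. i \<noteq> j \<longrightarrow> S $$ (i, j) = 0) \<and>
     (\<forall>i<min (dim_row M) (dim_col M). S $$ (i, i) \<ge> 0) \<and>
     (\<forall>j<min (dim_row M) (dim_col M). \<forall>i\<le>j. S $$ (j, j) \<le> S $$ (i, i)) \<and>
     M = W * S * transpose_mat Z"

text \<open>The truncated SVD is not unique when the singular values number r and r+1 coincide, hence a
  relation rather than a function.\<close>

definition is_truncated_svd :: "nat \<Rightarrow> real mat \<Rightarrow> real mat \<Rightarrow> bool" where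
  "is_truncated_svd r M N \<longleftrightarrow> (\<exists>W S Z. is_svd M W S Z \<and>
     N = W * Matrix.mat (dim_row M) (dim_col M) (\<lambda>(i, j). if i < r \<and> j < r then S $$ (i, j) else 0)
           * transpose_mat Z)"

definition is_orth_compl :: "real mat \<Rightarrow> real mat \<Rightarrow> bool" where
  "is_orth_compl Y Q \<longleftrightarrow> dim_row Q = dim_row Y \<and> orthonormal_cols Q \<and>
     vec_space.col_space (dim_row Y) Q =
       vec_module.orthogonal_complement (dim_row Y) (vec_space.col_space (dim_row Y) Y)"

definition is_thin_qr :: "real mat \<Rightarrow> real mat \<Rightarrow> real mat \<Rightarrow> bool" where
  "is_thin_qr M Q R \<longleftrightarrow>
     Q \<in> carrier_mat (dim_row M) (dim_col M) \<and> orthonormal_cols Q \<and>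
     R \<in> carrier_mat (dim_col M) (dim_col M) \<and> upper_triangular R \<and> M = Q * R"

definition random_mat :: "'w measure \<Rightarrow> nat \<Rightarrow> nat \<Rightarrow> ('w \<Rightarrow> real mat) \<Rightarrow> bool" where
  "random_mat M m k Y \<longleftrightarrow> (\<forall>\<omega>\<in>space M. Y \<omega> \<in> carrier_mat m k) \<and>
     (\<forall>i<m. \<forall>j<k. (\<lambda>\<omega>. Y \<omega> $$ (i, j)) \<in> borel_measurable M)"

definition gaussian_mat :: "'w measure \<Rightarrow> nat \<Rightarrow> nat \<Rightarrow> ('w \<Rightarrow> real mat) \<Rightarrow> bool" where
  "gaussian_mat M m k Y \<longleftrightarrow> random_mat M m k Y \<and>
     prob_space.indep_vars M (\<lambda>_. borel) (\<lambda>ij \<omega>. Y \<omega> $$ ij) ({..<m} \<times> {..<k}) \<and>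
     (\<exists>\<sigma>>0. \<forall>i<m. \<forall>j<k. distributed M lborel (\<lambda>\<omega>. Y \<omega> $$ (i, j)) (normal_density 0 \<sigma>))"

text \<open>The library's uniform measure on an event F of a probability space is the conditional
  probability measure given F. It is the null measure if F has probability 0.\<close>

definition cond_expectation :: "'w measure \<Rightarrow> ('w \<Rightarrow> real) \<Rightarrow> 'w set \<Rightarrow> real" where
  "cond_expectation M Y F = (\<integral>\<omega>. Y \<omega> \<partial>uniform_measure M F)"

end

theory Submission
  imports Defs "HOL-Real_Asymp.Real_Asymp"
begin

text \<open>Write \<open>Y\<close> for the matrix with row blocks \<open>X1\<close>, \<open>X2\<close>, which almost surely has full row rank,
  and \<open>T\<close> for its pseudoinverse. Then \<open>Qp * pinv (X1 * Qp)\<close> consists of the first \<open>r\<close> columns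
  \<open>T1\<close> of \<open>T\<close>, so \<open>B = X3 * T1\<close>, and the compressed pseudoinverse in \<open>E\<close> equals
  \<open>T1 * M0\<inverse> * transpose_mat T1\<close> with \<open>M0 = \<Lambda>1 + transpose_mat B * \<Lambda>3 * B\<close>, which is well
  conditioned on \<open>\<Omega>F\<close>. Duality between the nuclear norm and contractions then bounds
  \<open>nuclear_norm E\<close> by the optimal error plus \<open>2 (1 + \<rho>) Z + 4 sqrt (Z * nuclear_norm \<Lambda>3)\<close>, where \<open>Z\<close>
  is the squared Frobenius norm defining \<open>\<Omega>F\<close> and \<open>\<rho>\<close> is the quotient of the absolute eigenvalues
  number \<open>k1 + 1\<close> and \<open>r\<close>. Conditioning on \<open>\<Omega>F = {Z \<le> t}\<close> can only
  decrease the mean of \<open>Z\<close>, and this mean is at most \<open>b * nuclear_norm \<Lambda>3\<close>: Gaussian integration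
  by parts for the regularised inverse Gram matrix \<open>G\<close>, the inverse of
  \<open>Y * transpose_mat Y + d * 1\<close>, bounds the means of its diagonal entries by
  \<open>1 / (\<sigma>\<^sup>2 * (k2 - k1 - 1))\<close>, uniformly in \<open>d > 0\<close>. Letting \<open>d\<close> tend to 0, the same bound also
  yields the full rank.\<close>

subsection \<open>The real spectral theorem\<close>

text \<open>Integration by parts along the columns of \<open>V\<close> takes the role that
  independence of the blocks of the rotated Gaussian matrix would have: by orthonormality, the
  derivative of the regularised pseudoinverse along column \<open>j\<close> vanishes for
  \<open>j \<ge> k1\<close>, just as if \<open>X1\<close> and \<open>X2\<close> were held fixed. The
  obstacle is that the pseudoinverse is discontinuous where the rank drops, whereas integration by
  parts asks for derivatives everywhere and at most linear growth; this forces the parameter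
  \<open>d\<close>, and Fatou's lemma removes it again. The threshold 0.5 in the event keeps the
  perturbation of \<open>\<Lambda>1\<close> in \<open>M0\<close> below half of its smallest
  eigenvalue modulus, so that the inverse of \<open>M0\<close> has norm at most 2 divided by that
  modulus. The event must also be shown to have positive probability, as the conditional measure
  degenerates otherwise; an explicit box of matrices close to the leading eigenvectors lies inside
  it. The square root of \<open>Z\<close> is integrated by a weighted arithmetic-geometric
  inequality.\<close>

lemma mult_mat_index:
  assumes "A \<in> carrier_mat m n" "B \<in> carrier_mat n p" "i < m" "j < p"
  shows "(A * B) $$ (i, j) = (\<Sum>k<n. A $$ (i, k) * B $$ (k, j))"
  using assms by (auto simp: scalar_prod_def atLeast0LessThan intro!: sum.cong)

text \<open>A complex eigenpair exists because the characteristic polynomial splits. With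
  \<open>x\<close> and \<open>y\<close> the real and imaginary parts of the eigenvector, symmetry
  forces \<open>Im a = 0\<close>, so each part is zero or a real eigenvector for
  \<open>Re a\<close>.\<close>

lemma symmetric_real_eigenvector:
  fixes A :: "real mat"
  assumes A: "A \<in> carrier_mat n n" and sym: "transpose_mat A = A" and n: "n > 0"
  shows "\<exists>l v. (\<Sum>i<n. (v i)\<^sup>2) = 1 \<and> (\<forall>i<n. (\<Sum>j<n. A $$ (i, j) * v j) = l * v i)"
proof -
  define C where "C = map_mat complex_of_real A"
  have C: "C \<in> carrier_mat n n" using A by (simp add: C_def)
  obtain as where as: "char_poly C = (\<Prod>a\<leftarrow>as. [:- a, 1:])" "length as = n"
    using char_poly_factorized[OF C] by blast
  then obtain a where "a \<in> set as" using n by (cases as) auto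
  then have "poly (char_poly C) a = 0"
    unfolding as(1) poly_prod_list by (auto simp: prod_list_zero_iff)
  then have "eigenvalue C a" using eigenvalue_root_char_poly[OF C] by simp
  then obtain z where z: "z \<in> carrier_vec n" "z \<noteq> 0\<^sub>v n" "C *\<^sub>v z = a \<cdot>\<^sub>v z"
    using C unfolding eigenvalue_def eigenvector_def by auto
  define x y where "x = (\<lambda>i. Re (z $ i))" and "y = (\<lambda>i. Im (z $ i))"
  have sy: "A $$ (i, j) = A $$ (j, i)" if "i < n" "j < n" for i j
    using sym A that by (metis carrier_matD index_transpose_mat(1))
  have ev: "(\<Sum>j<n. complex_of_real (A $$ (i, j)) * z $ j) = a * z $ i" if i: "i < n" for i
  proof -
    have "(C *\<^sub>v z) $ i = (\<Sum>j<n. complex_of_real (A $$ (i, j)) * z $ j)"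
      using i A C z(1) by (auto simp: C_def scalar_prod_def atLeast0LessThan intro!: sum.cong)
    then show ?thesis using z i by simp
  qed
  have ex: "(\<Sum>j<n. A $$ (i, j) * x j) = Re a * x i - Im a * y i" if "i < n" for i
    using arg_cong[OF ev[OF that], of Re] by (simp add: x_def y_def)
  have ey: "(\<Sum>j<n. A $$ (i, j) * y j) = Re a * y i + Im a * x i" if "i < n" for i
    using arg_cong[OF ev[OF that], of Im] by (simp add: x_def y_def)
  \<comment> \<open>Symmetry of the bilinear form of \<open>A\<close> at \<open>x\<close> and
    \<open>y\<close>; inserting the two real equations leaves \<open>Im a\<close> times the squared
    norm of \<open>z\<close>.\<close>
  have "(\<Sum>i<n. y i * (\<Sum>j<n. A $$ (i, j) * x j)) = (\<Sum>i<n. x i * (\<Sum>j<n. A $$ (i, j) * y j))"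
    by (simp add: sum_distrib_left, subst sum.swap, auto intro!: sum.cong simp: sy)
  then have "(\<Sum>i<n. y i * (Re a * x i - Im a * y i)) = (\<Sum>i<n. x i * (Re a * y i + Im a * x i))"
    by (simp add: ex ey)
  then have "Im a * (\<Sum>i<n. (x i)\<^sup>2 + (y i)\<^sup>2) = 0"
    by (simp add: sum.distrib algebra_simps sum_subtractf power2_eq_square sum_distrib_left)
  moreover have nz: "(\<Sum>i<n. (x i)\<^sup>2 + (y i)\<^sup>2) \<noteq> 0"
  proof
    assume "(\<Sum>i<n. (x i)\<^sup>2 + (y i)\<^sup>2) = 0"
    then have "\<forall>i<n. (x i)\<^sup>2 + (y i)\<^sup>2 = 0"
      by (subst (asm) sum_nonneg_eq_0_iff) auto
    then have "z $ i = 0" if "i < n" for i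
      using that by (simp add: x_def y_def complex_eq_iff sum_power2_eq_zero_iff)
    then show False using z by auto
  qed
  ultimately have im: "Im a = 0" by simp
  have "\<exists>w. (\<exists>i<n. w i \<noteq> 0) \<and> (\<forall>i<n. (\<Sum>j<n. A $$ (i, j) * w j) = Re a * w i)"
  proof (cases "\<exists>i<n. x i \<noteq> 0")
    case True then show ?thesis using ex im by (intro exI[of _ x]) auto
  next
    case False
    then have "(\<Sum>i<n. (y i)\<^sup>2) \<noteq> 0" using nz by (simp add: sum.distrib)
    then obtain i where "i < n" "y i \<noteq> 0" by (metis (no_types, lifting) lessThan_iff sum.neutral zero_power2)
    then show ?thesis using ey im by (intro exI[of _ y]) auto
  qed
  then obtain w where w: "\<exists>i<n. w i \<noteq> 0" "\<forall>i<n. (\<Sum>j<n. A $$ (i, j) * w j) = Re a * w i" by blast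
  define s where "s = (\<Sum>i<n. (w i)\<^sup>2)"
  have s: "s > 0" unfolding s_def using w(1) by (auto intro!: sum_pos2)
  have "(\<Sum>i<n. (w i / sqrt s)\<^sup>2) = 1"
    using s by (simp add: power_divide flip: sum_divide_distrib) (simp add: s_def)
  moreover have "(\<Sum>j<n. A $$ (i, j) * (w j / sqrt s)) = Re a * (w i / sqrt s)" if "i < n" for i
    using w(2) that by (simp flip: sum_divide_distrib)
  ultimately show ?thesis by (intro exI[of _ "Re a"] exI[of _ "\<lambda>i. w i / sqrt s"]) auto
qed

text \<open>The reflection in the hyperplane orthogonal to \<open>v - e_0\<close> exchanges the unit
  vectors \<open>e_0\<close> and \<open>v\<close>, which yields a symmetric orthogonal matrix with
  prescribed first column.\<close>

lemma householder:
  fixes v :: "nat \<Rightarrow> real"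
  assumes v: "(\<Sum>i<n. (v i)\<^sup>2) = 1" and n: "n > 0"
  shows "\<exists>H \<in> carrier_mat n n. transpose_mat H = H \<and> H * H = 1\<^sub>m n \<and> (\<forall>i<n. H $$ (i, 0) = v i)"
proof -
  define w where "w i = v i - (if i = 0 then 1 else 0)" for i
  define q where "q = (\<Sum>i<n. (w i)\<^sup>2)"
  \<comment> \<open>If \<open>v\<close> is the first unit vector, then \<open>q = 0\<close>;
    division by zero gives \<open>c = 0\<close>, and \<open>H\<close> is the identity.\<close>
  define c where "c = 2 / q"
  define H where "H = Matrix.mat n n (\<lambda>(i, j). (if i = j then 1 else 0) - c * w i * w j)"
  have q: "q = 2 - 2 * v 0"
  proof -
    have "q = (\<Sum>i<n. (v i)\<^sup>2 + (if i = 0 then 1 - 2 * v 0 else 0))"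
      unfolding q_def w_def by (intro sum.cong) (auto simp: power2_eq_square algebra_simps)
    then show ?thesis using n v by (simp add: sum.distrib sum.delta)
  qed
  have H: "H \<in> carrier_mat n n" by (simp add: H_def)
  have "c * c * q = 2 * c" by (simp add: c_def)
  have 1: "(\<Sum>k<n. H $$ (i, k) * H $$ (k, j)) = (if i = j then 1 else 0)" if i: "i < n" and j: "j < n" for i j
  proof -
    have "(\<Sum>k<n. H $$ (i, k) * H $$ (k, j)) = (\<Sum>k<n. (if k = i then (if i = j then 1 else 0) - c * w i * w j else 0)
       - (if k = j then c * w i * w j else 0) + c * c * w i * w j * (w k)\<^sup>2)"
      using i j by (intro sum.cong) (auto simp: H_def power2_eq_square algebra_simps)
    also have "\<dots> = (if i = j then 1 else 0) - 2 * c * w i * w j + (c * c * q) * w i * w j"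
      using i j by (simp add: sum.distrib sum_subtractf sum.delta q_def flip: sum_distrib_left)
    also have "\<dots> = (if i = j then 1 else 0)" by (simp add: \<open>c * c * q = 2 * c\<close>)
    finally show ?thesis .
  qed
  have HH: "H * H = 1\<^sub>m n"
    by (rule eq_matI) (use H in \<open>auto simp del: index_mult_mat(1) simp: mult_mat_index[OF H H] 1\<close>)
  have HT: "transpose_mat H = H" by (rule eq_matI) (auto simp: H_def)
  have "H $$ (i, 0) = v i" if i: "i < n" for i
  proof (cases "q = 0")
    case True
    then have "w k = 0" if "k < n" for k using that by (auto simp: q_def sum_nonneg_eq_0_iff)
    then show ?thesis using i n by (simp add: H_def) (auto simp: w_def split: if_splits)
  next
    case False
    have "c * w 0 = -1" using False q by (simp add: c_def w_def field_simps)
    then have "c * w i * w 0 = - w i" by (metis mult.assoc mult.commute mult_minus1)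
    then show ?thesis using i n by (simp add: H_def) (auto simp: w_def)
  qed
  then show ?thesis using H HH HT by blast
qed

text \<open>Deflation: conjugation with a Householder reflection whose first column is an
  eigenvector clears the first row and column off the diagonal, and the induction hypothesis treats
  the remaining block \<open>D\<close>.\<close>

lemma spectral_theorem:
  fixes A :: "real mat"
  assumes "A \<in> carrier_mat n n" and "transpose_mat A = A"
  shows "\<exists>U d. U \<in> carrier_mat n n \<and> transpose_mat U * U = 1\<^sub>m n \<and> U * transpose_mat U = 1\<^sub>m n
    \<and> A = U * mat_diag n d * transpose_mat U"
  using assms
proof (induction n arbitrary: A)
  case 0
  then show ?case by (intro exI[of _ A] exI[of _ undefined]) (auto intro!: eq_matI)
next
  case (Suc n A)
  let ?N = "Suc n"
  note A = Suc.prems(1)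
  obtain l v where v: "(\<Sum>i<?N. (v i)\<^sup>2) = 1" "\<forall>i<?N. (\<Sum>j<?N. A $$ (i, j) * v j) = l * v i"
    using symmetric_real_eigenvector[OF Suc.prems] by blast
  obtain H where H: "H \<in> carrier_mat ?N ?N" "transpose_mat H = H" "H * H = 1\<^sub>m ?N" "\<forall>i<?N. H $$ (i, 0) = v i"
    using householder[OF v(1)] by blast
  define A' where "A' = H * A * H"
  have A': "A' \<in> carrier_mat ?N ?N" using H A by (simp add: A'_def)
  have symA': "transpose_mat A' = A'"
    using H A Suc.prems(2) unfolding A'_def
    by (simp add: transpose_mult[of _ ?N ?N _ ?N] assoc_mult_mat[of _ ?N ?N _ ?N _ ?N])
  have AH: "(A * H) $$ (k, 0) = l * H $$ (k, 0)" if "k < ?N" for k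
  proof -
    have "(A * H) $$ (k, 0) = (\<Sum>j<?N. A $$ (k, j) * H $$ (j, 0))"
      by (rule mult_mat_index[OF A H(1) that]) simp
    also have "\<dots> = (\<Sum>j<?N. A $$ (k, j) * v j)" using H(4) by (intro sum.cong) auto
    finally show ?thesis using v(2) H(4) that by simp
  qed
  have c0: "A' $$ (i, 0) = (if i = 0 then l else 0)" if i: "i < ?N" for i
  proof -
    have "A' = H * (A * H)" using H A by (simp add: A'_def assoc_mult_mat[of _ ?N ?N _ ?N _ ?N])
    then have "A' $$ (i, 0) = (\<Sum>k<?N. H $$ (i, k) * (A * H) $$ (k, 0))"
      using H A i by (simp only: mult_mat_index[of H ?N ?N "A * H" ?N i 0]) (subst mult_mat_index[of H ?N ?N "A * H" ?N i 0], auto)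
    also have "\<dots> = (\<Sum>k<?N. l * (H $$ (i, k) * H $$ (k, 0)))"
      by (intro sum.cong refl, subst AH) auto
    also have "\<dots> = l * (H * H) $$ (i, 0)"
      using mult_mat_index[OF H(1) H(1) i, of 0] by (simp only: sum_distrib_left zero_less_Suc)
    finally show ?thesis using H(3) i by simp
  qed
  have r0: "A' $$ (0, i) = (if i = 0 then l else 0)" if "i < ?N" for i
    using c0[OF that] symA' A' that by (metis carrier_matD index_transpose_mat(1) zero_less_Suc)
  define D where "D = Matrix.mat n n (\<lambda>(i, j). A' $$ (Suc i, Suc j))"
  have D: "D \<in> carrier_mat n n" by (simp add: D_def)
  have "transpose_mat D = D"
    by (rule eq_matI) (use symA' A' in \<open>auto simp: D_def, metis Suc_less_eq carrier_matD index_transpose_mat(1)\<close>)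
  from Suc.IH[OF D this] obtain W d where W: "W \<in> carrier_mat n n" "transpose_mat W * W = 1\<^sub>m n" "W * transpose_mat W = 1\<^sub>m n"
    and DW: "D = W * mat_diag n d * transpose_mat W" by blast
  define W' where "W' = four_block_mat (1\<^sub>m 1) (0\<^sub>m 1 n) (0\<^sub>m n 1) W"
  define d' where "d' i = (case i of 0 \<Rightarrow> l | Suc k \<Rightarrow> d k)" for i
  have W': "W' \<in> carrier_mat ?N ?N" using four_block_carrier_mat[of "1\<^sub>m 1" 1 1 W n n] W by (simp add: W'_def)
  have W'T: "transpose_mat W' = four_block_mat (1\<^sub>m 1) (0\<^sub>m 1 n) (0\<^sub>m n 1) (transpose_mat W)"
    using W by (simp add: W'_def transpose_four_block_mat[of _ 1 1 _ n _ n])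
  have one: "four_block_mat (1\<^sub>m 1) (0\<^sub>m 1 n) (0\<^sub>m n 1) (1\<^sub>m n) = (1\<^sub>m ?N :: real mat)"
    by (rule eq_matI) auto
  have o1: "transpose_mat W' * W' = 1\<^sub>m ?N"
    unfolding W'T unfolding W'_def
    by (subst mult_four_block_mat[of _ 1 1 _ n _ n _ _ 1 _ n]) (use W one in auto)
  have o2: "W' * transpose_mat W' = 1\<^sub>m ?N"
    unfolding W'T unfolding W'_def
    by (subst mult_four_block_mat[of _ 1 1 _ n _ n _ _ 1 _ n]) (use W one in auto)
  have Dd: "mat_diag ?N d' = four_block_mat (mat_diag 1 (\<lambda>_. l)) (0\<^sub>m 1 n) (0\<^sub>m n 1) (mat_diag n d)"
    by (rule eq_matI) (auto simp: mat_diag_def d'_def split: nat.splits)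
  have A'b: "A' = four_block_mat (mat_diag 1 (\<lambda>_. l)) (0\<^sub>m 1 n) (0\<^sub>m n 1) D"
  proof (rule eq_matI)
    fix i j assume "i < dim_row (four_block_mat (mat_diag 1 (\<lambda>_. l)) (0\<^sub>m 1 n) (0\<^sub>m n 1) D)"
      "j < dim_col (four_block_mat (mat_diag 1 (\<lambda>_. l)) (0\<^sub>m 1 n) (0\<^sub>m n 1) D)"
    then have ij: "i < ?N" "j < ?N" using D by (auto simp: mat_diag_def)
    show "A' $$ (i, j) = four_block_mat (mat_diag 1 (\<lambda>_. l)) (0\<^sub>m 1 n) (0\<^sub>m n 1) D $$ (i, j)"
      using ij c0[OF ij(1)] r0[OF ij(2)] by (cases i; cases j) (auto simp: D_def mat_diag_def)
  qed (use A' D in \<open>auto simp: mat_diag_def\<close>)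
  have A'W: "A' = W' * mat_diag ?N d' * transpose_mat W'"
  proof -
    have "W' * mat_diag ?N d' = four_block_mat (mat_diag 1 (\<lambda>_. l)) (0\<^sub>m 1 n) (0\<^sub>m n 1) (W * mat_diag n d)"
      unfolding Dd W'_def
      by (subst mult_four_block_mat[of _ 1 1 _ n _ n _ _ 1 _ n]) (use W in \<open>auto simp: mat_diag_def\<close>)
    then show ?thesis unfolding W'T A'b DW
      by (simp only:) (subst mult_four_block_mat[of _ 1 1 _ n _ n _ _ 1 _ n], use W in \<open>auto simp: mat_diag_def\<close>)
  qed
  define U where "U = H * W'"
  have U: "U \<in> carrier_mat ?N ?N" using H W' by (simp add: U_def)
  have UT: "transpose_mat U = transpose_mat W' * H"
    using H W' by (simp add: U_def transpose_mult[of _ ?N ?N _ ?N])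
  note as = assoc_mult_mat[of _ ?N ?N _ ?N _ ?N] mult_carrier_mat[of _ ?N ?N _ ?N]
  have "transpose_mat U * U = transpose_mat W' * (H * H) * W'"
    using H(1) W' unfolding UT by (simp add: U_def as)
  then have u1: "transpose_mat U * U = 1\<^sub>m ?N" using H o1 W' by simp
  have "U * transpose_mat U = H * (W' * transpose_mat W') * H"
    using H(1) W' unfolding UT by (simp add: U_def as)
  then have u2: "U * transpose_mat U = 1\<^sub>m ?N" using H o2 by simp
  have "U * mat_diag ?N d' * transpose_mat U = H * (W' * mat_diag ?N d' * transpose_mat W') * H"
    using H(1) W' unfolding UT by (simp add: U_def as)
  also have "\<dots> = H * (H * A * H) * H" by (simp only: A'W[symmetric]) (simp add: A'_def)
  also have "\<dots> = (H * H) * A * (H * H)" using H(1) A by (simp add: as)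
  also have "\<dots> = A" using H A by simp
  finally show ?case using U u1 u2 by (intro exI[of _ U] exI[of _ d']) auto
qed

subsection \<open>Frobenius inner product and nuclear norm\<close>

definition frob_inner :: "real mat \<Rightarrow> real mat \<Rightarrow> real" where
  "frob_inner A B = (\<Sum>i<dim_row A. \<Sum>j<dim_col A. A $$ (i, j) * B $$ (i, j))"

text \<open>A bound \<open>c\<close> on the spectral norm, tested on matrices of every width instead
  of vectors. In this form it combines directly with the Frobenius inner product and composes
  without reference to singular values.\<close>

definition op_bounded :: "real \<Rightarrow> real mat \<Rightarrow> bool" where
  "op_bounded c C \<longleftrightarrow> (\<forall>m. \<forall>X \<in> carrier_mat (dim_col C) m. frob_norm (C * X) \<le> c * frob_norm X)"

lemma frob_norm_L2_set:
  "A \<in> carrier_mat m n \<Longrightarrow> frob_norm A = L2_set (($$) A) ({..<m} \<times> {..<n})"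
  by (auto simp: frob_norm_def L2_set_def sum.cartesian_product)

lemma frob_norm_nonneg [simp]: "frob_norm A \<ge> 0"
  by (simp add: frob_norm_def sum_nonneg)

lemma frob_norm_square: "(frob_norm A)\<^sup>2 = frob_inner A A"
  by (simp add: frob_norm_def frob_inner_def sum_nonneg power2_eq_square)

lemma frob_norm_square_sum:
  "A \<in> carrier_mat m n \<Longrightarrow> (frob_norm A)\<^sup>2 = (\<Sum>i<m. \<Sum>j<n. (A $$ (i, j))\<^sup>2)"
  by (auto simp: frob_norm_def sum_nonneg)

lemma frob_cauchy_schwarz:
  assumes "A \<in> carrier_mat m n" "B \<in> carrier_mat m n"
  shows "frob_inner A B \<le> frob_norm A * frob_norm B"
proof -
  have "frob_inner A B = (\<Sum>x\<in>{..<m} \<times> {..<n}. A $$ x * B $$ x)"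
    using assms by (auto simp: frob_inner_def sum.cartesian_product intro!: sum.cong)
  also have "\<dots> \<le> (\<Sum>x\<in>{..<m} \<times> {..<n}. \<bar>A $$ x\<bar> * \<bar>B $$ x\<bar>)"
    by (intro sum_mono) (metis abs_ge_self abs_mult)
  also have "\<dots> \<le> frob_norm A * frob_norm B"
    unfolding frob_norm_L2_set[OF assms(1)] frob_norm_L2_set[OF assms(2)] by (rule L2_set_mult_ineq)
  finally show ?thesis .
qed

lemma frob_norm_uminus: "frob_norm (- A) = frob_norm A"
  unfolding frob_norm_def by (auto intro!: sum.cong)

lemma frob_inner_uminus_left:
  "A \<in> carrier_mat m n \<Longrightarrow> frob_inner (- A) B = - frob_inner A B"
  by (auto simp: frob_inner_def sum_negf intro!: sum.cong)

lemma frob_cauchy_schwarz_abs: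
  assumes "A \<in> carrier_mat m n" "B \<in> carrier_mat m n"
  shows "\<bar>frob_inner A B\<bar> \<le> frob_norm A * frob_norm B"
  using frob_cauchy_schwarz[OF assms] frob_cauchy_schwarz[of "- A" m n B] assms
  by (simp add: frob_inner_uminus_left[OF assms(1)] frob_norm_uminus abs_le_iff)

lemma frob_inner_transpose:
  assumes "A \<in> carrier_mat m n" "B \<in> carrier_mat m n"
  shows "frob_inner (transpose_mat A) (transpose_mat B) = frob_inner A B"
  using assms by (simp add: frob_inner_def, subst sum.swap) (auto intro!: sum.cong)

lemma frob_norm_transpose [simp]: "frob_norm (transpose_mat A) = frob_norm A"
  by (simp add: frob_norm_def, subst sum.swap) (auto intro!: arg_cong[of _ _ sqrt] sum.cong)

lemma frob_inner_mult_left: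
  assumes "A \<in> carrier_mat m p" "B \<in> carrier_mat m n" "C \<in> carrier_mat n p"
  shows "frob_inner A (B * C) = frob_inner (transpose_mat B * A) C"
proof -
  have T: "transpose_mat B \<in> carrier_mat n m" using assms by simp
  have "frob_inner A (B * C) = (\<Sum>i<m. \<Sum>j<p. \<Sum>k<n. A $$ (i, j) * B $$ (i, k) * C $$ (k, j))"
    using assms
    by (auto simp: frob_inner_def mult_mat_index[of B m n C p] sum_distrib_left mult.assoc
        simp del: index_mult_mat(1) intro!: sum.cong)
  also have "\<dots> = (\<Sum>i<m. \<Sum>k<n. \<Sum>j<p. A $$ (i, j) * B $$ (i, k) * C $$ (k, j))"
    by (intro sum.cong refl sum.swap)
  also have "\<dots> = (\<Sum>k<n. \<Sum>i<m. \<Sum>j<p. A $$ (i, j) * B $$ (i, k) * C $$ (k, j))"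
    by (rule sum.swap)
  also have "\<dots> = (\<Sum>k<n. \<Sum>j<p. \<Sum>i<m. A $$ (i, j) * B $$ (i, k) * C $$ (k, j))"
    by (intro sum.cong refl sum.swap)
  also have "\<dots> = frob_inner (transpose_mat B * A) C"
    using assms
    by (auto simp: frob_inner_def mult_mat_index[OF T assms(1)] sum_distrib_left sum_distrib_right mult_ac
        simp del: index_mult_mat(1) intro!: sum.cong)
  finally show ?thesis .
qed

lemma frob_inner_mult_right:
  assumes "A \<in> carrier_mat m p" "B \<in> carrier_mat m n" "C \<in> carrier_mat n p"
  shows "frob_inner A (B * C) = frob_inner (A * transpose_mat C) B"
proof -
  have "frob_inner A (B * C) = frob_inner (transpose_mat A) (transpose_mat C * transpose_mat B)"
    using assms frob_inner_transpose[of A m p "B * C"] by (simp add: transpose_mult[of B m n C p])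
  also have "\<dots> = frob_inner (C * transpose_mat A) (transpose_mat B)"
    using assms frob_inner_mult_left[of "transpose_mat A" p m "transpose_mat C" n "transpose_mat B"] by simp
  also have "\<dots> = frob_inner (transpose_mat (A * transpose_mat C)) (transpose_mat B)"
    using assms by (simp add: transpose_mult[of A m p "transpose_mat C" n])
  finally show ?thesis using assms frob_inner_transpose[of "A * transpose_mat C" m n B] by simp
qed

lemma frob_inner_add_right:
  assumes "A \<in> carrier_mat m n" "B \<in> carrier_mat m n" "C \<in> carrier_mat m n"
  shows "frob_inner A (B + C) = frob_inner A B + frob_inner A C"
  using assms by (auto simp: frob_inner_def distrib_left sum.distrib)

lemma frob_inner_diff_right:
  assumes "A \<in> carrier_mat m n" "B \<in> carrier_mat m n" "C \<in> carrier_mat m n"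
  shows "frob_inner A (B - C) = frob_inner A B - frob_inner A C"
  using assms by (auto simp: frob_inner_def right_diff_distrib sum_subtractf)

lemma frob_norm_add:
  assumes "A \<in> carrier_mat m n" "B \<in> carrier_mat m n"
  shows "frob_norm (A + B) \<le> frob_norm A + frob_norm B"
proof -
  have "frob_norm (A + B) = L2_set (\<lambda>x. A $$ x + B $$ x) ({..<m} \<times> {..<n})"
    using assms by (simp add: frob_norm_L2_set[of "A + B" m n]) (rule L2_set_cong, auto)
  also have "\<dots> \<le> frob_norm A + frob_norm B"
    unfolding frob_norm_L2_set[OF assms(1)] frob_norm_L2_set[OF assms(2)] by (rule L2_set_triangle_ineq)
  finally show ?thesis .
qed

lemma frob_norm_diff:
  assumes "A \<in> carrier_mat m n" "B \<in> carrier_mat m n"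
  shows "frob_norm (A - B) \<le> frob_norm A + frob_norm B"
proof -
  have "A - B = A + (- B)" using assms by auto
  then show ?thesis using frob_norm_add[of A m n "- B"] assms by (simp add: frob_norm_uminus)
qed

lemma frob_norm_mult:
  assumes A: "A \<in> carrier_mat m n" and B: "B \<in> carrier_mat n p"
  shows "frob_norm (A * B) \<le> frob_norm A * frob_norm B"
proof (rule power2_le_imp_le)
  have "(frob_norm (A * B))\<^sup>2 = (\<Sum>i<m. \<Sum>j<p. (\<Sum>k<n. A $$ (i, k) * B $$ (k, j))\<^sup>2)"
    using A B by (subst frob_norm_square_sum[of _ m p])
      (auto simp: mult_mat_index[OF A B] simp del: index_mult_mat(1))
  also have "\<dots> \<le> (\<Sum>i<m. \<Sum>j<p. (\<Sum>k<n. (A $$ (i, k))\<^sup>2) * (\<Sum>k<n. (B $$ (k, j))\<^sup>2))"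
    by (intro sum_mono Cauchy_Schwarz_ineq_sum)
  also have "\<dots> = (\<Sum>i<m. \<Sum>k<n. (A $$ (i, k))\<^sup>2) * (\<Sum>j<p. \<Sum>k<n. (B $$ (k, j))\<^sup>2)"
    by (simp add: sum_product)
  also have "(\<Sum>j<p. \<Sum>k<n. (B $$ (k, j))\<^sup>2) = (\<Sum>k<n. \<Sum>j<p. (B $$ (k, j))\<^sup>2)"
    by (rule sum.swap)
  finally show "(frob_norm (A * B))\<^sup>2 \<le> (frob_norm A * frob_norm B)\<^sup>2"
    by (simp add: power_mult_distrib frob_norm_square_sum[OF A] frob_norm_square_sum[OF B])
qed simp

lemma mult_le_abs:
  fixes w x :: real
  assumes "\<bar>w\<bar> \<le> 1"
  shows "w * x \<le> \<bar>x\<bar>"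
proof -
  have "w * x \<le> \<bar>w\<bar> * \<bar>x\<bar>" by (metis abs_ge_self abs_mult)
  also have "\<dots> \<le> 1 * \<bar>x\<bar>" using assms by (intro mult_right_mono) auto
  finally show ?thesis by simp
qed

lemma op_boundedD:
  "op_bounded c C \<Longrightarrow> C \<in> carrier_mat k n \<Longrightarrow> X \<in> carrier_mat n m \<Longrightarrow> frob_norm (C * X) \<le> c * frob_norm X"
  by (auto simp: op_bounded_def)

lemma frob_norm_orthonormal_mult:
  assumes U: "U \<in> carrier_mat k n" "transpose_mat U * U = 1\<^sub>m n" and X: "X \<in> carrier_mat n m"
  shows "frob_norm (U * X) = frob_norm X"
proof -
  have UX: "U * X \<in> carrier_mat k m" using U X by simp
  have "transpose_mat U * (U * X) = (transpose_mat U * U) * X"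
    using U(1) X assoc_mult_mat[of "transpose_mat U" n k U n X m] by simp
  then have "(frob_norm (U * X))\<^sup>2 = (frob_norm X)\<^sup>2"
    using frob_inner_mult_left[OF UX U(1) X] U(2) X by (simp add: frob_norm_square)
  then show ?thesis by (simp add: power2_eq_iff_nonneg)
qed

lemma op_bounded_orthonormal:
  "U \<in> carrier_mat k n \<Longrightarrow> transpose_mat U * U = 1\<^sub>m n \<Longrightarrow> op_bounded 1 U"
  by (auto simp: op_bounded_def frob_norm_orthonormal_mult)

lemma op_bounded_mat_diag:
  assumes "\<And>i. i < n \<Longrightarrow> \<bar>d i\<bar> \<le> c" and c: "c \<ge> 0"
  shows "op_bounded c (mat_diag n d)"
  unfolding op_bounded_def
proof (intro allI ballI)
  fix m and X :: "real mat" assume "X \<in> carrier_mat (dim_col (mat_diag n d)) m"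
  then have X: "X \<in> carrier_mat n m" by (simp add: mat_diag_def)
  have DX: "mat_diag n d * X \<in> carrier_mat n m" using X by (simp add: mult_carrier_mat[of _ n n])
  show "frob_norm (mat_diag n d * X) \<le> c * frob_norm X"
  proof (rule power2_le_imp_le)
    have "(frob_norm (mat_diag n d * X))\<^sup>2 = (\<Sum>i<n. \<Sum>j<m. (d i * X $$ (i, j))\<^sup>2)"
      unfolding frob_norm_square_sum[OF DX] unfolding mat_diag_mult_left[OF X] by simp
    also have "\<dots> \<le> (\<Sum>i<n. \<Sum>j<m. c\<^sup>2 * (X $$ (i, j))\<^sup>2)"
      unfolding power_mult_distrib
      by (intro sum_mono mult_right_mono) (use assms in \<open>auto simp: abs_le_square_iff[symmetric]\<close>)
    finally show "(frob_norm (mat_diag n d * X))\<^sup>2 \<le> (c * frob_norm X)\<^sup>2"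
      by (simp add: power_mult_distrib frob_norm_square_sum[OF X] sum_distrib_left)
  qed (use c in simp)
qed

lemma op_bounded_mult:
  assumes "op_bounded a A" "op_bounded b B" "A \<in> carrier_mat m n" "B \<in> carrier_mat n p" "a \<ge> 0"
  shows "op_bounded (a * b) (A * B)"
  unfolding op_bounded_def
proof (intro allI ballI)
  fix q and X :: "real mat" assume "X \<in> carrier_mat (dim_col (A * B)) q"
  then have X: "X \<in> carrier_mat p q" using assms by simp
  have "frob_norm (A * B * X) = frob_norm (A * (B * X))"
    using assoc_mult_mat[OF assms(3,4) X] by simp
  also have "\<dots> \<le> a * frob_norm (B * X)" using assms X by (intro op_boundedD[of a A m n _ q]) auto
  also have "\<dots> \<le> a * (b * frob_norm X)" using assms X by (intro mult_left_mono op_boundedD[of b B n p]) auto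
  finally show "frob_norm (A * B * X) \<le> a * b * frob_norm X" by simp
qed

text \<open>Testing on the \<open>j\<close>-th unit column suffices: the entry is one coordinate of
  a column of norm at most \<open>c\<close>.\<close>

lemma op_bounded_entry:
  assumes "op_bounded c C" and C: "C \<in> carrier_mat m n" and ij: "i < m" "j < n"
  shows "\<bar>C $$ (i, j)\<bar> \<le> c"
proof -
  define X where "X = Matrix.mat n 1 (\<lambda>(k, l). if k = j then 1 else 0 :: real)"
  have X: "X \<in> carrier_mat n 1" by (simp add: X_def)
  have "(frob_norm X)\<^sup>2 = (\<Sum>i<n. if i = j then 1 else 0)"
    unfolding frob_norm_square_sum[OF X] by (intro sum.cong) (auto simp: X_def)
  then have "(frob_norm X)\<^sup>2 = 1" using ij by simp
  then have X1: "frob_norm X = 1" using frob_norm_nonneg[of X] by (auto simp: power2_eq_1_iff simp del: frob_norm_nonneg)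
  have "(C * X) $$ (i, 0) = (\<Sum>k<n. C $$ (i, k) * X $$ (k, 0))"
    by (rule mult_mat_index[OF C X ij(1)]) simp
  also have "\<dots> = (\<Sum>k<n. if k = j then C $$ (i, j) else 0)"
    by (intro sum.cong) (auto simp: X_def)
  finally have e: "(C * X) $$ (i, 0) = C $$ (i, j)" using ij by simp
  have CX: "C * X \<in> carrier_mat m 1" using C X by simp
  have "\<bar>C $$ (i, j)\<bar>\<^sup>2 = ((C * X) $$ (i, 0))\<^sup>2" unfolding e by simp
  also have "\<dots> \<le> (\<Sum>i<m. ((C * X) $$ (i, 0))\<^sup>2)"
    using ij by (intro member_le_sum) auto
  also have "\<dots> = (frob_norm (C * X))\<^sup>2" unfolding frob_norm_square_sum[OF CX] by simp
  finally have "\<bar>C $$ (i, j)\<bar>\<^sup>2 \<le> (frob_norm (C * X))\<^sup>2" .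
  then have "\<bar>C $$ (i, j)\<bar> \<le> frob_norm (C * X)" by (rule power2_le_imp_le) simp
  also have "\<dots> \<le> c" using op_boundedD[OF assms(1) C X] X1 by simp
  finally show ?thesis .
qed

text \<open>Similarity preserves the characteristic polynomial, so the multiset in
  \<open>singular_values\<close> can be read off any orthogonal diagonalisation of the Gram
  matrix.\<close>

lemma proots_char_poly_orthogonal_diag:
  fixes U :: "real mat"
  assumes "U \<in> carrier_mat n n" "transpose_mat U * U = 1\<^sub>m n" "U * transpose_mat U = 1\<^sub>m n"
  shows "proots (char_poly (U * mat_diag n d * transpose_mat U)) = image_mset d (mset [0..<n])"
proof -
  have "char_poly (U * mat_diag n d * transpose_mat U) = char_poly (mat_diag n d)"
    by (intro char_poly_similar similar_matI[of _ _ U "transpose_mat U" n])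
      (use assms in \<open>auto simp: mult_carrier_mat[of _ n n _ n]\<close>)
  also have "\<dots> = (\<Prod>a\<leftarrow>diag_mat (mat_diag n d). [:- a, 1:])"
    by (rule char_poly_upper_triangular[of _ n]) (auto simp: mat_diag_def upper_triangular_def)
  also have "diag_mat (mat_diag n d) = map d [0..<n]" by (auto simp: diag_mat_def mat_diag_def)
  also have "(\<Prod>a\<leftarrow>map d [0..<n]. [:- a, 1:]) = (\<Prod>i\<in>{0..<n}. [:- d i, 1:])"
    by (simp add: prod.distinct_set_conv_list[symmetric] o_def)
  also have "proots \<dots> = (\<Sum>i\<in>{0..<n}. {#d i#})"
    by (subst proots_prod) auto
  also have "\<dots> = image_mset d (mset [0..<n])"
    by (induction n) (auto simp: sum.atLeast0_lessThan_Suc)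
  finally show ?thesis .
qed

lemma nuclear_norm_gram_diag:
  assumes "U \<in> carrier_mat n n" "transpose_mat U * U = 1\<^sub>m n" "U * transpose_mat U = 1\<^sub>m n"
    and "transpose_mat M * M = U * mat_diag n d * transpose_mat U"
  shows "nuclear_norm M = (\<Sum>i<n. sqrt (d i))"
  unfolding nuclear_norm_def singular_values_def assms(4) proots_char_poly_orthogonal_diag[OF assms(1-3)]
  by (simp add: multiset.map_comp o_def sum_unfold_sum_mset atLeast0LessThan[symmetric])

lemma nuclear_norm_symmetric:
  assumes U: "U \<in> carrier_mat n n" "transpose_mat U * U = 1\<^sub>m n" "U * transpose_mat U = 1\<^sub>m n"
    and E: "E = U * mat_diag n d * transpose_mat U"
  shows "nuclear_norm E = (\<Sum>i<n. \<bar>d i\<bar>)"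
proof -
  note as = assoc_mult_mat[of _ n n _ n _ n] mult_carrier_mat[of _ n n _ n]
  have DT: "transpose_mat (mat_diag n d) = mat_diag n d" by (rule eq_matI) (auto simp: mat_diag_def)
  have ET: "transpose_mat E = E"
    using U(1) by (simp add: E DT transpose_mult[of _ n n _ n] as)
  have "transpose_mat E * E = U * mat_diag n d * (transpose_mat U * U) * mat_diag n d * transpose_mat U"
    unfolding ET using U(1) by (simp add: E as)
  also have "\<dots> = U * (mat_diag n d * mat_diag n d) * transpose_mat U"
    using U(1) unfolding U(2) by (simp add: as left_mult_one_mat[of _ n n] del: mat_diag_diag)
  finally have "transpose_mat E * E = U * mat_diag n (\<lambda>i. (d i)\<^sup>2) * transpose_mat U"
    by (simp add: power2_eq_square)
  from nuclear_norm_gram_diag[OF U this] show ?thesis by simp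
qed

lemma nuclear_norm_mat_diag: "nuclear_norm (mat_diag n d) = (\<Sum>i<n. \<bar>d i\<bar>)"
  by (rule nuclear_norm_symmetric[of "1\<^sub>m n"])
    (auto simp: left_mult_one_mat[of _ n n] right_mult_one_mat[of _ n n])

text \<open>In an eigenbasis of \<open>E\<close> the pairing is the sum of
  \<open>C $$ (i, i) * d i\<close>, and the diagonal entries of the contraction \<open>C\<close>
  have modulus at most 1.\<close>

lemma nuclear_norm_dual_le:
  assumes E: "E \<in> carrier_mat n n" "transpose_mat E = E" and W: "W \<in> carrier_mat n n" "op_bounded 1 W"
  shows "frob_inner W E \<le> nuclear_norm E"
proof -
  obtain U d where U: "U \<in> carrier_mat n n" "transpose_mat U * U = 1\<^sub>m n" "U * transpose_mat U = 1\<^sub>m n"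
    and EU: "E = U * mat_diag n d * transpose_mat U" using spectral_theorem[OF E] by blast
  define C where "C = transpose_mat U * (W * U)"
  have C: "C \<in> carrier_mat n n" using U W by (simp add: C_def)
  have "op_bounded (1 * (1 * 1)) C" unfolding C_def
    by (rule op_bounded_mult[of _ _ _ _ n n n, OF op_bounded_orthonormal[of _ n n]
          op_bounded_mult[of _ _ _ _ n n n, OF W(2) op_bounded_orthonormal[of _ n n]]]) (use U W in auto)
  then have entry: "\<bar>C $$ (i, j)\<bar> \<le> 1" if "i < n" "j < n" for i j
    using op_bounded_entry[of 1 C n n] C that by simp
  have "frob_inner W E = frob_inner (W * U) (U * mat_diag n d)"
    unfolding EU using U W frob_inner_mult_right[of W n n "U * mat_diag n d" n "transpose_mat U"]
    by (simp add: mult_carrier_mat[of _ n n _ n])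
  also have "\<dots> = frob_inner C (mat_diag n d)"
    unfolding C_def using U W by (intro frob_inner_mult_left[of _ n n]) auto
  also have "\<dots> = (\<Sum>i<n. \<Sum>j<n. if j = i then C $$ (i, i) * d i else 0)"
    unfolding frob_inner_def using C
    by (intro sum.cong refl) (auto simp: mat_diag_def)
  also have "\<dots> = (\<Sum>i<n. C $$ (i, i) * d i)" by simp
  also have "\<dots> \<le> (\<Sum>i<n. \<bar>d i\<bar>)"
    using entry by (intro sum_mono mult_le_abs) auto
  also have "\<dots> = nuclear_norm E" using nuclear_norm_symmetric[OF U EU] by simp
  finally show ?thesis .
qed

text \<open>The dual matrix is the sign of \<open>E\<close>, obtained by applying \<open>sgn\<close>
  to its eigenvalues. Its symmetry is part of the claim because it later makes a matrix and its
  transpose pair equally.\<close>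

lemma nuclear_norm_dual_attained:
  assumes E: "E \<in> carrier_mat n n" "transpose_mat E = E"
  shows "\<exists>W. W \<in> carrier_mat n n \<and> transpose_mat W = W \<and> op_bounded 1 W \<and> nuclear_norm E = frob_inner W E"
proof -
  obtain U d where U: "U \<in> carrier_mat n n" "transpose_mat U * U = 1\<^sub>m n" "U * transpose_mat U = 1\<^sub>m n"
    and EU: "E = U * mat_diag n d * transpose_mat U" using spectral_theorem[OF E] by blast
  note as = assoc_mult_mat[of _ n n _ n _ n] mult_carrier_mat[of _ n n _ n]
  define S where "S = mat_diag n (\<lambda>i. sgn (d i))"
  have S: "S \<in> carrier_mat n n" by (simp add: S_def)
  have ST: "transpose_mat S = S" by (rule eq_matI) (auto simp: S_def mat_diag_def)
  define W where "W = U * S * transpose_mat U"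
  have W: "W \<in> carrier_mat n n" using U S by (simp add: W_def as)
  have WT: "transpose_mat W = W"
    using U(1) S by (simp add: W_def ST transpose_mult[of _ n n _ n] as)
  have "op_bounded 1 S" unfolding S_def by (rule op_bounded_mat_diag) (auto simp: sgn_if)
  then have "op_bounded (1 * 1 * 1) W" unfolding W_def
    by (intro op_bounded_mult[of _ _ _ _ n n n, OF op_bounded_mult[of _ _ _ _ n n n, OF op_bounded_orthonormal[of _ n n]]
          op_bounded_orthonormal[of _ n n]]) (use U S in auto)
  have D: "mat_diag n d \<in> carrier_mat n n" by simp
  have "frob_inner W E = frob_inner (W * U) (U * mat_diag n d)"
    unfolding EU using U W frob_inner_mult_right[of W n n "U * mat_diag n d" n "transpose_mat U"]
    by (simp add: as)
  also have "\<dots> = frob_inner (transpose_mat U * (W * U)) (mat_diag n d)"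
    using U W by (intro frob_inner_mult_left[of _ n n]) auto
  also have "transpose_mat U * (W * U) = (transpose_mat U * U) * S * (transpose_mat U * U)"
    using U(1) S by (simp add: W_def as)
  also have "\<dots> = S" using U(2) S by simp
  also have "frob_inner S (mat_diag n d) = (\<Sum>i<n. \<Sum>j<n. if j = i then \<bar>d i\<bar> else 0)"
    unfolding frob_inner_def S_def
    by (intro sum.cong refl) (auto simp: mat_diag_def sgn_if abs_if)
  also have "\<dots> = nuclear_norm E" using nuclear_norm_symmetric[OF U EU] by simp
  finally show ?thesis using W WT \<open>op_bounded (1 * 1 * 1) W\<close> by auto
qed

text \<open>The optimal dual matrix of \<open>E\<close> is admissible for \<open>F\<close>, and its
  entries have modulus at most 1. The purpose is continuity, and hence measurability, of the nuclear
  norm.\<close>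

lemma nuclear_norm_lipschitz:
  assumes E: "E \<in> carrier_mat n n" "transpose_mat E = E" and F: "F \<in> carrier_mat n n" "transpose_mat F = F"
  shows "nuclear_norm E - nuclear_norm F \<le> (\<Sum>i<n. \<Sum>j<n. \<bar>E $$ (i, j) - F $$ (i, j)\<bar>)"
proof -
  obtain W where W: "W \<in> carrier_mat n n" "op_bounded 1 W" "nuclear_norm E = frob_inner W E"
    using nuclear_norm_dual_attained[OF E] by blast
  have "nuclear_norm E - nuclear_norm F \<le> frob_inner W E - frob_inner W F"
    using nuclear_norm_dual_le[OF F W(1,2)] W(3) by simp
  also have "\<dots> = (\<Sum>i<n. \<Sum>j<n. W $$ (i, j) * (E $$ (i, j) - F $$ (i, j)))"
    using W(1) by (simp add: frob_inner_def algebra_simps sum_subtractf)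
  also have "\<dots> \<le> (\<Sum>i<n. \<Sum>j<n. \<bar>E $$ (i, j) - F $$ (i, j)\<bar>)"
    using op_bounded_entry[OF W(2,1)] by (intro sum_mono mult_le_abs) auto
  finally show ?thesis .
qed

subsection \<open>Regularised Gram matrices and the pseudoinverse\<close>

text \<open>This and the following rules restate matrix laws with premises on dimensions instead of
  carriers, which the simplifier can discharge without guessing sizes.\<close>

lemma mult_assoc_dim:
  "dim_col A = dim_row B \<Longrightarrow> dim_col B = dim_row C \<Longrightarrow> A * B * C = A * (B * C :: 'a :: semiring_0 mat)"
  by (rule assoc_mult_mat[of A "dim_row A" "dim_row B" B "dim_row C" C "dim_col C"]) (auto intro: carrier_matI)

lemma transpose_mult_dim:
  "dim_col A = dim_row B \<Longrightarrow> transpose_mat (A * B) = transpose_mat B * transpose_mat (A :: 'a :: comm_semiring_0 mat)"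
  by (rule transpose_mult[of A "dim_row A" "dim_row B" B "dim_col B"]) (auto intro: carrier_matI)

lemma one_mult_dim: "dim_row A = n \<Longrightarrow> 1\<^sub>m n * A = (A :: 'a :: semiring_1 mat)"
  by (rule left_mult_one_mat[of A n "dim_col A"]) (auto intro: carrier_matI)

lemma mult_one_dim: "dim_col A = n \<Longrightarrow> A * 1\<^sub>m n = (A :: 'a :: semiring_1 mat)"
  by (rule right_mult_one_mat[of A "dim_row A" n]) (auto intro: carrier_matI)

lemma mult_add_dim:
  "dim_col A = dim_row B \<Longrightarrow> dim_row B = dim_row C \<Longrightarrow> dim_col B = dim_col C \<Longrightarrow>
    A * (B + C) = A * B + A * (C :: 'a :: ring mat)"
  by (rule mult_add_distrib_mat[of A "dim_row A" "dim_row B" B "dim_col B" C]) (auto intro: carrier_matI)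

lemma add_mult_dim:
  "dim_col A = dim_row C \<Longrightarrow> dim_row A = dim_row B \<Longrightarrow> dim_col A = dim_col B \<Longrightarrow>
    (A + B) * C = A * C + B * (C :: 'a :: ring mat)"
  by (rule add_mult_distrib_mat[of A "dim_row A" "dim_col A" B C "dim_col C"]) (auto intro: carrier_matI)

lemma mult_diff_dim:
  "dim_col A = dim_row B \<Longrightarrow> dim_row B = dim_row C \<Longrightarrow> dim_col B = dim_col C \<Longrightarrow>
    A * (B - C) = A * B - A * (C :: 'a :: ring mat)"
  by (rule mult_minus_distrib_mat[of A "dim_row A" "dim_row B" B "dim_col B" C]) (auto intro: carrier_matI)

lemma diff_mult_dim:
  "dim_col A = dim_row C \<Longrightarrow> dim_row A = dim_row B \<Longrightarrow> dim_col A = dim_col B \<Longrightarrow>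
    (A - B) * C = A * C - B * (C :: 'a :: ring mat)"
  by (rule minus_mult_distrib_mat[of A "dim_row A" "dim_col A" B C "dim_col C"]) (auto intro: carrier_matI)

lemma smult_mult_dim:
  "dim_col A = dim_row B \<Longrightarrow> (c \<cdot>\<^sub>m A) * B = c \<cdot>\<^sub>m (A * (B :: 'a :: comm_ring_1 mat))"
  by (rule mult_smult_assoc_mat[of A "dim_row A" "dim_col A" B "dim_col B"]) (auto intro: carrier_matI)

lemma mult_smult_dim:
  "dim_col A = dim_row B \<Longrightarrow> A * (c \<cdot>\<^sub>m B) = c \<cdot>\<^sub>m (A * (B :: 'a :: comm_ring_1 mat))"
  by (rule mult_smult_distrib[of A "dim_row A" "dim_col A" B "dim_col B"]) (auto intro: carrier_matI)

lemma frob_norm_eq_0: "A \<in> carrier_mat m n \<Longrightarrow> frob_norm A = 0 \<Longrightarrow> A = 0\<^sub>m m n"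
  by (intro eq_matI) (auto simp: frob_norm_L2_set L2_set_eq_0_iff)

lemma frob_norm_zero [simp]: "frob_norm (0\<^sub>m m n) = 0"
  by (simp add: frob_norm_def)

lemma frob_norm_smult: "frob_norm (c \<cdot>\<^sub>m A) = \<bar>c\<bar> * frob_norm A"
proof -
  have "frob_norm (c \<cdot>\<^sub>m A) = sqrt (\<Sum>i<dim_row A. \<Sum>j<dim_col A. c\<^sup>2 * (A $$ (i, j))\<^sup>2)"
    by (auto simp: frob_norm_def power_mult_distrib intro!: arg_cong[of _ _ sqrt] sum.cong)
  then show ?thesis by (simp add: frob_norm_def real_sqrt_mult flip: sum_distrib_left)
qed

lemma frob_inner_smult_right:
  "A \<in> carrier_mat m n \<Longrightarrow> B \<in> carrier_mat m n \<Longrightarrow> frob_inner A (c \<cdot>\<^sub>m B) = c * frob_inner A B"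
  by (auto simp: frob_inner_def sum_distrib_left mult_ac intro!: sum.cong)

lemma frob_inner_add_smult:
  assumes Y: "Y \<in> carrier_mat n k" and X: "X \<in> carrier_mat n k"
  shows "frob_inner (Y + d \<cdot>\<^sub>m X) (Y + d \<cdot>\<^sub>m X)
    = frob_inner Y Y + 2 * d * frob_inner X Y + d\<^sup>2 * frob_inner X X"
proof -
  have "frob_inner (Y + d \<cdot>\<^sub>m X) (Y + d \<cdot>\<^sub>m X)
      = (\<Sum>i<n. \<Sum>j<k. Y $$ (i, j) * Y $$ (i, j) + 2 * d * (X $$ (i, j) * Y $$ (i, j)) + d\<^sup>2 * (X $$ (i, j) * X $$ (i, j)))"
    unfolding frob_inner_def using X Y
    by (intro sum.cong) (auto simp: algebra_simps power2_eq_square)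
  then show ?thesis using X Y by (simp add: frob_inner_def sum.distrib sum_distrib_left)
qed

lemma entry_le_frob_norm:
  assumes "A \<in> carrier_mat m n" "i < m" "j < n"
  shows "\<bar>A $$ (i, j)\<bar> \<le> frob_norm A"
proof -
  have "\<bar>A $$ (i, j)\<bar>\<^sup>2 \<le> (\<Sum>x\<in>{..<m} \<times> {..<n}. (A $$ x)\<^sup>2)"
    using member_le_sum[of "(i, j)" "{..<m} \<times> {..<n}" "\<lambda>x. (A $$ x)\<^sup>2"] assms by simp
  also have "\<dots> = (frob_norm A)\<^sup>2"
    unfolding frob_norm_L2_set[OF assms(1)] L2_set_def by (simp add: sum_nonneg)
  finally show ?thesis by (rule power2_le_imp_le) simp
qed

text \<open>The adjugate formula makes every entry a quotient of polynomials in the entries of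
  \<open>A\<close>, from which measurability and continuity follow. For singular \<open>A\<close>
  the value is the zero matrix.\<close>

definition mat_inv :: "real mat \<Rightarrow> real mat" where
  "mat_inv A = inverse (det A) \<cdot>\<^sub>m adj_mat A"

lemma mat_inv:
  assumes A: "A \<in> carrier_mat n n" and d: "det A \<noteq> 0"
  shows "mat_inv A \<in> carrier_mat n n" "A * mat_inv A = 1\<^sub>m n" "mat_inv A * A = 1\<^sub>m n"
proof -
  note a = adj_mat[OF A]
  show "mat_inv A \<in> carrier_mat n n" using a(1) by (simp add: mat_inv_def)
  have "A * mat_inv A = inverse (det A) \<cdot>\<^sub>m (A * adj_mat A)"
    using A a(1) by (simp add: mat_inv_def mult_smult_dim)
  then show "A * mat_inv A = 1\<^sub>m n" using d unfolding a(2) by (auto intro!: eq_matI)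
  have "mat_inv A * A = inverse (det A) \<cdot>\<^sub>m (adj_mat A * A)"
    using A a(1) by (simp add: mat_inv_def smult_mult_dim)
  then show "mat_inv A * A = 1\<^sub>m n" using d unfolding a(3) by (auto intro!: eq_matI)
qed

text \<open>A kernel vector, written as a one-column matrix, would violate the lower bound.\<close>

lemma coercive_det_nonzero:
  fixes A :: "real mat"
  assumes A: "A \<in> carrier_mat n n" and c: "c > 0"
    and co: "\<And>X. X \<in> carrier_mat n 1 \<Longrightarrow> c * frob_norm X \<le> frob_norm (A * X)"
  shows "det A \<noteq> 0"
proof
  assume "det A = 0"
  then obtain v where v: "v \<in> carrier_vec n" "v \<noteq> 0\<^sub>v n" "A *\<^sub>v v = 0\<^sub>v n"
    using det_0_iff_vec_prod_zero_field[OF A] by blast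
  define X where "X = Matrix.mat n 1 (\<lambda>(i, j). v $ i)"
  have X: "X \<in> carrier_mat n 1" by (simp add: X_def)
  have AX: "A * X = 0\<^sub>m n 1"
  proof (rule eq_matI)
    fix i j assume "i < dim_row (0\<^sub>m n 1 :: real mat)" "j < dim_col (0\<^sub>m n 1 :: real mat)"
    then have ij: "i < n" "j = 0" by auto
    have "(A * X) $$ (i, j) = (A *\<^sub>v v) $ i"
      using ij A v(1) by (auto simp: X_def scalar_prod_def intro!: sum.cong)
    then show "(A * X) $$ (i, j) = 0\<^sub>m n 1 $$ (i, j)" using v(3) ij by simp
  qed (use A X in auto)
  have "frob_norm X = 0" using co[OF X] c frob_norm_nonneg[of X] unfolding AX
    by (simp add: mult_le_0_iff del: frob_norm_nonneg)
  then have "X = 0\<^sub>m n 1" using frob_norm_eq_0[OF X] by simp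
  then have "X $$ (i, 0) = 0" if "i < n" for i using that by simp
  then have "v $ i = 0" if "i < n" for i using that by (auto simp: X_def)
  then show False using v by auto
qed

lemma coercive_inverse_bounded:
  assumes A: "A \<in> carrier_mat n n" and c: "c > 0"
    and co: "\<And>X m. X \<in> carrier_mat n m \<Longrightarrow> c * frob_norm X \<le> frob_norm (A * X)"
  shows "op_bounded (1 / c) (mat_inv A)"
  unfolding op_bounded_def
proof (intro allI ballI)
  have d: "det A \<noteq> 0" by (rule coercive_det_nonzero[OF A c co])
  note I = mat_inv[OF A d]
  fix m and X :: "real mat" assume "X \<in> carrier_mat (dim_col (mat_inv A)) m"
  then have X: "X \<in> carrier_mat n m" using I by simp
  have "A * (mat_inv A * X) = X" 
    using assoc_mult_mat[OF A I(1) X] I(2) X by simp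
  moreover have "mat_inv A * X \<in> carrier_mat n m" using I(1) X by simp
  ultimately have "c * frob_norm (mat_inv A * X) \<le> frob_norm X" using co by metis
  then show "frob_norm (mat_inv A * X) \<le> 1 / c * frob_norm X" using c by (simp add: field_simps)
qed

text \<open>Tikhonov regularisation of the Gram matrix: invertible for every \<open>d > 0\<close>,
  whatever the rank of \<open>M\<close>.\<close>

definition reg_gram :: "real \<Rightarrow> real mat \<Rightarrow> real mat" where
  "reg_gram d M = transpose_mat M * M + d \<cdot>\<^sub>m 1\<^sub>m (dim_col M)"

text \<open>Everything rests on expanding the squared norm of \<open>reg_gram d M * X\<close> into
  those of \<open>H * X\<close>, \<open>M * X\<close> and \<open>X\<close> with coefficients 1,
  \<open>2 * d\<close> and \<open>d * d\<close>: the last term gives coercivity, the first one makes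
  \<open>H * G\<close> a contraction.\<close>

lemma reg_gram:
  assumes M: "M \<in> carrier_mat m n" and d: "d > 0"
  defines "H \<equiv> transpose_mat M * M" and "G \<equiv> mat_inv (reg_gram d M)"
  shows "G \<in> carrier_mat n n" "reg_gram d M * G = 1\<^sub>m n" "G * reg_gram d M = 1\<^sub>m n"
    "op_bounded (1 / d) G" "op_bounded 1 (H * G)" "H * G = 1\<^sub>m n - d \<cdot>\<^sub>m G" "G * H = 1\<^sub>m n - d \<cdot>\<^sub>m G"
    "transpose_mat G = G" "det (reg_gram d M) \<noteq> 0"
proof -
  have S: "reg_gram d M \<in> carrier_mat n n" and H: "H \<in> carrier_mat n n"
    using M by (auto simp: reg_gram_def H_def)
  have SX: "reg_gram d M * X = H * X + d \<cdot>\<^sub>m X" if "X \<in> carrier_mat n k" for X k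
    using M that by (simp add: reg_gram_def H_def add_mult_dim smult_mult_dim one_mult_dim)
  have HX: "frob_inner X (H * X) = (frob_norm (M * X))\<^sup>2" if X: "X \<in> carrier_mat n k" for X k
  proof -
    have "frob_inner X (H * X) = frob_inner X (transpose_mat M * (M * X))"
      using M X by (simp add: H_def mult_assoc_dim)
    also have "\<dots> = frob_inner (M * X) (M * X)"
      using frob_inner_mult_left[of X n k "transpose_mat M" m "M * X"] M X by simp
    finally show ?thesis by (simp add: frob_norm_square)
  qed
  have sq: "(frob_norm (reg_gram d M * X))\<^sup>2
      = (frob_norm (H * X))\<^sup>2 + 2 * d * (frob_norm (M * X))\<^sup>2 + d\<^sup>2 * (frob_norm X)\<^sup>2" if X: "X \<in> carrier_mat n k" for X k
  proof -
    have HXc: "H * X \<in> carrier_mat n k" using H X by simp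
    have "frob_inner (H * X + d \<cdot>\<^sub>m X) (H * X + d \<cdot>\<^sub>m X)
       = frob_inner (H * X) (H * X) + 2 * d * frob_inner X (H * X) + d\<^sup>2 * frob_inner X X"
      by (rule frob_inner_add_smult[OF HXc X])
    then show ?thesis unfolding SX[OF X] frob_norm_square HX[OF X, unfolded frob_norm_square] .
  qed
  have co: "d * frob_norm X \<le> frob_norm (reg_gram d M * X)" if X: "X \<in> carrier_mat n k" for X k
    by (rule power2_le_imp_le) (use d in \<open>auto simp: sq[OF X] power_mult_distrib\<close>)
  show det: "det (reg_gram d M) \<noteq> 0" by (rule coercive_det_nonzero[OF S d co])
  show G: "G \<in> carrier_mat n n" and SG: "reg_gram d M * G = 1\<^sub>m n" and GS: "G * reg_gram d M = 1\<^sub>m n"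
    using mat_inv[OF S det] by (auto simp: G_def)
  show "op_bounded (1 / d) G" unfolding G_def by (rule coercive_inverse_bounded[OF S d co])
  have e: "H * G + d \<cdot>\<^sub>m G = 1\<^sub>m n" using SX[OF G] SG by simp
  show HG: "H * G = 1\<^sub>m n - d \<cdot>\<^sub>m G" unfolding e[symmetric]
    by (rule eq_matI) (use H G in \<open>auto simp del: index_mult_mat(1)\<close>)
  have "G * reg_gram d M = G * H + d \<cdot>\<^sub>m G"
    using M G H unfolding reg_gram_def H_def[symmetric] by (simp add: mult_add_dim mult_smult_dim mult_one_dim)
  then have e': "G * H + d \<cdot>\<^sub>m G = 1\<^sub>m n" using GS by simp
  show "G * H = 1\<^sub>m n - d \<cdot>\<^sub>m G" unfolding e'[symmetric]
    by (rule eq_matI) (use H G in \<open>auto simp del: index_mult_mat(1)\<close>)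
  show "op_bounded 1 (H * G)" unfolding op_bounded_def
  proof (intro allI ballI)
    fix k and X :: "real mat" assume "X \<in> carrier_mat (dim_col (H * G)) k"
    then have X: "X \<in> carrier_mat n k" using G by simp
    have Z: "G * X \<in> carrier_mat n k" using G X by simp
    have SZ: "reg_gram d M * (G * X) = X" using assoc_mult_mat[OF S G X] SG X by simp
    have "(frob_norm (H * (G * X)))\<^sup>2 \<le> (frob_norm X)\<^sup>2"
      using sq[OF Z] d unfolding SZ by simp
    then have "frob_norm (H * (G * X)) \<le> frob_norm X" by (rule power2_le_imp_le) simp
    then show "frob_norm (H * G * X) \<le> 1 * frob_norm X" using assoc_mult_mat[OF H G X] by simp
  qed
  have "transpose_mat (d \<cdot>\<^sub>m 1\<^sub>m n) = (d \<cdot>\<^sub>m 1\<^sub>m n :: real mat)" by (rule eq_matI) auto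
  then have ST: "transpose_mat (reg_gram d M) = reg_gram d M"
    using M by (simp add: reg_gram_def transpose_add[of _ n n] transpose_mult_dim)
  have GT: "transpose_mat G * reg_gram d M = 1\<^sub>m n"
    using transpose_mult[OF S G] SG ST by simp
  have "transpose_mat G = transpose_mat G * (reg_gram d M * G)" unfolding SG using G by (simp add: mult_one_dim)
  also have "\<dots> = (transpose_mat G * reg_gram d M) * G" using G S by (simp add: mult_assoc_dim)
  finally show "transpose_mat G = G" unfolding GT using G by simp
qed

text \<open>The symmetric products \<open>M * N\<close> and \<open>N * M\<close> do not depend on
  the choice of \<open>N\<close>; then \<open>N = N * M * N' = N' * M * N' = N'\<close>.\<close>

lemma is_pinv_unique:
  assumes "is_pinv M N" "is_pinv M N'"
  shows "N = N'"
proof -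
  have d: "dim_row N = dim_col M" "dim_col N = dim_row M" "dim_row N' = dim_col M" "dim_col N' = dim_row M"
    using assms unfolding is_pinv_def by auto
  have 1: "M * N * M = M" "N * M * N = N" "transpose_mat (M * N) = M * N" "transpose_mat (N * M) = N * M"
    using assms(1) unfolding is_pinv_def by auto
  have 2: "M * N' * M = M" "N' * M * N' = N'" "transpose_mat (M * N') = M * N'" "transpose_mat (N' * M) = N' * M"
    using assms(2) unfolding is_pinv_def by auto
  have "M * N = transpose_mat (M * N' * M * N)" using 1(3) 2(1) by simp
  also have "\<dots> = transpose_mat ((M * N') * (M * N))" using d by (simp add: mult_assoc_dim)
  also have "\<dots> = (M * N) * (M * N')" by (subst transpose_mult_dim) (use d 1 2 in auto)
  also have "\<dots> = (M * N * M) * N'" using d by (simp add: mult_assoc_dim)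
  finally have a: "M * N = M * N'" using 1(1) by simp
  have "N * M = transpose_mat (N * (M * N' * M))" using 1(4) 2(1) by simp
  also have "\<dots> = transpose_mat ((N * M) * (N' * M))" using d by (simp add: mult_assoc_dim)
  also have "\<dots> = (N' * M) * (N * M)" by (subst transpose_mult_dim) (use d 1 2 in auto)
  also have "\<dots> = N' * (M * N * M)" using d by (simp add: mult_assoc_dim)
  finally have b: "N * M = N' * M" using 1(1) by simp
  have "N = N * M * N'" using 1(2) a d by (metis mult_assoc_dim)
  also have "\<dots> = N'" using 2(2) b by simp
  finally show ?thesis .
qed

text \<open>With \<open>K\<close> the pseudoinverse of the Gram matrix \<open>G\<close>, the
  candidate is \<open>K * transpose_mat M\<close>. The one condition beyond the algebra of diagonal
  matrices is \<open>M * N * M = M\<close>; it holds because \<open>G\<close> and \<open>M\<close>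
  have the same kernel.\<close>

lemma is_pinv_exists: "\<exists>N. is_pinv M N"
proof -
  define m n where "m = dim_row M" and "n = dim_col M"
  define G where "G = transpose_mat M * M"
  have G: "G \<in> carrier_mat n n" "transpose_mat G = G"
    by (auto simp: G_def n_def transpose_mult_dim)
  obtain U e where U: "U \<in> carrier_mat n n" "transpose_mat U * U = 1\<^sub>m n" "U * transpose_mat U = 1\<^sub>m n"
    and GU: "G = U * mat_diag n e * transpose_mat U" using spectral_theorem[OF G] by blast
  note dd = carrier_matD[OF U(1)]
  have D: "dim_row (mat_diag n f) = n" "dim_col (mat_diag n f) = n" for f :: "nat \<Rightarrow> real" by (auto simp: mat_diag_def)
  have DT: "transpose_mat (mat_diag n f) = mat_diag n f" for f :: "nat \<Rightarrow> real" by (rule eq_matI) (auto simp: mat_diag_def)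
  have UU: "transpose_mat U * (U * X) = X" if "dim_row X = n" for X
    using U(2) that dd by (simp add: mult_assoc_dim[symmetric] one_mult_dim)
  have DD: "mat_diag n f * (mat_diag n g * X) = mat_diag n (\<lambda>i. f i * g i) * X" if "dim_row X = n" for X and f g :: "nat \<Rightarrow> real"
    using that by (simp add: mult_assoc_dim[symmetric] D)
  \<comment> \<open>As \<open>inverse 0 = 0\<close>, zero eigenvalues stay zero, as a pseudoinverse
    requires.\<close>
  define K where "K = U * mat_diag n (\<lambda>i. inverse (e i)) * transpose_mat U"
  have K: "dim_row K = n" "dim_col K = n" using dd by (auto simp: K_def)
  have KT: "transpose_mat K = K" using dd D by (simp add: K_def transpose_mult_dim DT mult_assoc_dim)
  have KG: "K * G = U * mat_diag n (\<lambda>i. inverse (e i) * e i) * transpose_mat U"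
    using dd D by (simp add: K_def GU mult_assoc_dim UU DD)
  have ee: "x * (inverse x * x) = x" "inverse x * (x * inverse x) = inverse x" for x :: real
    by (cases "x = 0"; simp)+
  have GKG: "G * (K * G) = G"
    unfolding KG unfolding GU using dd D by (simp add: mult_assoc_dim UU DD ee)
  have KGK: "K * (G * K) = K"
    unfolding K_def GU using dd D by (simp add: mult_assoc_dim UU DD ee)
  have KGT: "transpose_mat (K * G) = K * G"
    unfolding KG using dd D by (simp add: transpose_mult_dim DT mult_assoc_dim)
  define N where "N = K * transpose_mat M"
  have dM: "dim_row M = m" "dim_col M = n" by (auto simp: m_def n_def)
  have N: "dim_row N = n" "dim_col N = m" using K dM by (auto simp: N_def)
  have NM: "N * M = K * G" using K dM by (simp add: N_def G_def mult_assoc_dim)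
  have dG: "dim_row G = n" "dim_col G = n" using G by auto
  have "M * (1\<^sub>m n - K * G) = 0\<^sub>m m n"
  proof -
    \<comment> \<open>\<open>R\<close> lies in the range of \<open>M\<close> while
      \<open>transpose_mat M * R = 0\<close>, so \<open>R\<close> is orthogonal to itself.\<close>
    define R where "R = M * (1\<^sub>m n - K * G)"
    have R: "R \<in> carrier_mat m n" using dM dG by (auto simp: R_def)
    have "transpose_mat M * R = G * (1\<^sub>m n - K * G)" using dM K by (simp add: R_def G_def mult_assoc_dim)
    also have "\<dots> = 0\<^sub>m n n" using dG K by (simp add: mult_diff_dim GKG mult_one_dim) (metis G(1) minus_r_inv_mat)
    finally have MR: "transpose_mat M * R = 0\<^sub>m n n" .
    have "1\<^sub>m n - K * G \<in> carrier_mat n n" "M \<in> carrier_mat m n" using dM dG K by auto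
    then have "frob_inner R (M * (1\<^sub>m n - K * G)) = frob_inner (transpose_mat M * R) (1\<^sub>m n - K * G)"
      using R by (intro frob_inner_mult_left)
    then have "frob_inner R R = frob_inner (0\<^sub>m n n) (1\<^sub>m n - K * G)"
      unfolding MR R_def[symmetric] .
    also have "\<dots> = 0" using dG by (simp add: frob_inner_def del: index_mult_mat(1) index_minus_mat(1))
    finally have "frob_norm R = 0" by (simp add: frob_norm_square[symmetric])
    then show ?thesis using frob_norm_eq_0[OF R] by (simp add: R_def)
  qed
  then have "M - M * (K * G) = 0\<^sub>m m n" using dM dG K by (simp add: mult_diff_dim mult_one_dim)
  then have e: "(M - M * (K * G)) $$ (i, j) = 0" if "i < m" "j < n" for i j using that by simp
  have MKG: "M * (K * G) = M"
  proof (rule eq_matI)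
    fix i j assume "i < dim_row M" "j < dim_col M"
    then show "(M * (K * G)) $$ (i, j) = M $$ (i, j)" using e[of i j] dM dG by (simp del: index_mult_mat(1))
  qed (use dM dG in auto)
  have "is_pinv M N"
    unfolding is_pinv_def
  proof (intro conjI)
    show "N \<in> carrier_mat (dim_col M) (dim_row M)" using N dM by auto
    show "M * N * M = M" using dM N MKG by (simp add: mult_assoc_dim NM)
    show "N * M * N = N" unfolding NM using dM dG K KGK by (simp add: N_def mult_assoc_dim[symmetric])
    show "transpose_mat (M * N) = M * N" using dM K by (simp add: N_def transpose_mult_dim KT mult_assoc_dim)
    show "transpose_mat (N * M) = N * M" unfolding NM by (rule KGT)
  qed
  then show ?thesis by blast
qed

lemma is_pinv_pinv: "is_pinv M (pinv M)"
  unfolding pinv_def using is_pinv_exists is_pinv_unique by (metis theI)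

lemma pinv_eqI: "is_pinv M N \<Longrightarrow> pinv M = N"
  using is_pinv_unique is_pinv_pinv by blast

lemma pinv_carrier: "M \<in> carrier_mat m n \<Longrightarrow> pinv M \<in> carrier_mat n m"
  using is_pinv_pinv[of M] unfolding is_pinv_def by auto

lemma pinv_symmetric:
  assumes "transpose_mat M = M"
  shows "transpose_mat (pinv M) = pinv M"
proof -
  have d: "dim_row M = dim_col M" using assms by (metis index_transpose_mat(2))
  note p = is_pinv_pinv[of M, unfolded is_pinv_def]
  have dN: "dim_row (pinv M) = dim_col M" "dim_col (pinv M) = dim_row M" using p by auto
  have "is_pinv M (transpose_mat (pinv M))"
    unfolding is_pinv_def
  proof (intro conjI)
    show "transpose_mat (pinv M) \<in> carrier_mat (dim_col M) (dim_row M)" using dN d by auto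
    have a: "transpose_mat (pinv M * M) = M * transpose_mat (pinv M)"
      "transpose_mat (M * pinv M) = transpose_mat (pinv M) * M"
      using dN d assms by (auto simp: transpose_mult_dim)
    show "M * transpose_mat (pinv M) * M = M"
      using arg_cong[OF conjunct1[OF conjunct2[OF p]], of transpose_mat] dN d assms by (simp add: transpose_mult_dim mult_assoc_dim)
    show "transpose_mat (pinv M) * M * transpose_mat (pinv M) = transpose_mat (pinv M)"
      using arg_cong[OF conjunct1[OF conjunct2[OF conjunct2[OF p]]], of transpose_mat] dN d assms by (simp add: transpose_mult_dim mult_assoc_dim)
    show "transpose_mat (M * transpose_mat (pinv M)) = M * transpose_mat (pinv M)"
      using p unfolding a[symmetric] by simp
    show "transpose_mat (transpose_mat (pinv M) * M) = transpose_mat (pinv M) * M"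
      using p unfolding a[symmetric] by simp
  qed
  then show ?thesis by (metis pinv_eqI)
qed

text \<open>The factorisation \<open>N = H * K\<close> with
  \<open>K = N * transpose_mat N * N\<close> turns the error, up to sign, into \<open>d\<close>
  times \<open>H * G * K\<close>, and \<open>H * G\<close> is a contraction. So the error is linear
  in \<open>d\<close>, with a constant depending on \<open>M\<close>.\<close>

lemma pinv_regularization_error:
  assumes M: "M \<in> carrier_mat m n"
  shows "\<exists>C. \<forall>d>0. \<forall>i<n. \<forall>j<m. \<bar>(mat_inv (reg_gram d M) * transpose_mat M) $$ (i, j) - pinv M $$ (i, j)\<bar> \<le> d * C"
proof -
  define N where "N = pinv M"
  have N: "N \<in> carrier_mat n m" using pinv_carrier[OF M] by (simp add: N_def)
  note dims = carrier_matD[OF M] carrier_matD[OF N]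
  have p: "M * N * M = M" "N * M * N = N" "transpose_mat (M * N) = M * N" "transpose_mat (N * M) = N * M"
    using is_pinv_pinv[of M] unfolding is_pinv_def N_def by auto
  define K where "K = N * (transpose_mat N * N)"
  have K: "K \<in> carrier_mat n m" using N by (simp add: K_def)
  define H where "H = transpose_mat M * M"
  have H: "H \<in> carrier_mat n n" using M by (simp add: H_def)
  have HN: "H * N = transpose_mat M"
  proof -
    have "H * N = transpose_mat M * transpose_mat (M * N)" unfolding p(3) using dims by (simp add: H_def mult_assoc_dim)
    also have "\<dots> = transpose_mat (M * N * M)" using dims by (simp add: transpose_mult_dim mult_assoc_dim)
    finally show ?thesis by (simp add: p(1))
  qed
  have NK: "N = H * K"
  proof -
    have "N = transpose_mat (N * M) * N" using p by simp
    also have "\<dots> = transpose_mat M * (transpose_mat N * N)" using dims by (simp add: transpose_mult_dim mult_assoc_dim)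
    also have "\<dots> = H * K" unfolding HN[symmetric] using dims H by (simp add: K_def mult_assoc_dim)
    finally show ?thesis .
  qed
  have "\<bar>(mat_inv (reg_gram d M) * transpose_mat M) $$ (i, j) - N $$ (i, j)\<bar> \<le> d * frob_norm K"
    if d: "d > 0" and ij: "i < n" "j < m" for d i j
  proof -
    note r = reg_gram[OF M d, folded H_def]
    define G where "G = mat_inv (reg_gram d M)"
    note r = r[folded G_def]
    have G: "G \<in> carrier_mat n n" by (rule r)
    have "G * transpose_mat M = (G * H) * N" unfolding HN[symmetric] using G H N by simp
    also have "\<dots> = N - d \<cdot>\<^sub>m (G * N)" unfolding r(7) using G N
      by (simp add: diff_mult_dim one_mult_dim smult_mult_dim)
    also have "G * N = (G * H) * K" by (subst NK) (use G H K in simp)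
    also have "\<dots> = H * G * K" using r(6,7) by simp
    finally have e: "G * transpose_mat M = N - d \<cdot>\<^sub>m (H * G * K)" .
    have HGK: "H * G * K \<in> carrier_mat n m" using H G K by simp
    have "\<bar>(H * G * K) $$ (i, j)\<bar> \<le> frob_norm (H * G * K)" by (rule entry_le_frob_norm[OF HGK ij])
    also have "\<dots> \<le> 1 * frob_norm K" by (rule op_boundedD[OF r(5), of n n K m]) (use H G K in simp_all)
    finally have "\<bar>(H * G * K) $$ (i, j)\<bar> \<le> frob_norm K" by simp
    moreover have "(G * transpose_mat M) $$ (i, j) - N $$ (i, j) = - (d * (H * G * K) $$ (i, j))"
      unfolding e using ij N H G K by (simp del: index_mult_mat(1))
    ultimately show ?thesis using d by (simp add: abs_mult G_def[symmetric] del: index_mult_mat(1))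
  qed
  then show ?thesis unfolding N_def by blast
qed

lemma pinv_limit:
  assumes M: "M \<in> carrier_mat m n" and ij: "i < n" "j < m"
  shows "(\<lambda>k. (mat_inv (reg_gram (1 / real (Suc k)) M) * transpose_mat M) $$ (i, j)) \<longlonglongrightarrow> pinv M $$ (i, j)"
proof -
  obtain C where C: "\<And>d. d > 0 \<Longrightarrow> \<bar>(mat_inv (reg_gram d M) * transpose_mat M) $$ (i, j) - pinv M $$ (i, j)\<bar> \<le> d * C"
    using pinv_regularization_error[OF M] ij by blast
  have "(\<lambda>k. (1 / real (Suc k)) * C) \<longlonglongrightarrow> 0"
    using tendsto_mult_left_zero[OF LIMSEQ_inverse_real_of_nat, of C] by (simp add: divide_inverse)
  then have "(\<lambda>k. (mat_inv (reg_gram (1 / real (Suc k)) M) * transpose_mat M) $$ (i, j) - pinv M $$ (i, j)) \<longlonglongrightarrow> 0"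
  proof (rule Lim_null_comparison[rotated], intro always_eventually allI)
    fix k
    show "norm ((mat_inv (reg_gram (1 / real (Suc k)) M) * transpose_mat M) $$ (i, j) - pinv M $$ (i, j)) \<le> 1 / real (Suc k) * C"
      unfolding real_norm_def by (rule C) simp
  qed
  then show ?thesis by (simp add: LIM_zero_iff del: index_mult_mat(1))
qed

subsection \<open>Measurability of matrix operations\<close>

lemma random_matI:
  "(\<And>\<omega>. \<omega> \<in> space M \<Longrightarrow> Y \<omega> \<in> carrier_mat m k) \<Longrightarrow>
   (\<And>i j. i < m \<Longrightarrow> j < k \<Longrightarrow> (\<lambda>\<omega>. Y \<omega> $$ (i, j)) \<in> borel_measurable M) \<Longrightarrow> random_mat M m k Y"
  by (simp add: random_mat_def)

lemma random_mat_carrier: "random_mat M m k Y \<Longrightarrow> \<omega> \<in> space M \<Longrightarrow> Y \<omega> \<in> carrier_mat m k"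
  by (simp add: random_mat_def)

lemma random_mat_entry:
  "random_mat M m k Y \<Longrightarrow> i < m \<Longrightarrow> j < k \<Longrightarrow> (\<lambda>\<omega>. Y \<omega> $$ (i, j)) \<in> borel_measurable M"
  by (simp add: random_mat_def)

lemma random_mat_const: "A \<in> carrier_mat m k \<Longrightarrow> random_mat M m k (\<lambda>_. A)"
  by (auto intro: random_matI)

lemma random_mat_mult:
  assumes Y: "random_mat M m k Y" and Z: "random_mat M k l Z"
  shows "random_mat M m l (\<lambda>\<omega>. Y \<omega> * Z \<omega>)"
proof (rule random_matI)
  fix i j assume ij: "i < m" "j < l"
  have "(\<lambda>\<omega>. \<Sum>p<k. Y \<omega> $$ (i, p) * Z \<omega> $$ (p, j)) \<in> borel_measurable M"
    using random_mat_entry[OF Y] random_mat_entry[OF Z] ij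
    by (intro borel_measurable_sum borel_measurable_times) auto
  moreover have "(Y \<omega> * Z \<omega>) $$ (i, j) = (\<Sum>p<k. Y \<omega> $$ (i, p) * Z \<omega> $$ (p, j))" if "\<omega> \<in> space M" for \<omega>
    using mult_mat_index[OF random_mat_carrier[OF Y that] random_mat_carrier[OF Z that] ij] .
  ultimately show "(\<lambda>\<omega>. (Y \<omega> * Z \<omega>) $$ (i, j)) \<in> borel_measurable M"
    by (simp cong: measurable_cong del: index_mult_mat(1))
qed (rule mult_carrier_mat[OF random_mat_carrier[OF Y] random_mat_carrier[OF Z]])

lemma random_mat_cong:
  assumes Y: "random_mat M m k Y" and "\<And>\<omega>. \<omega> \<in> space M \<Longrightarrow> Y \<omega> = Z \<omega>"
  shows "random_mat M m k Z"
  using assms unfolding random_mat_def by (metis (no_types, lifting) measurable_cong)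

lemma random_mat_entrywise:
  assumes "\<And>\<omega>. \<omega> \<in> space M \<Longrightarrow> Z \<omega> \<in> carrier_mat m k"
    and "\<And>i j \<omega>. i < m \<Longrightarrow> j < k \<Longrightarrow> \<omega> \<in> space M \<Longrightarrow> Z \<omega> $$ (i, j) = f i j \<omega>"
    and "\<And>i j. i < m \<Longrightarrow> j < k \<Longrightarrow> f i j \<in> borel_measurable M"
  shows "random_mat M m k Z"
proof (rule random_matI)
  fix i j assume ij: "i < m" "j < k"
  have "(\<lambda>\<omega>. Z \<omega> $$ (i, j)) \<in> borel_measurable M \<longleftrightarrow> f i j \<in> borel_measurable M"
    by (rule measurable_cong) (rule assms(2)[OF ij])
  then show "(\<lambda>\<omega>. Z \<omega> $$ (i, j)) \<in> borel_measurable M" using assms(3)[OF ij] by simp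
qed (rule assms(1))

lemma random_mat_transpose:
  assumes Y: "random_mat M m k Y" shows "random_mat M k m (\<lambda>\<omega>. transpose_mat (Y \<omega>))"
proof (rule random_mat_entrywise)
  fix i j \<omega> assume "i < k" "j < m" "\<omega> \<in> space M"
  then show "transpose_mat (Y \<omega>) $$ (i, j) = Y \<omega> $$ (j, i)"
    using carrier_matD[OF random_mat_carrier[OF Y]] by simp
qed (simp_all add: random_mat_carrier[OF Y] random_mat_entry[OF Y])

lemma random_mat_add:
  assumes Y: "random_mat M m k Y" and Z: "random_mat M m k Z"
  shows "random_mat M m k (\<lambda>\<omega>. Y \<omega> + Z \<omega>)"
proof (rule random_mat_entrywise)
  fix i j \<omega> assume "i < m" "j < k" "\<omega> \<in> space M"
  then show "(Y \<omega> + Z \<omega>) $$ (i, j) = Y \<omega> $$ (i, j) + Z \<omega> $$ (i, j)"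
    using carrier_matD[OF random_mat_carrier[OF Z]] by simp
next
  fix i j assume "i < m" "j < k"
  then show "(\<lambda>\<omega>. Y \<omega> $$ (i, j) + Z \<omega> $$ (i, j)) \<in> borel_measurable M"
    by (intro borel_measurable_add random_mat_entry[OF Y] random_mat_entry[OF Z])
next
  fix \<omega> assume "\<omega> \<in> space M"
  then show "Y \<omega> + Z \<omega> \<in> carrier_mat m k"
    by (intro add_carrier_mat random_mat_carrier[OF Z])
qed

lemma random_mat_diff:
  assumes Y: "random_mat M m k Y" and Z: "random_mat M m k Z"
  shows "random_mat M m k (\<lambda>\<omega>. Y \<omega> - Z \<omega>)"
proof (rule random_mat_entrywise)
  fix i j \<omega> assume "i < m" "j < k" "\<omega> \<in> space M"
  then show "(Y \<omega> - Z \<omega>) $$ (i, j) = Y \<omega> $$ (i, j) - Z \<omega> $$ (i, j)"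
    using carrier_matD[OF random_mat_carrier[OF Z]] by simp
next
  fix i j assume "i < m" "j < k"
  then show "(\<lambda>\<omega>. Y \<omega> $$ (i, j) - Z \<omega> $$ (i, j)) \<in> borel_measurable M"
    by (intro borel_measurable_diff random_mat_entry[OF Y] random_mat_entry[OF Z])
next
  fix \<omega> assume "\<omega> \<in> space M"
  then show "Y \<omega> - Z \<omega> \<in> carrier_mat m k"
    by (intro minus_carrier_mat random_mat_carrier[OF Z])
qed

lemma borel_measurable_det:
  assumes Y: "random_mat M n n Y"
  shows "(\<lambda>\<omega>. det (Y \<omega>)) \<in> borel_measurable M"
proof -
  have "(\<lambda>\<omega>. \<Sum>p | p permutes {0..<n}. signof p * (\<Prod>i = 0..<n. Y \<omega> $$ (i, p i))) \<in> borel_measurable M"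
    using random_mat_entry[OF Y]
    by (intro borel_measurable_sum borel_measurable_times borel_measurable_const borel_measurable_prod)
      (auto simp: permutes_in_image)
  moreover have "det (Y \<omega>) = (\<Sum>p | p permutes {0..<n}. signof p * (\<Prod>i = 0..<n. Y \<omega> $$ (i, p i)))"
    if "\<omega> \<in> space M" for \<omega>
    using det_def'[OF random_mat_carrier[OF Y that]] .
  ultimately show ?thesis by (simp cong: measurable_cong)
qed

lemma random_mat_mat_delete:
  assumes Y: "random_mat M n n Y" and ij: "i < n" "j < n"
  shows "random_mat M (n - 1) (n - 1) (\<lambda>\<omega>. mat_delete (Y \<omega>) i j)"
proof (rule random_mat_entrywise)
  fix i' j' \<omega> assume "i' < n - 1" "j' < n - 1" "\<omega> \<in> space M"
  then show "mat_delete (Y \<omega>) i j $$ (i', j') = Y \<omega> $$ (if i' < i then i' else Suc i', if j' < j then j' else Suc j')"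
    using carrier_matD[OF random_mat_carrier[OF Y]] by (simp add: mat_delete_def)
next
  fix i' j' assume "i' < n - 1" "j' < n - 1"
  then show "(\<lambda>\<omega>. Y \<omega> $$ (if i' < i then i' else Suc i', if j' < j then j' else Suc j')) \<in> borel_measurable M"
    by (intro random_mat_entry[OF Y]) auto
next
  fix \<omega> assume "\<omega> \<in> space M"
  then show "mat_delete (Y \<omega>) i j \<in> carrier_mat (n - 1) (n - 1)"
    using carrier_matD[OF random_mat_carrier[OF Y]] by (intro carrier_matI) (simp_all add: mat_delete_def)
qed

lemma random_mat_mat_inv:
  assumes Y: "random_mat M n n Y"
  shows "random_mat M n n (\<lambda>\<omega>. mat_inv (Y \<omega>))"
proof (rule random_mat_entrywise[where f = "\<lambda>i j \<omega>. inverse (det (Y \<omega>)) * ((-1) ^ (j + i) * det (mat_delete (Y \<omega>) j i))"])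
  fix \<omega> assume w: "\<omega> \<in> space M"
  note c = random_mat_carrier[OF Y w]
  show "mat_inv (Y \<omega>) \<in> carrier_mat n n" using adj_mat(1)[OF c] by (simp add: mat_inv_def)
  fix i j assume "i < n" "j < n"
  then show "mat_inv (Y \<omega>) $$ (i, j) = inverse (det (Y \<omega>)) * ((-1) ^ (j + i) * det (mat_delete (Y \<omega>) j i))"
    using c adj_mat(1)[OF c] by (simp add: mat_inv_def) (simp add: adj_mat_def cofactor_def)
next
  fix i j assume "i < n" "j < n"
  then show "(\<lambda>\<omega>. inverse (det (Y \<omega>)) * ((-1) ^ (j + i) * det (mat_delete (Y \<omega>) j i))) \<in> borel_measurable M"
    using borel_measurable_det[OF Y] borel_measurable_det[OF random_mat_mat_delete[OF Y]]
    by (intro borel_measurable_times borel_measurable_const borel_measurable_inverse) auto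
qed

lemma random_mat_reg_gram:
  assumes Y: "random_mat M m n Y"
  shows "random_mat M n n (\<lambda>\<omega>. reg_gram d (Y \<omega>))"
proof -
  have "random_mat M n n (\<lambda>\<omega>. transpose_mat (Y \<omega>) * Y \<omega> + d \<cdot>\<^sub>m 1\<^sub>m n)"
    by (intro random_mat_add random_mat_mult[OF random_mat_transpose[OF Y] Y] random_mat_const) simp
  then show ?thesis
    by (rule random_mat_cong) (use random_mat_carrier[OF Y] in \<open>auto simp: reg_gram_def\<close>)
qed

text \<open>The pseudoinverse is not continuous, but it is the pointwise limit of regularised
  expressions whose entries are measurable.\<close>

lemma random_mat_pinv:
  assumes Y: "random_mat M m n Y"
  shows "random_mat M n m (\<lambda>\<omega>. pinv (Y \<omega>))"
proof (rule random_matI)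
  show "pinv (Y \<omega>) \<in> carrier_mat n m" if "\<omega> \<in> space M" for \<omega>
    using pinv_carrier[OF random_mat_carrier[OF Y that]] .
  fix i j assume ij: "i < n" "j < m"
  show "(\<lambda>\<omega>. pinv (Y \<omega>) $$ (i, j)) \<in> borel_measurable M"
  proof (rule borel_measurable_LIMSEQ_real)
    fix \<omega> assume "\<omega> \<in> space M"
    then show "(\<lambda>k. (mat_inv (reg_gram (1 / real (Suc k)) (Y \<omega>)) * transpose_mat (Y \<omega>)) $$ (i, j)) \<longlonglongrightarrow> pinv (Y \<omega>) $$ (i, j)"
      using pinv_limit[OF random_mat_carrier[OF Y] ij] by simp
  next
    fix k
    show "(\<lambda>\<omega>. (mat_inv (reg_gram (1 / real (Suc k)) (Y \<omega>)) * transpose_mat (Y \<omega>)) $$ (i, j)) \<in> borel_measurable M"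
      using random_mat_entry[OF random_mat_mult[OF random_mat_mat_inv[OF random_mat_reg_gram[OF Y]] random_mat_transpose[OF Y]] ij] .
  qed
qed

lemma borel_measurable_frob_norm:
  assumes Y: "random_mat M m n Y"
  shows "(\<lambda>\<omega>. frob_norm (Y \<omega>)) \<in> borel_measurable M"
proof -
  have [measurable]: "(\<lambda>\<omega>. \<Sum>i<m. \<Sum>j<n. (Y \<omega> $$ (i, j))\<^sup>2) \<in> borel_measurable M"
    using random_mat_entry[OF Y] by (intro borel_measurable_sum borel_measurable_power) auto
  have "(\<lambda>\<omega>. sqrt (\<Sum>i<m. \<Sum>j<n. (Y \<omega> $$ (i, j))\<^sup>2)) \<in> borel_measurable M"
    by measurable
  moreover have "frob_norm (Y \<omega>) = sqrt (\<Sum>i<m. \<Sum>j<n. (Y \<omega> $$ (i, j))\<^sup>2)" if "\<omega> \<in> space M" for \<omega>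
    using random_mat_carrier[OF Y that] by (auto simp: frob_norm_def)
  ultimately show ?thesis by (simp cong: measurable_cong)
qed

text \<open>The nuclear norm is defined through roots of a polynomial, so measurability is derived
  from continuity. The map \<open>s\<close> turns any family of reals into a symmetric matrix, so
  that the Lipschitz bound applies at every point of the function space, and it reproduces matrices
  that are already symmetric.\<close>

lemma borel_measurable_nuclear_norm_symmetric:
  assumes Y: "random_mat M n n Y" and sym: "\<And>\<omega>. \<omega> \<in> space M \<Longrightarrow> transpose_mat (Y \<omega>) = Y \<omega>"
  shows "(\<lambda>\<omega>. nuclear_norm (Y \<omega>)) \<in> borel_measurable M"
proof -
  define s where "s h = Matrix.mat n n (\<lambda>(i, j). (h (i, j) + h (j, i)) / 2)" for h :: "nat \<times> nat \<Rightarrow> real"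
  have s: "s h \<in> carrier_mat n n" "transpose_mat (s h) = s h" for h
    by (auto simp: s_def intro!: eq_matI)
  have "isCont (\<lambda>h. nuclear_norm (s h)) h" for h
  proof -
    have c: "isCont (\<lambda>g. (g (i, j) :: real)) h" for i j :: nat
      by (rule continuous_on_interior[of UNIV]) (auto intro: continuous_on_product_coordinates)
    have "((\<lambda>g. \<Sum>i<n. \<Sum>j<n. \<bar>(g (i, j) + g (j, i)) / 2 - (h (i, j) + h (j, i)) / 2\<bar>) \<longlongrightarrow>
        (\<Sum>i<n. \<Sum>j<n. \<bar>(h (i, j) + h (j, i)) / 2 - (h (i, j) + h (j, i)) / 2\<bar>)) (at h)"
      using c unfolding isCont_def by (intro tendsto_intros) auto
    then have "((\<lambda>g. \<Sum>i<n. \<Sum>j<n. \<bar>s g $$ (i, j) - s h $$ (i, j)\<bar>) \<longlongrightarrow> 0) (at h)"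
      by (simp add: s_def)
    then have "((\<lambda>g. nuclear_norm (s g) - nuclear_norm (s h)) \<longlongrightarrow> 0) (at h)"
    proof (rule Lim_null_comparison[rotated], intro always_eventually allI)
      fix g
      have "(\<Sum>i<n. \<Sum>j<n. \<bar>s h $$ (i, j) - s g $$ (i, j)\<bar>) = (\<Sum>i<n. \<Sum>j<n. \<bar>s g $$ (i, j) - s h $$ (i, j)\<bar>)"
        by (simp add: abs_minus_commute)
      then show "norm (nuclear_norm (s g) - nuclear_norm (s h)) \<le> (\<Sum>i<n. \<Sum>j<n. \<bar>s g $$ (i, j) - s h $$ (i, j)\<bar>)"
        using nuclear_norm_lipschitz[OF s[of g] s[of h]] nuclear_norm_lipschitz[OF s[of h] s[of g]]
        unfolding real_norm_def by linarith
    qed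
    then show ?thesis unfolding isCont_def by (simp add: LIM_zero_iff)
  qed
  then have "continuous_on UNIV (\<lambda>h. nuclear_norm (s h))"
    by (simp add: continuous_at_imp_continuous_on)
  then have m: "(\<lambda>h. nuclear_norm (s h)) \<in> borel_measurable borel"
    by (rule borel_measurable_continuous_onI)
  define h where "h \<omega> p = (if fst p < n \<and> snd p < n then Y \<omega> $$ p else 0)" for \<omega> p
  have "h \<in> borel_measurable M"
  proof (rule measurable_coordinatewise_then_product)
    fix p :: "nat \<times> nat"
    show "(\<lambda>\<omega>. h \<omega> p) \<in> borel_measurable M"
      using random_mat_entry[OF Y, of "fst p" "snd p"]
      by (cases "fst p < n \<and> snd p < n") (auto simp: h_def)
  qed
  then have "(\<lambda>\<omega>. nuclear_norm (s (h \<omega>))) \<in> borel_measurable M"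
    by (rule measurable_compose[OF _ m])
  moreover have "nuclear_norm (Y \<omega>) = nuclear_norm (s (h \<omega>))" if w: "\<omega> \<in> space M" for \<omega>
  proof -
    have c: "Y \<omega> \<in> carrier_mat n n" by (rule random_mat_carrier[OF Y w])
    have "Y \<omega> $$ (j, i) = Y \<omega> $$ (i, j)" if "i < n" "j < n" for i j
      using sym[OF w] c that by (metis carrier_matD index_transpose_mat(1))
    then have "Y \<omega> = s (h \<omega>)" by (intro eq_matI) (use c in \<open>auto simp: s_def h_def\<close>)
    then show ?thesis by simp
  qed
  ultimately show ?thesis by (simp cong: measurable_cong)
qed

text \<open>Sorting a multiset has only one result; this turns equality of spectra into equality of
  the ordered values.\<close>

lemma antimono_list_eqI:
  fixes f g :: "nat \<Rightarrow> real"
  assumes m: "image_mset f (mset [0..<n]) = image_mset g (mset [0..<n])"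
    and f: "\<And>i j. i \<le> j \<Longrightarrow> j < n \<Longrightarrow> f j \<le> f i" and g: "\<And>i j. i \<le> j \<Longrightarrow> j < n \<Longrightarrow> g j \<le> g i"
    and i: "i < n"
  shows "f i = g i"
proof -
  have s: "sorted (rev (map h [0..<n]))" if "\<And>i j. i \<le> j \<Longrightarrow> j < n \<Longrightarrow> h j \<le> h i" for h :: "nat \<Rightarrow> real"
    unfolding sorted_rev_iff_nth_mono using that by auto
  have "mset (rev (map f [0..<n])) = mset (rev (map g [0..<n]))" using m by simp
  then have "rev (map f [0..<n]) = rev (map g [0..<n])"
    using s[of f] s[of g] f g by (metis properties_for_sort sorted_sort_id)
  then show ?thesis using i by (simp add: map_eq_conv)
qed

text \<open>The squared eigenvalues and the squared diagonal of any SVD are the spectrum of the same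
  Gram matrix, and both are ordered. The value is therefore the same for every choice of the
  truncated SVD.\<close>

lemma nuclear_norm_truncation_error:
  assumes V: "V \<in> carrier_mat n n" "orthonormal_cols V"
    and A: "A = V * mat_diag n l * transpose_mat V"
    and l: "\<And>i j. i \<le> j \<Longrightarrow> j < n \<Longrightarrow> \<bar>l j\<bar> \<le> \<bar>l i\<bar>"
    and Ar: "is_truncated_svd r A Ar" and r: "r \<le> n"
  shows "nuclear_norm (A - Ar) = (\<Sum>i\<in>{r..<n}. \<bar>l i\<bar>)"
proof -
  have oc: "transpose_mat W * W = 1\<^sub>m n" "W * transpose_mat W = 1\<^sub>m n"
    if "W \<in> carrier_mat n n" "orthonormal_cols W" for W
    using that mat_mult_left_right_inverse[of "transpose_mat W" n W] by (auto simp: orthonormal_cols_def)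
  have D: "dim_row (mat_diag n f) = n" "dim_col (mat_diag n f) = n" for f :: "nat \<Rightarrow> real" by (auto simp: mat_diag_def)
  have DT: "transpose_mat (mat_diag n f) = mat_diag n f" for f :: "nat \<Rightarrow> real" by (rule eq_matI) (auto simp: mat_diag_def)
  have DD: "mat_diag n f * (mat_diag n g * X) = mat_diag n (\<lambda>i. f i * g i) * X" if "dim_row X = n" for X and f g :: "nat \<Rightarrow> real"
    using that by (simp add: mult_assoc_dim[symmetric] D)
  have gram: "transpose_mat (W * mat_diag n f * transpose_mat Z) * (W * mat_diag n f * transpose_mat Z)
      = Z * mat_diag n (\<lambda>i. (f i)\<^sup>2) * transpose_mat Z"
    if W: "W \<in> carrier_mat n n" "orthonormal_cols W" and Z: "Z \<in> carrier_mat n n" for W Z f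
  proof -
    have "transpose_mat W * (W * X) = X" if "dim_row X = n" for X
      using oc(1)[OF W] W(1) that by (simp add: mult_assoc_dim[symmetric] one_mult_dim)
    then show ?thesis using W(1) Z
      by (simp add: transpose_mult_dim D DT mult_assoc_dim DD power2_eq_square)
  qed
  have dA: "dim_row A = n" "dim_col A = n" using V by (auto simp: A)
  obtain W S Z where svd: "is_svd A W S Z"
    and Ar: "Ar = W * Matrix.mat n n (\<lambda>(i, j). if i < r \<and> j < r then S $$ (i, j) else 0) * transpose_mat Z"
    using Ar dA unfolding is_truncated_svd_def by auto
  have W: "W \<in> carrier_mat n n" "orthonormal_cols W" and Z: "Z \<in> carrier_mat n n" "orthonormal_cols Z"
    and S: "S \<in> carrier_mat n n" "\<forall>i<n. \<forall>j<n. i \<noteq> j \<longrightarrow> S $$ (i, j) = 0" "\<forall>i<n. S $$ (i, i) \<ge> 0"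
    "\<forall>j<n. \<forall>i\<le>j. S $$ (j, j) \<le> S $$ (i, i)" and AS: "A = W * S * transpose_mat Z"
    using svd dA unfolding is_svd_def by auto
  define s where "s i = S $$ (i, i)" for i
  have Sd: "S = mat_diag n s" using S(1,2) by (intro eq_matI) (auto simp: mat_diag_def s_def)
  define f where "f i = (if i < r then 0 else s i)" for i
  have S0: "Matrix.mat n n (\<lambda>(i, j). if i < r \<and> j < r then S $$ (i, j) else 0) = mat_diag n (\<lambda>i. if i < r then s i else 0)"
    using S(2) by (intro eq_matI) (auto simp: mat_diag_def s_def)
  have "mat_diag n s - mat_diag n (\<lambda>i. if i < r then s i else 0) = mat_diag n f"
    by (rule eq_matI) (auto simp: mat_diag_def f_def)
  then have "A - Ar = W * mat_diag n f * transpose_mat Z"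
    unfolding AS Ar S0 unfolding Sd using W Z by (simp add: D flip: mult_diff_dim diff_mult_dim)
  then have "transpose_mat (A - Ar) * (A - Ar) = Z * mat_diag n (\<lambda>i. (f i)\<^sup>2) * transpose_mat Z"
    using gram[OF W Z(1)] by simp
  from nuclear_norm_gram_diag[OF Z(1) oc[OF Z] this]
  have nn: "nuclear_norm (A - Ar) = (\<Sum>i<n. \<bar>f i\<bar>)" by simp
  have "V * mat_diag n (\<lambda>i. (l i)\<^sup>2) * transpose_mat V = Z * mat_diag n (\<lambda>i. (s i)\<^sup>2) * transpose_mat Z"
    using gram[OF V V(1), of l] gram[OF W Z(1), of s] A AS Sd by simp
  then have "image_mset (\<lambda>i. (l i)\<^sup>2) (mset [0..<n]) = image_mset (\<lambda>i. (s i)\<^sup>2) (mset [0..<n])"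
    using proots_char_poly_orthogonal_diag[OF V(1) oc[OF V]] proots_char_poly_orthogonal_diag[OF Z(1) oc[OF Z]] by metis
  then have "image_mset sqrt (image_mset (\<lambda>i. (l i)\<^sup>2) (mset [0..<n])) = image_mset sqrt (image_mset (\<lambda>i. (s i)\<^sup>2) (mset [0..<n]))"
    by simp
  then have "image_mset (\<lambda>i. \<bar>l i\<bar>) (mset [0..<n]) = image_mset (\<lambda>i. \<bar>s i\<bar>) (mset [0..<n])"
    by (simp add: multiset.map_comp o_def)
  then have eq: "\<bar>l i\<bar> = \<bar>s i\<bar>" if "i < n" for i
  proof (rule antimono_list_eqI)
    show "\<bar>s j\<bar> \<le> \<bar>s i\<bar>" if "i \<le> j" "j < n" for i j using S(3,4) that by (simp add: s_def)
  qed (use l that in auto)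
  have "(\<Sum>i<n. \<bar>f i\<bar>) = (\<Sum>i\<in>{r..<n}. \<bar>f i\<bar>)"
    by (rule sum.mono_neutral_right) (auto simp: f_def)
  also have "\<dots> = (\<Sum>i\<in>{r..<n}. \<bar>l i\<bar>)" by (rule sum.cong) (auto simp: f_def eq)
  finally show ?thesis using nn by simp
qed

subsection \<open>The residual on the good event\<close>

lemma mat_diag_transpose [simp]: "transpose_mat (mat_diag n f) = mat_diag n f"
  by (rule eq_matI) (auto simp: mat_diag_def)

lemma mat_diag_dims [simp]: "dim_row (mat_diag n f) = n" "dim_col (mat_diag n f) = n"
  by (auto simp: mat_diag_def)

lemma transpose_diff_dim:
  "dim_row A = dim_row B \<Longrightarrow> dim_col A = dim_col B \<Longrightarrow> transpose_mat (A - B) = transpose_mat A - transpose_mat B"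
  by (rule eq_matI) auto

lemma frob_inner_mat_diag:
  "W \<in> carrier_mat n n \<Longrightarrow> frob_inner W (mat_diag n d) = (\<Sum>i<n. W $$ (i, i) * d i)"
proof -
  assume W: "W \<in> carrier_mat n n"
  have "frob_inner W (mat_diag n d) = (\<Sum>i<n. \<Sum>j<n. if j = i then W $$ (i, i) * d i else 0)"
    unfolding frob_inner_def using W by (intro sum.cong) (auto simp: mat_diag_def)
  then show ?thesis by simp
qed

text \<open>The problem in eigenvector coordinates: \<open>J\<close> has the row blocks identity,
  zero and \<open>B\<close>, and \<open>z\<close> is the squared Frobenius norm of \<open>B\<close>
  weighted by the square roots of the trailing moduli. Indices start at 0, so
  \<open>l (r - 1)\<close> and \<open>l k1\<close> are the eigenvalues number \<open>r\<close> and
  \<open>k1 + 1\<close>. The residual is split into five terms, each paired with one optimal dual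
  matrix of \<open>E\<close>.\<close>

lemma residual_nuclear_bound:
  fixes l :: "nat \<Rightarrow> real"
  assumes r: "r > 0" "r \<le> k1" "k1 < n"
    and l: "\<And>i j. i \<le> j \<Longrightarrow> j < n \<Longrightarrow> \<bar>l j\<bar> \<le> \<bar>l i\<bar>" and nz: "l (r - 1) \<noteq> 0"
    and J: "J \<in> carrier_mat n r"
    and J_top: "\<And>i j. i < r \<Longrightarrow> j < r \<Longrightarrow> J $$ (i, j) = (if i = j then 1 else 0)"
    and J_mid: "\<And>i j. r \<le> i \<Longrightarrow> i < k1 \<Longrightarrow> j < r \<Longrightarrow> J $$ (i, j) = 0"
    and z: "z = (\<Sum>i\<in>{k1..<n}. \<Sum>j<r. \<bar>l i\<bar> * (J $$ (i, j))\<^sup>2)" and small: "z \<le> \<bar>l (r - 1)\<bar> / 2"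
  defines "L \<equiv> mat_diag n l"
  defines "M0 \<equiv> transpose_mat J * L * J"
  defines "E \<equiv> L - L * J * mat_inv M0 * transpose_mat J * L"
  shows "det M0 \<noteq> 0" "transpose_mat E = E"
    "nuclear_norm E \<le> (\<Sum>i\<in>{r..<n}. \<bar>l i\<bar>) + 2 * (1 + \<bar>l k1\<bar> / \<bar>l (r - 1)\<bar>) * z
       + 4 * sqrt z * sqrt (\<Sum>i\<in>{k1..<n}. \<bar>l i\<bar>)"
proof -

  \<comment> \<open>Weighted blocks in eigenvector coordinates\<close>
  define \<mu> where "\<mu> = \<bar>l (r - 1)\<bar>"
  have \<mu>: "\<mu> > 0" using nz by (simp add: \<mu>_def)
  define J0 where "J0 = Matrix.mat n r (\<lambda>(i, j). if i = j then 1 else 0 :: real)"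
  define J3 where "J3 = Matrix.mat n r (\<lambda>(i, j). if k1 \<le> i then J $$ (i, j) else 0)"
  define L1 where "L1 = mat_diag r l"
  \<comment> \<open>Up to zero rows, \<open>Y\<close> is \<open>B\<close> weighted by the square
    roots of the trailing moduli, \<open>F\<close> is \<open>\<Lambda>3 * B\<close>, and
    \<open>K\<close> is \<open>transpose_mat B * \<Lambda>3 * B\<close>. In \<open>F = S * G\<close>
    half of the weight sits in \<open>G\<close>, whose norm is at most
    \<open>sqrt z\<close>.\<close>
  define S where "S = mat_diag n (\<lambda>i. if k1 \<le> i then sqrt \<bar>l i\<bar> else 0)"
  define Y where "Y = S * J3"
  define G where "G = mat_diag n (\<lambda>i. sgn (l i)) * Y"
  define K where "K = transpose_mat Y * G"
  define F where "F = S * G"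
  define N where "N = mat_inv M0"
  have J0: "J0 \<in> carrier_mat n r" and J3: "J3 \<in> carrier_mat n r" and L1: "L1 \<in> carrier_mat r r"
    and S: "S \<in> carrier_mat n n" and L: "L \<in> carrier_mat n n"
    by (auto simp: J0_def J3_def L1_def S_def L_def)
  have Y: "Y \<in> carrier_mat n r" using S J3 by (auto simp: Y_def)
  have G: "G \<in> carrier_mat n r" using Y by (auto simp: G_def)
  have K: "K \<in> carrier_mat r r" using Y G by (auto simp: K_def)
  have F: "F \<in> carrier_mat n r" using S G by (auto simp: F_def)
  have M0: "M0 \<in> carrier_mat r r" using J L by (auto simp: M0_def)
  note dims = carrier_matD[OF J0] carrier_matD[OF J3] carrier_matD[OF L1] carrier_matD[OF S] carrier_matD[OF L]
    carrier_matD[OF Y] carrier_matD[OF G] carrier_matD[OF K] carrier_matD[OF F] carrier_matD[OF J] carrier_matD[OF M0]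
  have J03: "J = J0 + J3"
    by (rule eq_matI) (use J r J_top J_mid in \<open>auto simp: J0_def J3_def\<close>, metis not_le)
  have YY: "Y = Matrix.mat n r (\<lambda>(i, j). (if k1 \<le> i then sqrt \<bar>l i\<bar> else 0) * J3 $$ (i, j))"
    unfolding Y_def S_def by (rule mat_diag_mult_left[OF J3])
  have GG: "G = Matrix.mat n r (\<lambda>(i, j). sgn (l i) * Y $$ (i, j))"
    unfolding G_def by (rule mat_diag_mult_left[OF Y])
  have FF: "F = Matrix.mat n r (\<lambda>(i, j). (if k1 \<le> i then sqrt \<bar>l i\<bar> else 0) * G $$ (i, j))"
    unfolding F_def S_def by (rule mat_diag_mult_left[OF G])
  have LJ3: "L * J3 = F"
    unfolding L_def mat_diag_mult_left[OF J3] FF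
    by (rule eq_matI) (auto simp: GG YY J3_def sgn_if)
  have LJ0: "L * J0 = J0 * L1"
    unfolding L_def L1_def mat_diag_mult_left[OF J0] mat_diag_mult_right[OF J0]
    by (rule eq_matI) (auto simp: J0_def)
  have J0F: "transpose_mat J0 * F = 0\<^sub>m r r"
    by (rule eq_matI) (use J0 F r in \<open>auto simp: J0_def FF scalar_prod_def intro!: sum.neutral\<close>)
  have J00: "transpose_mat J0 * J0 = 1\<^sub>m r"
  proof (rule eq_matI)
    fix i j assume "i < dim_row (1\<^sub>m r :: real mat)" "j < dim_col (1\<^sub>m r :: real mat)"
    then have ij: "i < r" "j < r" by auto
    have "(transpose_mat J0 * J0) $$ (i, j) = (\<Sum>k<n. transpose_mat J0 $$ (i, k) * J0 $$ (k, j))"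
      by (rule mult_mat_index[of _ r n _ r]) (use J0 ij in auto)
    also have "\<dots> = (\<Sum>k<n. if k = i then (if i = j then 1 else 0) else 0)"
      using ij r by (intro sum.cong) (auto simp: J0_def)
    finally show "(transpose_mat J0 * J0) $$ (i, j) = 1\<^sub>m r $$ (i, j)" using ij r by simp
  qed (use J0 in auto)
  have J3F: "transpose_mat J3 * F = K"
    unfolding F_def K_def Y_def using dims by (simp add: mult_assoc_dim transpose_mult_dim) (simp add: S_def)
  have FT: "transpose_mat F * J0 = 0\<^sub>m r r"
    using arg_cong[OF J0F, of transpose_mat] dims by (simp add: transpose_mult_dim)
  have LJ: "L * J = J0 * L1 + F"
    unfolding J03 using dims by (simp add: mult_add_dim LJ0 LJ3)
  have "transpose_mat J3 * (L * J0) = transpose_mat (L * J3) * J0"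
    using dims by (simp add: transpose_mult_dim mult_assoc_dim) (simp add: L_def)
  then have J3J0: "transpose_mat J3 * (J0 * L1) = 0\<^sub>m r r" unfolding LJ3 LJ0 FT .
  have TJ: "transpose_mat J = transpose_mat J0 + transpose_mat J3"
    unfolding J03 using J0 J3 by (simp add: transpose_add[of _ n r])
  have M0K: "M0 = L1 + K"
  proof -
    have "M0 = transpose_mat J * (J0 * L1 + F)"
      unfolding LJ[symmetric] M0_def using dims by (simp add: mult_assoc_dim)
    also have "\<dots> = (transpose_mat J0 * J0) * L1 + K"
    proof -
      have "transpose_mat J0 * (J0 * L1) \<in> carrier_mat r r" using J0 L1 by simp
      then show ?thesis
        unfolding TJ using dims K
        by (simp add: mult_add_dim add_mult_dim J3J0 J0F J3F mult_assoc_dim right_add_zero_mat[of _ r r])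
    qed
    finally show ?thesis unfolding J00 using dims by (simp add: one_mult_dim)
  qed
  have GYeq: "transpose_mat G * Y = transpose_mat Y * G"
    unfolding G_def using dims by (simp add: transpose_mult_dim mult_assoc_dim)
  have KT: "transpose_mat K = K"
    using GYeq dims by (simp add: K_def transpose_mult_dim)
  have M0T: "transpose_mat M0 = M0"
    using K L1 KT unfolding M0K by (simp add: transpose_add[of _ r r]) (simp add: L1_def)

  \<comment> \<open>Coercivity of the core matrix\<close>
  have zY: "z = (frob_norm Y)\<^sup>2"
  proof -
    have "(frob_norm Y)\<^sup>2 = (\<Sum>i<n. \<Sum>j<r. (Y $$ (i, j))\<^sup>2)" by (rule frob_norm_square_sum[OF Y])
    also have "\<dots> = (\<Sum>i\<in>{k1..<n}. \<Sum>j<r. (Y $$ (i, j))\<^sup>2)"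
      by (rule sum.mono_neutral_right) (auto simp: YY)
    also have "\<dots> = z" unfolding z
      by (intro sum.cong refl) (auto simp: YY J3_def power_mult_distrib)
    finally show ?thesis by simp
  qed
  have z0: "z \<ge> 0" by (simp add: zY)
  have fY: "frob_norm Y = sqrt z" by (simp add: zY)
  have fG: "frob_norm G \<le> frob_norm Y"
    unfolding G_def using op_boundedD[OF op_bounded_mat_diag[of n "\<lambda>i. sgn (l i)" 1] _ Y, of n] by (simp add: sgn_if)
  have fK: "frob_norm K \<le> z"
  proof -
    have "frob_norm K \<le> frob_norm (transpose_mat Y) * frob_norm G"
      unfolding K_def by (rule frob_norm_mult[of _ r n _ r]) (use Y G in auto)
    also have "\<dots> \<le> frob_norm Y * frob_norm Y" using fG by (simp add: mult_left_mono)
    finally show ?thesis by (simp add: zY power2_eq_square)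
  qed
  \<comment> \<open>\<open>L1\<close> expands by at least \<open>\<mu>\<close>, and \<open>K\<close>
    has norm at most \<open>z\<close>, hence at most \<open>\<mu> / 2\<close>: this is where the
    threshold of the event enters.\<close>
  have co: "\<mu> / 2 * frob_norm X \<le> frob_norm (M0 * X)" if X: "X \<in> carrier_mat r m" for X m
  proof -
    have dX: "dim_row X = r" "dim_col X = m" using X by auto
    have l0: "\<bar>l i\<bar> \<ge> \<mu>" if "i < r" for i using l[of i "r - 1"] r that by (simp add: \<mu>_def)
    have l1: "l i \<noteq> 0" if "i < r" for i using l0[OF that] \<mu> by auto
    have "mat_diag r (\<lambda>i. inverse (l i)) * L1 = 1\<^sub>m r"
      unfolding L1_def mat_diag_diag by (rule eq_matI) (use l1 in \<open>auto simp: mat_diag_def\<close>)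
    then have "X = mat_diag r (\<lambda>i. inverse (l i)) * (L1 * X)"
      using dims dX by (simp add: mult_assoc_dim[symmetric] one_mult_dim)
    moreover have "op_bounded (inverse \<mu>) (mat_diag r (\<lambda>i. inverse (l i)))"
      by (rule op_bounded_mat_diag) (use l0 \<mu> in \<open>auto intro: le_imp_inverse_le\<close>)
    then have "frob_norm (mat_diag r (\<lambda>i. inverse (l i)) * (L1 * X)) \<le> inverse \<mu> * frob_norm (L1 * X)"
      by (rule op_boundedD[of _ _ r r _ m]) (use L1 X in auto)
    ultimately have "frob_norm X \<le> inverse \<mu> * frob_norm (L1 * X)" by simp
    then have a: "\<mu> * frob_norm X \<le> frob_norm (L1 * X)" using \<mu> by (simp add: field_simps)
    have "L1 * X = M0 * X - K * X"
      unfolding M0K using L1 K X by (simp add: add_mult_dim) (rule eq_matI, auto simp del: index_mult_mat(1))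
    then have "frob_norm (L1 * X) \<le> frob_norm (M0 * X) + frob_norm (K * X)"
      using frob_norm_diff[of "M0 * X" r m "K * X"] M0 K X by simp
    moreover have "frob_norm (K * X) \<le> \<mu> / 2 * frob_norm X"
      using frob_norm_mult[OF K X] fK small mult_right_mono[of "frob_norm K" "\<mu> / 2" "frob_norm X"]
      by (simp add: \<mu>_def)
    ultimately show ?thesis using a by linarith
  qed
  show det: "det M0 \<noteq> 0" by (rule coercive_det_nonzero[OF M0 _ co]) (use \<mu> in auto)
  note inv = mat_inv[OF M0 det, folded N_def]
  have N: "N \<in> carrier_mat r r" by (rule inv)
  have "op_bounded (1 / (\<mu> / 2)) N" unfolding N_def by (rule coercive_inverse_bounded[OF M0 _ co]) (use \<mu> in auto)
  then have opN: "op_bounded (2 / \<mu>) N" by simp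
  have NT: "transpose_mat N = N"
  proof -
    have "transpose_mat N * M0 = 1\<^sub>m r" using transpose_mult[OF M0 N] inv(2) M0T by simp
    moreover have "transpose_mat N = transpose_mat N * (M0 * N)" unfolding inv(2) using N by (simp add: mult_one_dim)
    then have "transpose_mat N = (transpose_mat N * M0) * N" using M0 N by (simp add: mult_assoc_dim)
    ultimately show ?thesis using N by simp
  qed
  note dims = dims carrier_matD[OF N]

  \<comment> \<open>Decomposition of the residual\<close>
  define C where "C = 1\<^sub>m r - K * N"
  have C: "C \<in> carrier_mat r r" using K N by (auto simp: C_def)
  note dims = dims carrier_matD[OF C]
  have L1N: "L1 * N = C"
  proof -
    have "M0 * N = L1 * N + K * N" unfolding M0K using dims by (simp add: add_mult_dim)
    then have "1\<^sub>m r = L1 * N + K * N" using inv(2) by simp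
    then show ?thesis unfolding C_def
      by (intro eq_matI) (use dims in \<open>simp_all del: index_mult_mat(1)\<close>)
  qed
  have L1T: "transpose_mat L1 = L1" by (simp add: L1_def)
  have NL1: "N * L1 = transpose_mat C" unfolding L1N[symmetric] using dims by (simp add: transpose_mult_dim NT L1T)
  have CT: "transpose_mat C = 1\<^sub>m r - N * K"
  proof -
    have "transpose_mat (K * N) = N * K" using dims by (simp add: transpose_mult_dim NT KT)
    then show ?thesis unfolding C_def using dims by (simp add: transpose_diff_dim)
  qed
  \<comment> \<open>Resolvent algebra for \<open>M0 = L1 + K\<close> with inverse \<open>N\<close>:
    compressing \<open>N\<close> by \<open>L1\<close> on both sides reproduces \<open>L1\<close> up
    to a correction of the size of \<open>K\<close>.\<close>
  have L1NL1: "L1 * (N * L1) = L1 - (K - K * (N * K))"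
  proof -
    have "L1 * (N * L1) = C * L1" unfolding L1N[symmetric] using dims by (simp add: mult_assoc_dim)
    also have "\<dots> = L1 - K * (N * L1)" unfolding C_def using dims
      by (simp add: diff_mult_dim one_mult_dim mult_assoc_dim)
    also have "K * (N * L1) = K - K * (N * K)" unfolding NL1 CT using dims
      by (simp add: mult_diff_dim mult_one_dim)
    finally show ?thesis .
  qed
  define D where "D = K - K * (N * K)"
  have D: "D \<in> carrier_mat r r" using K N by (auto simp: D_def)
  define T0 where "T0 = L - J0 * L1 * transpose_mat J0"
  define T1 where "T1 = J0 * D * transpose_mat J0"
  define T2 where "T2 = J0 * C * transpose_mat F"
  define T3 where "T3 = F * N * transpose_mat F"
  have T0: "T0 \<in> carrier_mat n n" and T1: "T1 \<in> carrier_mat n n" and T2: "T2 \<in> carrier_mat n n" and T3: "T3 \<in> carrier_mat n n"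
    using L J0 L1 D C F N by (auto simp: T0_def T1_def T2_def T3_def)
  note dims = dims carrier_matD[OF D]
  have JL: "transpose_mat J * L = L1 * transpose_mat J0 + transpose_mat F"
  proof -
    have "transpose_mat J * L = transpose_mat (L * J)" using dims by (simp add: transpose_mult_dim) (simp add: L_def)
    also have "\<dots> = transpose_mat (J0 * L1) + transpose_mat F"
      unfolding LJ using J0 L1 F by (simp add: transpose_add[of _ n r])
    finally show ?thesis using dims by (simp add: transpose_mult_dim L1T)
  qed
  \<comment> \<open>Insert \<open>L * J = J0 * L1 + F\<close> on both sides of \<open>N\<close>; the
    mixed terms carry the factor \<open>C = L1 * N\<close> or its transpose.\<close>
  have Edec: "E = T0 + T1 - T2 - transpose_mat T2 - T3"
  proof -
    have "L * J * N * transpose_mat J * L = (L * J) * (N * (transpose_mat J * L))"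
      using dims by (simp add: mult_assoc_dim)
    also have "\<dots> = (J0 * L1 + F) * (transpose_mat C * transpose_mat J0 + N * transpose_mat F)"
      unfolding LJ JL NL1[symmetric] using dims by (simp add: mult_add_dim mult_assoc_dim)
    also have "\<dots> = J0 * (L1 * transpose_mat C) * transpose_mat J0 + J0 * (L1 * N) * transpose_mat F
        + (F * (transpose_mat C * transpose_mat J0) + T3)"
      using dims by (simp add: mult_add_dim add_mult_dim mult_assoc_dim T3_def)
        (rule eq_matI, simp_all del: index_mult_mat(1))
    also have "L1 * transpose_mat C = L1 - D" using L1NL1 unfolding NL1 D_def .
    also have "F * (transpose_mat C * transpose_mat J0) = transpose_mat T2"
      using dims by (simp add: T2_def transpose_mult_dim mult_assoc_dim)
    finally have e: "L * J * N * transpose_mat J * L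
       = J0 * (L1 - D) * transpose_mat J0 + T2 + (transpose_mat T2 + T3)" unfolding L1N T2_def .
    have "J0 * (L1 - D) * transpose_mat J0 = J0 * L1 * transpose_mat J0 - T1"
      using dims by (simp add: T1_def mult_diff_dim diff_mult_dim)
    then show ?thesis unfolding E_def N_def[symmetric] e T0_def
      by (intro eq_matI) (use T1 T2 T3 dims in \<open>auto simp del: index_mult_mat(1)\<close>)
  qed
  have DT: "transpose_mat D = D"
  proof -
    have "transpose_mat (K * (N * K)) = K * (N * K)" using dims by (simp add: transpose_mult_dim KT NT mult_assoc_dim)
    then show ?thesis unfolding D_def using KT dims by (simp add: transpose_diff_dim)
  qed
  \<comment> \<open>Removing the leading block leaves exactly the eigenvalues after number
    \<open>r\<close>, so \<open>T0\<close> accounts for the optimal error with factor 1.\<close>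
  have T0d: "T0 = mat_diag n (\<lambda>i. if i < r then 0 else l i)"
  proof (rule eq_matI)
    fix i j assume "i < dim_row (mat_diag n (\<lambda>i. if i < r then 0 else l i))" "j < dim_col (mat_diag n (\<lambda>i. if i < r then 0 else l i))"
    then have ij: "i < n" "j < n" by auto
    have J0L: "J0 * L1 \<in> carrier_mat n r" using J0 L1 by simp
    have J0T: "transpose_mat J0 \<in> carrier_mat r n" using J0 by simp
    have "(J0 * L1 * transpose_mat J0) $$ (i, j) = (\<Sum>k<r. (J0 * L1) $$ (i, k) * transpose_mat J0 $$ (k, j))"
      by (rule mult_mat_index[OF J0L J0T ij])
    also have "\<dots> = (\<Sum>k<r. if k = i then (if i = j then l i else 0) else 0)"
      unfolding L1_def mat_diag_mult_right[OF J0] using ij r by (intro sum.cong) (auto simp: J0_def)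
    finally have "(J0 * L1 * transpose_mat J0) $$ (i, j) = (if i < r \<and> i = j then l i else 0)" by simp
    moreover have "T0 $$ (i, j) = L $$ (i, j) - (J0 * L1 * transpose_mat J0) $$ (i, j)"
      unfolding T0_def by (rule index_minus_mat(1)) (use ij J0 in auto)
    ultimately show "T0 $$ (i, j) = mat_diag n (\<lambda>i. if i < r then 0 else l i) $$ (i, j)"
      using ij by (auto simp: L_def mat_diag_def)
  qed (use T0 in auto)
  have T1T: "transpose_mat T1 = T1" and T3T: "transpose_mat T3 = T3"
    unfolding T1_def T3_def using dims by (auto simp: transpose_mult_dim DT NT mult_assoc_dim)
  have E: "E \<in> carrier_mat n n" unfolding Edec by (rule minus_carrier_mat[OF T3])
  have sym: "T $$ (i, j) = T $$ (j, i)" if "transpose_mat T = T" "T \<in> carrier_mat n n" "i < n" "j < n" for T i j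
    using that by (metis carrier_matD index_transpose_mat(1))
  show ET: "transpose_mat E = E"
  proof (rule eq_matI)
    fix i j assume "i < dim_row E" "j < dim_col E"
    then have ij: "i < n" "j < n" using E by auto
    have "transpose_mat T0 = T0" unfolding T0d by simp
    then show "transpose_mat E $$ (i, j) = E $$ (i, j)"
      using ij E carrier_matD[OF T0] carrier_matD[OF T1] carrier_matD[OF T2] carrier_matD[OF T3]
        sym[OF _ T0 ij] sym[OF T1T T1 ij] sym[OF T3T T3 ij] by (simp add: Edec)
  qed (use E in auto)

  \<comment> \<open>Pairings with an optimal dual matrix\<close>
  obtain W where W: "W \<in> carrier_mat n n" "transpose_mat W = W" "op_bounded 1 W" "nuclear_norm E = frob_inner W E"
    using nuclear_norm_dual_attained[OF E ET] by blast
  note dims = dims carrier_matD[OF W(1)]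
  have split: "frob_inner W E = frob_inner W T0 + frob_inner W T1 - frob_inner W T2 - frob_inner W (transpose_mat T2) - frob_inner W T3"
    unfolding Edec using W T0 T1 T2 T3 by (simp add: frob_inner_diff_right[of _ n n] frob_inner_add_right[of _ n n] minus_carrier_mat)
  have b0: "frob_inner W T0 \<le> (\<Sum>i\<in>{r..<n}. \<bar>l i\<bar>)"
  proof -
    have "frob_inner W T0 = (\<Sum>i<n. W $$ (i, i) * (if i < r then 0 else l i))"
      unfolding T0d by (rule frob_inner_mat_diag[OF W(1)])
    also have "\<dots> = (\<Sum>i\<in>{r..<n}. W $$ (i, i) * l i)"
      by (rule sum.mono_neutral_cong_right) auto
    also have "\<dots> \<le> (\<Sum>i\<in>{r..<n}. \<bar>l i\<bar>)"
      using op_bounded_entry[OF W(3,1)] by (intro sum_mono mult_le_abs) auto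
    finally show ?thesis .
  qed
  \<comment> \<open>\<open>T1\<close> is supported on the leading block, so only the compression of
    \<open>W\<close> to that block enters its pairing; it is again a symmetric contraction.\<close>
  define W' where "W' = transpose_mat J0 * (W * J0)"
  have W': "W' \<in> carrier_mat r r" "transpose_mat W' = W'"
    using J0 W dims by (auto simp: W'_def transpose_mult_dim mult_assoc_dim)
  have opJ0: "op_bounded 1 J0" using op_bounded_orthonormal[OF J0 J00] .
  have opJ0T: "frob_norm (transpose_mat J0 * X) \<le> frob_norm X" if X: "X \<in> carrier_mat n m" for X m
  proof -
    have TX: "transpose_mat J0 * X \<in> carrier_mat r m" using J0 X by simp
    have "(frob_norm (transpose_mat J0 * X))\<^sup>2 = (\<Sum>i<r. \<Sum>j<m. (X $$ (i, j))\<^sup>2)"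
      unfolding frob_norm_square_sum[OF TX]
    proof (intro sum.cong refl)
      fix i j assume ij: "i \<in> {..<r}" "j \<in> {..<m}"
      have "(transpose_mat J0 * X) $$ (i, j) = (\<Sum>k<n. transpose_mat J0 $$ (i, k) * X $$ (k, j))"
        by (rule mult_mat_index[of _ r n _ m]) (use J0 X ij in auto)
      also have "\<dots> = (\<Sum>k<n. if k = i then X $$ (i, j) else 0)"
        using ij r by (intro sum.cong) (auto simp: J0_def)
      finally show "((transpose_mat J0 * X) $$ (i, j))\<^sup>2 = (X $$ (i, j))\<^sup>2" using ij r by simp
    qed
    also have "\<dots> \<le> (\<Sum>i<n. \<Sum>j<m. (X $$ (i, j))\<^sup>2)"
      by (rule sum_mono2) (use r in \<open>auto intro: sum_nonneg\<close>)
    also have "\<dots> = (frob_norm X)\<^sup>2" by (rule frob_norm_square_sum[OF X, symmetric])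
    finally show ?thesis by (rule power2_le_imp_le) simp
  qed
  have opW': "frob_norm (W' * X) \<le> frob_norm X" if X: "X \<in> carrier_mat r m" for X m
  proof -
    have "W' * X = transpose_mat J0 * (W * (J0 * X))" using dims X by (simp add: W'_def mult_assoc_dim)
    then have "frob_norm (W' * X) \<le> frob_norm (W * (J0 * X))" using opJ0T[of "W * (J0 * X)" m] W J0 X by simp
    also have "\<dots> \<le> frob_norm (J0 * X)" using op_boundedD[OF W(3,1), of "J0 * X" m] J0 X by simp
    also have "\<dots> = frob_norm X" by (rule frob_norm_orthonormal_mult[OF J0 J00 X])
    finally show ?thesis .
  qed
  \<comment> \<open>One \<open>z\<close> comes from \<open>K\<close>, the other from
    \<open>K * N * K\<close>: its pairing is at most \<open>z * (2 / \<mu>) * z\<close>, and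
    \<open>z \<le> \<mu> / 2\<close>.\<close>
  have b1: "frob_inner W T1 \<le> 2 * z"
  proof -
    have "frob_inner W T1 = frob_inner (W * J0) (J0 * D)"
      unfolding T1_def using frob_inner_mult_right[of W n n "J0 * D" r "transpose_mat J0"] W J0 D by simp
    also have "\<dots> = frob_inner W' D"
      unfolding W'_def by (rule frob_inner_mult_left[of _ n r]) (use W J0 D in auto)
    also have "\<dots> = frob_inner W' K - frob_inner W' (K * (N * K))"
      unfolding D_def by (rule frob_inner_diff_right[of _ r r]) (use W' K N in auto)
    finally have s: "frob_inner W T1 = frob_inner W' K - frob_inner W' (K * (N * K))" .
    have "frob_inner W' K = frob_inner (Y * W') G"
      unfolding K_def using frob_inner_mult_left[of W' r r "transpose_mat Y" n G] W' Y G by simp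
    also have "\<dots> \<le> frob_norm (Y * W') * frob_norm G"
      by (rule frob_cauchy_schwarz[of _ n r]) (use Y W' G in auto)
    also have "frob_norm (Y * W') = frob_norm (W' * transpose_mat Y)"
      using frob_norm_transpose[of "Y * W'"] dims carrier_matD[OF W'(1)] by (simp add: transpose_mult_dim W'(2) del: frob_norm_transpose)
    also have "frob_norm (W' * transpose_mat Y) * frob_norm G \<le> frob_norm (transpose_mat Y) * frob_norm Y"
      by (intro mult_mono fG opW'[of _ n]) (use Y in auto)
    finally have i: "frob_inner W' K \<le> z" by (simp add: zY power2_eq_square)
    have "\<bar>frob_inner W' (K * (N * K))\<bar> = \<bar>frob_inner (K * W') (N * K)\<bar>"
      using frob_inner_mult_left[of W' r r K r "N * K"] W' K N by (simp add: KT)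
    also have "\<dots> \<le> frob_norm (K * W') * frob_norm (N * K)"
      by (rule frob_cauchy_schwarz_abs[of _ r r]) (use K W' N in auto)
    also have "frob_norm (K * W') = frob_norm (W' * K)"
      using frob_norm_transpose[of "K * W'"] dims carrier_matD[OF W'(1)] by (simp add: transpose_mult_dim W'(2) KT del: frob_norm_transpose)
    also have "frob_norm (W' * K) * frob_norm (N * K) \<le> z * (2 / \<mu> * z)"
    proof (rule mult_mono)
      show "frob_norm (W' * K) \<le> z" using opW'[OF K] fK by simp
      have "frob_norm (N * K) \<le> 2 / \<mu> * frob_norm K" by (rule op_boundedD[OF opN N K])
      also have "\<dots> \<le> 2 / \<mu> * z" using fK \<mu> by (intro mult_left_mono) auto
      finally show "frob_norm (N * K) \<le> 2 / \<mu> * z" .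
    qed (use z0 in auto)
    also have "z * (2 / \<mu> * z) = z * (z * 2 / \<mu>)" by simp
    also have "\<dots> \<le> z * 1"
      using small \<mu> z0 by (intro mult_left_mono) (auto simp: \<mu>_def field_simps)
    finally have ii: "\<bar>frob_inner W' (K * (N * K))\<bar> \<le> z" by simp
    show ?thesis using s i ii by linarith
  qed
  have fS: "frob_norm S = sqrt (\<Sum>i\<in>{k1..<n}. \<bar>l i\<bar>)"
  proof -
    have "(frob_norm S)\<^sup>2 = frob_inner S S" by (rule frob_norm_square)
    also have "\<dots> = (\<Sum>i<n. (if k1 \<le> i then sqrt \<bar>l i\<bar> else 0) * (if k1 \<le> i then sqrt \<bar>l i\<bar> else 0))"
      unfolding S_def by (subst frob_inner_mat_diag) (auto simp: mat_diag_def intro!: sum.cong)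
    also have "\<dots> = (\<Sum>i\<in>{k1..<n}. \<bar>l i\<bar>)"
      by (rule sum.mono_neutral_cong_right) auto
    finally show ?thesis by (metis frob_norm_nonneg real_sqrt_unique)
  qed
  have fC: "frob_norm (C * X) \<le> 2 * frob_norm X" if X: "X \<in> carrier_mat r m" for X m
  proof -
    have "C * X = X - K * (N * X)" unfolding C_def using dims X by (simp add: diff_mult_dim one_mult_dim mult_assoc_dim)
    then have "frob_norm (C * X) \<le> frob_norm X + frob_norm (K * (N * X))"
      using frob_norm_diff[of X r m "K * (N * X)"] X K N by simp
    moreover have "frob_norm (K * (N * X)) \<le> z * (2 / \<mu> * frob_norm X)"
    proof -
      have "frob_norm (K * (N * X)) \<le> frob_norm K * frob_norm (N * X)"
        by (rule frob_norm_mult[of _ r r _ m]) (use K N X in auto)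
      also have "\<dots> \<le> z * (2 / \<mu> * frob_norm X)"
        by (intro mult_mono fK op_boundedD[OF opN N X]) (use z0 in auto)
      finally show ?thesis .
    qed
    moreover have "z * (2 / \<mu> * frob_norm X) = (z * 2 / \<mu>) * frob_norm X" by simp
    moreover have "(z * 2 / \<mu>) * frob_norm X \<le> 1 * frob_norm X"
      using small \<mu> by (intro mult_right_mono) (auto simp: \<mu>_def field_simps)
    ultimately show ?thesis by linarith
  qed
  \<comment> \<open>Cauchy-Schwarz with the weight divided evenly: \<open>S\<close> contributes the
    square root of the tail sum, the remaining factor at most \<open>2 * sqrt z\<close>.\<close>
  have b2: "\<bar>frob_inner W T2\<bar> \<le> 2 * sqrt z * sqrt (\<Sum>i\<in>{k1..<n}. \<bar>l i\<bar>)"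
  proof -
    define Q where "Q = J0 * (C * transpose_mat G)"
    have Q: "Q \<in> carrier_mat n n" using J0 C G by (simp add: Q_def)
    have "T2 = Q * S" unfolding T2_def Q_def F_def using dims
      by (simp add: transpose_mult_dim mult_assoc_dim) (simp add: S_def)
    then have "\<bar>frob_inner W T2\<bar> = \<bar>frob_inner (transpose_mat Q * W) S\<bar>"
      using frob_inner_mult_left[OF W(1) Q S] by simp
    also have "\<dots> \<le> frob_norm (transpose_mat Q * W) * frob_norm S"
      by (rule frob_cauchy_schwarz_abs[of _ n n]) (use Q W S in auto)
    also have "frob_norm (transpose_mat Q * W) = frob_norm (W * Q)"
      using frob_norm_transpose[of "W * Q"] W Q by (simp add: transpose_mult_dim del: frob_norm_transpose)
    also have "frob_norm (W * Q) * frob_norm S \<le> (2 * sqrt z) * frob_norm S"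
    proof (rule mult_right_mono)
      have "frob_norm (W * Q) \<le> frob_norm Q" using op_boundedD[OF W(3,1) Q] by simp
      also have "\<dots> = frob_norm (C * transpose_mat G)" unfolding Q_def
        by (rule frob_norm_orthonormal_mult[OF J0 J00, of _ n]) (use C G in auto)
      also have "\<dots> \<le> 2 * frob_norm (transpose_mat G)" by (rule fC[of _ n]) (use G in auto)
      finally show "frob_norm (W * Q) \<le> 2 * sqrt z" using fG fY by simp
    qed simp
    finally show ?thesis by (simp add: fS)
  qed
  \<comment> \<open>Symmetry of \<open>W\<close> makes the two mixed terms equal, whence the factor
    4 in the final bound.\<close>
  have b2': "frob_inner W (transpose_mat T2) = frob_inner W T2"
    using frob_inner_transpose[OF W(1) T2] W(2) by simp
  \<comment> \<open>The weight \<open>S\<close> in \<open>F = S * G\<close> has norm at most the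
    square root of \<open>\<bar>l k1\<bar>\<close>, the largest trailing modulus, and
    \<open>N\<close> has norm at most \<open>2 / \<mu>\<close>; this produces the quotient of
    eigenvalues.\<close>
  have b3: "\<bar>frob_inner W T3\<bar> \<le> 2 * (\<bar>l k1\<bar> / \<mu>) * z"
  proof -
    have "frob_inner W T3 = frob_inner (transpose_mat F * W) (N * transpose_mat F)"
      using frob_inner_mult_left[of W n n F r "N * transpose_mat F"] W F N dims by (simp add: T3_def mult_assoc_dim)
    then have "\<bar>frob_inner W T3\<bar> \<le> frob_norm (transpose_mat F * W) * frob_norm (N * transpose_mat F)"
      using frob_cauchy_schwarz_abs[of "transpose_mat F * W" r n "N * transpose_mat F"] F W N by simp
    also have "frob_norm (transpose_mat F * W) = frob_norm (W * F)"
      using frob_norm_transpose[of "W * F"] W dims by (simp add: transpose_mult_dim del: frob_norm_transpose)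
    also have "frob_norm (W * F) * frob_norm (N * transpose_mat F) \<le> frob_norm F * (2 / \<mu> * frob_norm F)"
    proof (rule mult_mono)
      show "frob_norm (W * F) \<le> frob_norm F" using op_boundedD[OF W(3,1) F] by simp
      show "frob_norm (N * transpose_mat F) \<le> 2 / \<mu> * frob_norm F"
        using op_boundedD[OF opN N, of "transpose_mat F" n] F by simp
    qed auto
    also have "\<dots> = 2 / \<mu> * (frob_norm F)\<^sup>2" by (simp add: power2_eq_square)
    also have "\<dots> \<le> 2 / \<mu> * (\<bar>l k1\<bar> * z)"
    proof (rule mult_left_mono)
      have "op_bounded (sqrt \<bar>l k1\<bar>) S" unfolding S_def
        by (rule op_bounded_mat_diag) (use l in auto)
      then have "frob_norm F \<le> sqrt \<bar>l k1\<bar> * frob_norm G" unfolding F_def by (rule op_boundedD[OF _ S G])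
      also have "\<dots> \<le> sqrt \<bar>l k1\<bar> * sqrt z" using fG fY by (intro mult_left_mono) auto
      finally have "(frob_norm F)\<^sup>2 \<le> (sqrt \<bar>l k1\<bar> * sqrt z)\<^sup>2" by (intro power_mono) auto
      then show "(frob_norm F)\<^sup>2 \<le> \<bar>l k1\<bar> * z" using z0 by (simp add: power_mult_distrib)
    qed (use \<mu> in auto)
    finally show ?thesis by simp
  qed
  have "frob_inner W E \<le> (\<Sum>i\<in>{r..<n}. \<bar>l i\<bar>) + 2 * z + 2 * (2 * sqrt z * sqrt (\<Sum>i\<in>{k1..<n}. \<bar>l i\<bar>)) + 2 * (\<bar>l k1\<bar> / \<mu>) * z"
    using split b0 b1 b2 b2' b3 by linarith
  then show "nuclear_norm E \<le> (\<Sum>i\<in>{r..<n}. \<bar>l i\<bar>) + 2 * (1 + \<bar>l k1\<bar> / \<bar>l (r - 1)\<bar>) * z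
       + 4 * sqrt z * sqrt (\<Sum>i\<in>{k1..<n}. \<bar>l i\<bar>)"
    unfolding W(4) \<mu>_def by (simp add: algebra_simps)
qed

subsection \<open>Gaussian integration by parts\<close>

abbreviation gauss1 :: "real \<Rightarrow> real measure" where
  "gauss1 \<sigma> \<equiv> density lborel (normal_density 0 \<sigma>)"

lemma integrable_gauss1_power: "\<sigma> > 0 \<Longrightarrow> integrable (gauss1 \<sigma>) (\<lambda>t. t ^ k)"
  using integrable_normal_moment[of \<sigma> 0 k] by (subst integrable_density) (auto simp: normal_density_nonneg)

lemma integrable_gauss1_abs: "\<sigma> > 0 \<Longrightarrow> integrable (gauss1 \<sigma>) (\<lambda>t. \<bar>t\<bar>)"
  using integrable_gauss1_power[of \<sigma> 1] by simp

text \<open>These limits remove the boundary terms when integrating by parts over the real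
  line.\<close>

lemma gaussian_tail_limit:
  assumes s: "\<sigma> > 0" and b: "\<And>t. \<bar>f t\<bar> \<le> C * (1 + \<bar>t\<bar>)"
  shows "((\<lambda>t. f t * normal_density 0 \<sigma> t) \<longlongrightarrow> 0) at_top" "((\<lambda>t. f t * normal_density 0 \<sigma> t) \<longlongrightarrow> 0) at_bot"
proof -
  have b': "norm (f t * normal_density 0 \<sigma> t) \<le> C * (1 + \<bar>t\<bar>) * normal_density 0 \<sigma> t" for t
    using mult_right_mono[OF b normal_density_nonneg, of t 0 \<sigma> t] by (simp add: abs_mult)
  have 1: "((\<lambda>t. C * (1 + \<bar>t\<bar>) * normal_density 0 \<sigma> t) \<longlongrightarrow> 0) at_top"
    unfolding normal_density_def using s by real_asymp
  have 2: "((\<lambda>t. C * (1 + \<bar>t\<bar>) * normal_density 0 \<sigma> t) \<longlongrightarrow> 0) at_bot"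
    unfolding normal_density_def using s by real_asymp
  show "((\<lambda>t. f t * normal_density 0 \<sigma> t) \<longlongrightarrow> 0) at_top"
    by (rule Lim_null_comparison[OF _ 1]) (use b' in \<open>intro always_eventually allI\<close>)
  show "((\<lambda>t. f t * normal_density 0 \<sigma> t) \<longlongrightarrow> 0) at_bot"
    by (rule Lim_null_comparison[OF _ 2]) (use b' in \<open>intro always_eventually allI\<close>)
qed

lemma integrable_gauss1_linear_growth:
  assumes s: "\<sigma> > 0" and [measurable]: "f \<in> borel_measurable borel" and b: "\<And>t. \<bar>f t\<bar> \<le> C * (1 + \<bar>t\<bar>)"
  shows "integrable (gauss1 \<sigma>) f" "integrable (gauss1 \<sigma>) (\<lambda>t. t * f t)"
proof -
  interpret prob_space "gauss1 \<sigma>" by (rule prob_space_normal_density[OF s])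
  have i1: "integrable (gauss1 \<sigma>) (\<lambda>t. C * (1 + \<bar>t\<bar>))"
    using integrable_gauss1_abs[OF s] by auto
  have i2: "integrable (gauss1 \<sigma>) (\<lambda>t. C * (\<bar>t\<bar> + t ^ 2))"
    using integrable_gauss1_abs[OF s] integrable_gauss1_power[OF s, of 2] by auto
  have C: "C \<ge> 0" using b[of 0] by simp
  show "integrable (gauss1 \<sigma>) f"
    by (rule Bochner_Integration.integrable_bound[OF i1]) (use b C in auto)
  have "norm (t * f t) \<le> norm (C * (\<bar>t\<bar> + t ^ 2))" for t
  proof -
    have "norm (t * f t) \<le> \<bar>t\<bar> * (C * (1 + \<bar>t\<bar>))" using mult_left_mono[OF b, of "\<bar>t\<bar>" t] by (simp add: abs_mult)
    also have "\<dots> = C * (\<bar>t\<bar> + t ^ 2)" by (simp add: algebra_simps power2_eq_square)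
    also have "\<dots> \<le> norm (C * (\<bar>t\<bar> + t ^ 2))" by simp
    finally show ?thesis .
  qed
  then show "integrable (gauss1 \<sigma>) (\<lambda>t. t * f t)"
    by (intro Bochner_Integration.integrable_bound[OF i2]) auto
qed

text \<open>Stein's identity: the derivative of the density is
  \<open>- (t / \<sigma>\<^sup>2)\<close> times the density, so the derivative of \<open>f\<close>
  times the density contains both integrands. Its integral over the line is zero by the decay at
  both ends.\<close>

lemma stein_1d:
  assumes s: "\<sigma> > 0" and d: "\<And>t. (f has_real_derivative f' t) (at t)" and c: "\<And>t. isCont f' t"
    and b: "\<And>t. \<bar>f t\<bar> \<le> C * (1 + \<bar>t\<bar>)" and b': "\<And>t. \<bar>f' t\<bar> \<le> C * (1 + \<bar>t\<bar>)"
  shows "(\<integral>t. t * f t \<partial>gauss1 \<sigma>) = \<sigma>\<^sup>2 * (\<integral>t. f' t \<partial>gauss1 \<sigma>)"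
proof -
  let ?p = "normal_density 0 \<sigma>"
  have cf: "isCont f t" for t using d DERIV_isCont by blast
  have m [measurable]: "f \<in> borel_measurable borel" "f' \<in> borel_measurable borel"
    by (auto intro!: borel_measurable_continuous_onI continuous_at_imp_continuous_on cf c)
  have dp: "(?p has_real_derivative - (t / \<sigma>\<^sup>2) * ?p t) (at t)" for t
    unfolding normal_density_def using s
    by (auto intro!: derivative_eq_intros simp: field_simps power2_eq_square)
  define g where "g t = f' t * ?p t - (t * f t / \<sigma>\<^sup>2) * ?p t" for t
  have dF: "((\<lambda>t. f t * ?p t) has_real_derivative g t) (at t)" for t
    unfolding g_def by (rule derivative_eq_intros d dp refl | simp add: algebra_simps)+
  have cp: "isCont ?p t" for t using dp DERIV_isCont by blast
  have cg: "isCont g t" for t unfolding g_def using s by (intro continuous_intros c cf cp) auto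
  note i1 = integrable_gauss1_linear_growth[OF s m(2) b'] and i2 = integrable_gauss1_linear_growth[OF s m(1) b]
  have j1: "integrable lborel (\<lambda>t. ?p t * f' t)"
    using i1(1) by (subst (asm) integrable_density) auto
  have j2: "integrable lborel (\<lambda>t. ?p t * (t * f t))"
    using i2(2) by (subst (asm) integrable_density) auto
  have g_eq: "g = (\<lambda>t. ?p t * f' t - (?p t * (t * f t)) / \<sigma>\<^sup>2)" by (auto simp: g_def)
  have ig: "integrable lborel g" unfolding g_eq using j1 j2 by auto
  have "(LBINT x=-\<infinity>..\<infinity>. g x) = 0 - 0"
  proof (rule interval_integral_FTC_integrable)
    show "((\<lambda>t. f t * ?p t) has_vector_derivative g x) (at x)" for x
      using dF by (simp add: has_real_derivative_iff_has_vector_derivative)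
    show "set_integrable lborel (einterval (-\<infinity>) \<infinity>) g" using ig by (simp add: set_integrable_def)
    show "(((\<lambda>t. f t * ?p t) \<circ> real_of_ereal) \<longlongrightarrow> 0) (at_right (-\<infinity>))"
      unfolding ereal_tendsto_simps by (rule gaussian_tail_limit(2)[OF s b])
    show "(((\<lambda>t. f t * ?p t) \<circ> real_of_ereal) \<longlongrightarrow> 0) (at_left \<infinity>)"
      unfolding ereal_tendsto_simps by (rule gaussian_tail_limit(1)[OF s b])
  qed (use cg in auto)
  then have "integral\<^sup>L lborel g = 0"
    by (simp add: interval_lebesgue_integral_def set_lebesgue_integral_def)
  then have "(\<integral>t. ?p t * f' t \<partial>lborel) = (\<integral>t. ?p t * (t * f t) \<partial>lborel) / \<sigma>\<^sup>2"
    unfolding g_eq using j1 j2 by simp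
  then show ?thesis using s by (simp add: integral_density)
qed

abbreviation gaussN :: "real \<Rightarrow> 'i set \<Rightarrow> ('i \<Rightarrow> real) measure" where
  "gaussN \<sigma> I \<equiv> PiM I (\<lambda>_. gauss1 \<sigma>)"

lemma integrable_gaussN_component:
  fixes h :: "real \<Rightarrow> real"
  assumes s: "\<sigma> > 0" and I: "finite I" "i \<in> I" and h: "integrable (gauss1 \<sigma>) h"
  shows "integrable (gaussN \<sigma> I) (\<lambda>x. h (x i))"
proof -
  have "distr (gaussN \<sigma> I) (gauss1 \<sigma>) (\<lambda>x. x i) = gauss1 \<sigma>"
    by (rule distr_PiM_component) (use I prob_space_normal_density[OF s] in auto)
  then have "integrable (distr (gaussN \<sigma> I) (gauss1 \<sigma>) (\<lambda>x. x i)) h" using h by simp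
  moreover have "(\<lambda>x. x i) \<in> measurable (gaussN \<sigma> I) (gauss1 \<sigma>)" using I by simp
  ultimately show ?thesis using integrable_distr[of "\<lambda>x. x i" "gaussN \<sigma> I" "gauss1 \<sigma>" h] by simp
qed

text \<open>The product \<open>x p * F x\<close> has quadratic growth, so second moments of the
  coordinates suffice once mixed products are dominated by sums of squares.\<close>

lemma integrable_gaussN_linear_growth:
  assumes s: "\<sigma> > 0" and I: "finite I" "p \<in> I" and m: "F \<in> borel_measurable (gaussN \<sigma> I)"
    and b: "\<And>x. \<bar>F x\<bar> \<le> C * (1 + (\<Sum>i\<in>I. \<bar>x i\<bar>))"
  shows "integrable (gaussN \<sigma> I) F" "integrable (gaussN \<sigma> I) (\<lambda>x. x p * F x)"
proof -
  interpret prob_space "gaussN \<sigma> I" by (intro prob_space_PiM prob_space_normal_density[OF s])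
  have C: "C \<ge> 0" using b[of "\<lambda>_. 0"] by simp
  have a: "integrable (gaussN \<sigma> I) (\<lambda>x. \<bar>x i\<bar>)" if "i \<in> I" for i
    by (rule integrable_gaussN_component[OF s I(1) that integrable_gauss1_abs[OF s]])
  have a2: "integrable (gaussN \<sigma> I) (\<lambda>x. (x i)^2)" if "i \<in> I" for i
    by (rule integrable_gaussN_component[OF s I(1) that integrable_gauss1_power[OF s]])
  have "integrable (gaussN \<sigma> I) (\<lambda>x. C * (1 + (\<Sum>i\<in>I. \<bar>x i\<bar>)))"
    using a by (intro integrable_mult_right Bochner_Integration.integrable_add Bochner_Integration.integrable_sum) auto
  then show "integrable (gaussN \<sigma> I) F"
    by (rule Bochner_Integration.integrable_bound) (use m b C in \<open>auto simp: sum_nonneg\<close>)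
  have "integrable (gaussN \<sigma> I) (\<lambda>x. C * (\<bar>x p\<bar> + (\<Sum>i\<in>I. (x p)^2 + (x i)^2)))"
    using a a2 I by (intro integrable_mult_right Bochner_Integration.integrable_add Bochner_Integration.integrable_sum) auto
  then show "integrable (gaussN \<sigma> I) (\<lambda>x. x p * F x)"
  proof (rule Bochner_Integration.integrable_bound)
    show "AE x in gaussN \<sigma> I. norm (x p * F x) \<le> norm (C * (\<bar>x p\<bar> + (\<Sum>i\<in>I. (x p)^2 + (x i)^2)))"
    proof (rule AE_I2)
      fix x :: "'a \<Rightarrow> real"
      have "norm (x p * F x) \<le> \<bar>x p\<bar> * (C * (1 + (\<Sum>i\<in>I. \<bar>x i\<bar>)))"
        using mult_left_mono[OF b, of "\<bar>x p\<bar>" x] by (simp add: abs_mult)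
      also have "\<dots> = C * (\<bar>x p\<bar> + (\<Sum>i\<in>I. \<bar>x p\<bar> * \<bar>x i\<bar>))" by (simp add: algebra_simps sum_distrib_left)
      also have "\<dots> \<le> C * (\<bar>x p\<bar> + (\<Sum>i\<in>I. (x p)^2 + (x i)^2))"
      proof (intro mult_left_mono add_left_mono sum_mono C)
        fix i
        have "0 \<le> (\<bar>x p\<bar> - \<bar>x i\<bar>)\<^sup>2" by simp
        then have "2 * (\<bar>x p\<bar> * \<bar>x i\<bar>) \<le> (x p)^2 + (x i)^2" by (simp add: power2_diff)
        moreover have "0 \<le> \<bar>x p\<bar> * \<bar>x i\<bar>" by simp
        ultimately show "\<bar>x p\<bar> * \<bar>x i\<bar> \<le> (x p)^2 + (x i)^2" by linarith
      qed
      finally show "norm (x p * F x) \<le> norm (C * (\<bar>x p\<bar> + (\<Sum>i\<in>I. (x p)^2 + (x i)^2)))" by simp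
    qed
    have "(\<lambda>x. x p) \<in> borel_measurable (gaussN \<sigma> I)" using I by measurable
    then show "(\<lambda>x. x p * F x) \<in> borel_measurable (gaussN \<sigma> I)" using m by (rule borel_measurable_times)
  qed
qed

text \<open>By Fubini, integrate over coordinate \<open>p\<close> first and apply the
  one-dimensional identity with the other coordinates frozen. The derivative is demanded at every
  point, which is why the later integrands are regularised.\<close>

lemma stein_coordinate:
  fixes F F' :: "('i \<Rightarrow> real) \<Rightarrow> real"
  assumes s: "\<sigma> > 0" and I: "finite I" "p \<in> I"
    and m: "F \<in> borel_measurable (gaussN \<sigma> I)" "F' \<in> borel_measurable (gaussN \<sigma> I)"
    and d: "\<And>x t. ((\<lambda>t. F (x(p := t))) has_real_derivative F' (x(p := t))) (at t)"
    and c: "\<And>x t. isCont (\<lambda>t. F' (x(p := t))) t"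
    and b: "\<And>x. \<bar>F x\<bar> \<le> C * (1 + (\<Sum>i\<in>I. \<bar>x i\<bar>))" "\<And>x. \<bar>F' x\<bar> \<le> C * (1 + (\<Sum>i\<in>I. \<bar>x i\<bar>))"
  shows "(\<integral>x. x p * F x \<partial>gaussN \<sigma> I) = \<sigma>\<^sup>2 * (\<integral>x. F' x \<partial>gaussN \<sigma> I)"
proof -
  define J where "J = I - {p}"
  have J: "finite J" "p \<notin> J" "I = insert p J" using I by (auto simp: J_def)
  have C: "C \<ge> 0" using b(1)[of "\<lambda>_. 0"] by simp
  interpret product_sigma_finite "\<lambda>_ :: 'i. gauss1 \<sigma>"
    by (intro product_sigma_finite.intro prob_space_imp_sigma_finite prob_space_normal_density[OF s])
  note i1 = integrable_gaussN_linear_growth[OF s I m(1) b(1)] and i2 = integrable_gaussN_linear_growth[OF s I m(2) b(2)]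
  have "(\<integral>x. x p * F x \<partial>gaussN \<sigma> I) = (\<integral>x. \<integral>t. t * F (x(p := t)) \<partial>gauss1 \<sigma> \<partial>gaussN \<sigma> J)"
    using product_integral_insert[OF J(1,2), of "\<lambda>x. x p * F x"] i1(2) unfolding J(3) by simp
  also have "\<dots> = (\<integral>x. \<sigma>\<^sup>2 * (\<integral>t. F' (x(p := t)) \<partial>gauss1 \<sigma>) \<partial>gaussN \<sigma> J)"
  proof (intro Bochner_Integration.integral_cong refl)
    fix x :: "'i \<Rightarrow> real"
    define B where "B = (\<Sum>i\<in>J. \<bar>x i\<bar>)"
    have B: "B \<ge> 0" by (simp add: B_def sum_nonneg)
    have sum: "(\<Sum>i\<in>I. \<bar>(x(p := t)) i\<bar>) = \<bar>t\<bar> + B" for t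
    proof -
      have "(\<Sum>i\<in>J. \<bar>(x(p := t)) i\<bar>) = B" unfolding B_def using J(2) by (intro sum.cong) auto
      then show ?thesis using J by simp
    qed
    have e: "C * (1 + (\<bar>t\<bar> + B)) \<le> C * (1 + B) * (1 + \<bar>t\<bar>)" for t
      using B C by (simp add: algebra_simps)
    show "(\<integral>t. t * F (x(p := t)) \<partial>gauss1 \<sigma>) = \<sigma>\<^sup>2 * (\<integral>t. F' (x(p := t)) \<partial>gauss1 \<sigma>)"
    proof (rule stein_1d[OF s, where C = "C * (1 + B)"])
      show "\<bar>F (x(p := t))\<bar> \<le> C * (1 + B) * (1 + \<bar>t\<bar>)" for t using b(1)[of "x(p := t)"] e[of t] unfolding sum by (rule order_trans)
      show "\<bar>F' (x(p := t))\<bar> \<le> C * (1 + B) * (1 + \<bar>t\<bar>)" for t using b(2)[of "x(p := t)"] e[of t] unfolding sum by (rule order_trans)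
    qed (use d c in auto)
  qed
  also have "\<dots> = \<sigma>\<^sup>2 * (\<integral>x. F' x \<partial>gaussN \<sigma> I)"
    using product_integral_insert[OF J(1,2), of F'] i2(1) unfolding J(3) by simp
  finally show ?thesis .
qed

subsection \<open>Derivatives of matrix-valued functions\<close>

text \<open>\<open>F'\<close> is the value of the derivative at \<open>t\<close>. Sizes are demanded
  for all \<open>s\<close>, so that entries of products expand into sums of fixed length.\<close>

definition mat_deriv :: "nat \<Rightarrow> nat \<Rightarrow> (real \<Rightarrow> real mat) \<Rightarrow> real mat \<Rightarrow> real \<Rightarrow> bool" where
  "mat_deriv m n F F' t \<longleftrightarrow> (\<forall>s. F s \<in> carrier_mat m n) \<and> F' \<in> carrier_mat m n \<and>
    (\<forall>i<m. \<forall>j<n. ((\<lambda>s. F s $$ (i, j)) has_real_derivative F' $$ (i, j)) (at t))"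

lemma mat_derivD:
  assumes "mat_deriv m n F F' t"
  shows "F s \<in> carrier_mat m n" "F' \<in> carrier_mat m n"
    "i < m \<Longrightarrow> j < n \<Longrightarrow> ((\<lambda>s. F s $$ (i, j)) has_real_derivative F' $$ (i, j)) (at t)"
    "i < m \<Longrightarrow> j < n \<Longrightarrow> isCont (\<lambda>s. F s $$ (i, j)) t"
  using assms by (auto simp: mat_deriv_def intro: DERIV_isCont)

lemma mat_deriv_mult:
  assumes F: "mat_deriv m n F F' t" and G: "mat_deriv n p G G' t"
  shows "mat_deriv m p (\<lambda>s. F s * G s) (F' * G t + F t * G') t"
  unfolding mat_deriv_def
proof (intro conjI allI impI)
  note f = mat_derivD[OF F] and g = mat_derivD[OF G]
  show "F s * G s \<in> carrier_mat m p" for s by (rule mult_carrier_mat[OF f(1) g(1)])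
  show "F' * G t + F t * G' \<in> carrier_mat m p"
    by (intro add_carrier_mat mult_carrier_mat[OF f(1) g(2)])
  fix i j assume ij: "i < m" "j < p"
  have "((\<lambda>s. \<Sum>k<n. F s $$ (i, k) * G s $$ (k, j)) has_real_derivative
      (\<Sum>k<n. F' $$ (i, k) * G t $$ (k, j) + F t $$ (i, k) * G' $$ (k, j))) (at t)"
  proof (rule DERIV_sum)
    fix k assume "k \<in> {..<n}"
    then have d: "((\<lambda>s. F s $$ (i, k)) has_real_derivative F' $$ (i, k)) (at t)"
      "((\<lambda>s. G s $$ (k, j)) has_real_derivative G' $$ (k, j)) (at t)"
      using f(3) g(3) ij by auto
    show "((\<lambda>s. F s $$ (i, k) * G s $$ (k, j)) has_real_derivative
      F' $$ (i, k) * G t $$ (k, j) + F t $$ (i, k) * G' $$ (k, j)) (at t)"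
      using DERIV_mult[OF d] by (simp add: algebra_simps)
  qed
  moreover have "(F s * G s) $$ (i, j) = (\<Sum>k<n. F s $$ (i, k) * G s $$ (k, j))" for s
    by (rule mult_mat_index[OF f(1) g(1) ij])
  moreover have "(F' * G t + F t * G') $$ (i, j) = (F' * G t) $$ (i, j) + (F t * G') $$ (i, j)"
    by (rule index_add_mat(1)) (use carrier_matD[OF f(1)] carrier_matD[OF g(2)] ij in auto)
  moreover have "(F' * G t) $$ (i, j) = (\<Sum>k<n. F' $$ (i, k) * G t $$ (k, j))"
    by (rule mult_mat_index[OF f(2) g(1) ij])
  moreover have "(F t * G') $$ (i, j) = (\<Sum>k<n. F t $$ (i, k) * G' $$ (k, j))"
    by (rule mult_mat_index[OF f(1) g(2) ij])
  ultimately show "((\<lambda>s. (F s * G s) $$ (i, j)) has_real_derivative (F' * G t + F t * G') $$ (i, j)) (at t)"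
    by (simp add: sum.distrib del: index_mult_mat(1))
qed

lemma mat_deriv_transpose:
  assumes F: "mat_deriv m n F F' t"
  shows "mat_deriv n m (\<lambda>s. transpose_mat (F s)) (transpose_mat F') t"
  unfolding mat_deriv_def
proof (intro conjI allI impI)
  note f = mat_derivD[OF F]
  show "transpose_mat (F s) \<in> carrier_mat n m" for s using f(1) by simp
  show "transpose_mat F' \<in> carrier_mat n m" using f(2) by simp
  fix i j assume ij: "i < n" "j < m"
  then show "((\<lambda>s. transpose_mat (F s) $$ (i, j)) has_real_derivative transpose_mat F' $$ (i, j)) (at t)"
    using f(3)[OF ij(2,1)] carrier_matD[OF f(1)] carrier_matD[OF f(2)] by simp
qed

lemma mat_deriv_add_const:
  assumes F: "mat_deriv m n F F' t" and C: "C \<in> carrier_mat m n"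
  shows "mat_deriv m n (\<lambda>s. F s + C) F' t"
  unfolding mat_deriv_def
proof (intro conjI allI impI)
  note f = mat_derivD[OF F]
  show "F s + C \<in> carrier_mat m n" for s by (rule add_carrier_mat[OF C])
  show "F' \<in> carrier_mat m n" by (rule f)
  fix i j assume ij: "i < m" "j < n"
  then show "((\<lambda>s. (F s + C) $$ (i, j)) has_real_derivative F' $$ (i, j)) (at t)"
    using DERIV_add[OF f(3)[OF ij] DERIV_const[of "C $$ (i, j)"]] carrier_matD[OF C] by simp
qed

lemma isCont_det:
  fixes A :: "real \<Rightarrow> real mat"
  assumes A: "\<And>s. A s \<in> carrier_mat n n" and c: "\<And>i j. i < n \<Longrightarrow> j < n \<Longrightarrow> isCont (\<lambda>s. A s $$ (i, j)) t"
  shows "isCont (\<lambda>s. det (A s)) t"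
proof -
  have "isCont (\<lambda>s. \<Sum>p | p permutes {0..<n}. signof p * (\<Prod>i = 0..<n. A s $$ (i, p i))) t"
    using c by (intro continuous_intros) (auto simp: permutes_in_image)
  then show ?thesis by (simp add: det_def'[OF A])
qed

lemma isCont_mat_inv:
  fixes A :: "real \<Rightarrow> real mat"
  assumes A: "\<And>s. A s \<in> carrier_mat n n" and c: "\<And>i j. i < n \<Longrightarrow> j < n \<Longrightarrow> isCont (\<lambda>s. A s $$ (i, j)) t"
    and d: "det (A t) \<noteq> 0" and ij: "i < n" "j < n"
  shows "isCont (\<lambda>s. mat_inv (A s) $$ (i, j)) t"
proof -
  have e: "mat_inv (A s) $$ (i, j) = inverse (det (A s)) * ((-1) ^ (j + i) * det (mat_delete (A s) j i))" for s
    using A adj_mat(1)[OF A] ij carrier_matD[OF A] by (simp add: mat_inv_def) (simp add: adj_mat_def cofactor_def)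
  have "isCont (\<lambda>s. det (mat_delete (A s) j i)) t"
  proof (rule isCont_det)
    show "mat_delete (A s) j i \<in> carrier_mat (n - 1) (n - 1)" for s
      using A by (intro carrier_matI) (simp_all add: mat_delete_def carrier_matD[OF A])
    fix i' j' assume "i' < n - 1" "j' < n - 1"
    then show "isCont (\<lambda>s. mat_delete (A s) j i $$ (i', j')) t"
      using c by (simp add: mat_delete_def carrier_matD[OF A])
  qed
  then show ?thesis unfolding e using isCont_det[OF A c] d by (intro continuous_intros) auto
qed

text \<open>The resolvent identity writes \<open>G s - G t\<close> as minus
  \<open>G s * (A s - A t) * G t\<close>; after division by \<open>s - t\<close> only continuity of
  \<open>G\<close> is missing, and the adjugate formula supplies it.\<close>

lemma mat_deriv_mat_inv:
  assumes A: "mat_deriv n n A A' t" and d: "\<And>s. det (A s) \<noteq> 0"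
  defines "G \<equiv> \<lambda>s. mat_inv (A s)"
  shows "mat_deriv n n G (- (G t * A' * G t)) t"
  unfolding mat_deriv_def
proof (intro conjI allI impI)
  note a = mat_derivD[OF A]
  note inv = mat_inv[OF a(1) d, folded G_def]
  show G: "G s \<in> carrier_mat n n" for s unfolding G_def by (rule mat_inv(1)[OF a(1) d])
  have dims: "dim_row (G s) = n" "dim_col (G s) = n" "dim_row (A s) = n" "dim_col (A s) = n" "dim_row A' = n" "dim_col A' = n" for s
    using carrier_matD[OF G] carrier_matD[OF a(1)] carrier_matD[OF a(2)] by auto
  show GAG: "- (G t * A' * G t) \<in> carrier_mat n n" by (intro carrier_matI) (simp_all add: dims)
  have inv1: "A s * G s = 1\<^sub>m n" "G s * A s = 1\<^sub>m n" for s
    unfolding G_def by (rule mat_inv[OF a(1) d])+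
  fix i j assume ij: "i < n" "j < n"
  have triple: "(P * Q * R) $$ (i, j) = (\<Sum>q<n. (\<Sum>p<n. P $$ (i, p) * Q $$ (p, q)) * R $$ (q, j))"
    if "P \<in> carrier_mat n n" "Q \<in> carrier_mat n n" "R \<in> carrier_mat n n" for P Q R :: "real mat"
  proof -
    have "(P * Q * R) $$ (i, j) = (\<Sum>q<n. (P * Q) $$ (i, q) * R $$ (q, j))"
      by (rule mult_mat_index[of _ n n _ n]) (use that ij in auto)
    also have "\<dots> = (\<Sum>q<n. (\<Sum>p<n. P $$ (i, p) * Q $$ (p, q)) * R $$ (q, j))"
      using mult_mat_index[OF that(1,2) ij(1)] by (intro sum.cong) auto
    finally show ?thesis .
  qed
  have res: "G s $$ (i, j) - G t $$ (i, j) = - (\<Sum>q<n. (\<Sum>p<n. G s $$ (i, p) * (A s $$ (p, q) - A t $$ (p, q))) * G t $$ (q, j))" for s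
  proof -
    have "G s * (A s - A t) * G t = G s * A s * G t - G s * (A t * G t)"
      by (simp add: mult_diff_dim diff_mult_dim mult_assoc_dim dims)
    also have "\<dots> = G t - G s" by (simp add: inv1 one_mult_dim mult_one_dim dims)
    finally have e: "G s * (A s - A t) * G t = G t - G s" .
    have "(G s * (A s - A t) * G t) $$ (i, j) = (\<Sum>q<n. (\<Sum>p<n. G s $$ (i, p) * (A s $$ (p, q) - A t $$ (p, q))) * G t $$ (q, j))"
      by (subst triple[OF G _ G]) (auto intro!: sum.cong minus_carrier_mat a(1) simp: dims)
    then show ?thesis unfolding e using ij by (simp add: dims)
  qed
  have "((\<lambda>s. (G s $$ (i, j) - G t $$ (i, j)) / (s - t)) \<longlongrightarrow>
     - (\<Sum>q<n. (\<Sum>p<n. G t $$ (i, p) * A' $$ (p, q)) * G t $$ (q, j))) (at t)"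
  proof -
    have "(G s $$ (i, j) - G t $$ (i, j)) / (s - t)
      = - (\<Sum>q<n. (\<Sum>p<n. G s $$ (i, p) * ((A s $$ (p, q) - A t $$ (p, q)) / (s - t))) * G t $$ (q, j))" for s
      unfolding res by (simp add: sum_divide_distrib sum_distrib_right)
    moreover have "((\<lambda>s. - (\<Sum>q<n. (\<Sum>p<n. G s $$ (i, p) * ((A s $$ (p, q) - A t $$ (p, q)) / (s - t))) * G t $$ (q, j))) \<longlongrightarrow>
      - (\<Sum>q<n. (\<Sum>p<n. G t $$ (i, p) * A' $$ (p, q)) * G t $$ (q, j))) (at t)"
    proof (intro tendsto_minus tendsto_sum tendsto_mult tendsto_const)
      fix p q assume "q \<in> {..<n}" "p \<in> {..<n}"
      then show "((\<lambda>s. (A s $$ (p, q) - A t $$ (p, q)) / (s - t)) \<longlongrightarrow> A' $$ (p, q)) (at t)"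
        using a(3)[of p q] by (simp add: has_field_derivative_iff)
      show "((\<lambda>s. G s $$ (i, p)) \<longlongrightarrow> G t $$ (i, p)) (at t)"
        using isCont_mat_inv[OF a(1) a(4) d ij(1), of p] \<open>p \<in> {..<n}\<close> unfolding isCont_def G_def by simp
    qed
    ultimately show ?thesis by simp
  qed
  moreover have "(- (G t * A' * G t)) $$ (i, j) = - (\<Sum>q<n. (\<Sum>p<n. G t $$ (i, p) * A' $$ (p, q)) * G t $$ (q, j))"
    unfolding triple[OF G a(2) G, symmetric] using ij by (simp add: dims del: index_mult_mat(1))
  ultimately show "((\<lambda>s. G s $$ (i, j)) has_real_derivative (- (G t * A' * G t)) $$ (i, j)) (at t)"
    by (simp add: has_field_derivative_iff)
qed

lemma transpose_mult_index:
  "A \<in> carrier_mat m n \<Longrightarrow> B \<in> carrier_mat m p \<Longrightarrow> i < n \<Longrightarrow> j < p \<Longrightarrow>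
    (transpose_mat A * B) $$ (i, j) = (\<Sum>k<m. A $$ (k, i) * B $$ (k, j))"
  by (subst mult_mat_index[of _ n m _ p]) auto

lemma mult_transpose_index:
  "A \<in> carrier_mat m n \<Longrightarrow> B \<in> carrier_mat p n \<Longrightarrow> i < m \<Longrightarrow> j < p \<Longrightarrow>
    (A * transpose_mat B) $$ (i, j) = (\<Sum>k<n. A $$ (i, k) * B $$ (j, k))"
  by (subst mult_mat_index[of _ m n _ p]) auto

text \<open>\<open>T\<close> is the transposed regularised pseudoinverse and \<open>H\<close> the
  corresponding hat matrix, a projector in the limit. All bounds come from three identities:
  \<open>transpose_mat T * T = G - d * G * G\<close>,
  \<open>H * transpose_mat H = H - d * T * transpose_mat T\<close> and
  \<open>transpose_mat M * T = 1 - d * G\<close>, where \<open>d\<close> stands for scalar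
  multiplication.\<close>

lemma reg_pinv_bounds:
  assumes M: "M \<in> carrier_mat m n" and d: "d > 0"
  defines "G \<equiv> mat_inv (reg_gram d M)"
  defines "T \<equiv> M * G"
  defines "H \<equiv> T * transpose_mat M"
  shows "i < n \<Longrightarrow> j < n \<Longrightarrow> \<bar>G $$ (i, j)\<bar> \<le> 1 / d"
    and "i < n \<Longrightarrow> j < n \<Longrightarrow> G $$ (i, j) = G $$ (j, i)"
    and "i < n \<Longrightarrow> (\<Sum>a<m. (T $$ (a, i))\<^sup>2) \<le> G $$ (i, i)"
    and "a < m \<Longrightarrow> i < n \<Longrightarrow> \<bar>T $$ (a, i)\<bar> \<le> sqrt (1 / d)"
    and "a < m \<Longrightarrow> c < m \<Longrightarrow> \<bar>H $$ (a, c)\<bar> \<le> 1"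
    and "(\<Sum>a<m. H $$ (a, a)) \<le> n"
    and "i < n \<Longrightarrow> (\<Sum>a<m. M $$ (a, i) * T $$ (a, i)) = 1 - d * G $$ (i, i)"
    and "i < n \<Longrightarrow> d * (\<Sum>l<n. (G $$ (i, l))\<^sup>2) \<le> G $$ (i, i)"
proof -
  note r = reg_gram[OF M d, folded G_def]
  have G: "G \<in> carrier_mat n n" by (rule r)
  have T: "T \<in> carrier_mat m n" using M G by (simp add: T_def)
  have H: "H \<in> carrier_mat m m" using M T by (simp add: H_def)
  note dims = carrier_matD[OF M] carrier_matD[OF G] carrier_matD[OF T] carrier_matD[OF H]
  have sym: "G $$ (i, j) = G $$ (j, i)" if "i < n" "j < n" for i j
    using r(8) G that by (metis carrier_matD index_transpose_mat(1))
  then show "i < n \<Longrightarrow> j < n \<Longrightarrow> G $$ (i, j) = G $$ (j, i)" .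
  have Gb: "\<bar>G $$ (i, j)\<bar> \<le> 1 / d" if "i < n" "j < n" for i j by (rule op_bounded_entry[OF r(4) G that])
  then show "i < n \<Longrightarrow> j < n \<Longrightarrow> \<bar>G $$ (i, j)\<bar> \<le> 1 / d" .
  have TT: "transpose_mat T * T = G - d \<cdot>\<^sub>m (G * G)"
  proof -
    have "transpose_mat T * T = G * (transpose_mat M * M * G)"
      unfolding T_def using dims by (simp add: transpose_mult_dim mult_assoc_dim r(8))
    also have "\<dots> = G - d \<cdot>\<^sub>m (G * G)" unfolding r(6) using dims
      by (simp add: mult_diff_dim mult_one_dim mult_smult_dim)
    finally show ?thesis .
  qed
  have Ts: "(\<Sum>a<m. (T $$ (a, i))\<^sup>2) = G $$ (i, i) - d * (\<Sum>l<n. (G $$ (i, l))\<^sup>2)" if i: "i < n" for i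
  proof -
    have "(\<Sum>a<m. (T $$ (a, i))\<^sup>2) = (transpose_mat T * T) $$ (i, i)"
      unfolding transpose_mult_index[OF T T i i] by (simp add: power2_eq_square)
    also have "\<dots> = G $$ (i, i) - d * (G * G) $$ (i, i)"
      unfolding TT using i dims by (simp del: index_mult_mat(1))
    also have "(G * G) $$ (i, i) = (\<Sum>l<n. (G $$ (i, l))\<^sup>2)"
      unfolding mult_mat_index[OF G G i i] using sym i by (intro sum.cong) (auto simp: power2_eq_square)
    finally show ?thesis .
  qed
  show "i < n \<Longrightarrow> d * (\<Sum>l<n. (G $$ (i, l))\<^sup>2) \<le> G $$ (i, i)"
    using Ts[of i] sum_nonneg[of "{..<m}" "\<lambda>a. (T $$ (a, i))\<^sup>2"] by simp
  have Tle: "(\<Sum>a<m. (T $$ (a, i))\<^sup>2) \<le> G $$ (i, i)" if "i < n" for i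
    using Ts[OF that] d by (simp add: sum_nonneg)
  then show "i < n \<Longrightarrow> (\<Sum>a<m. (T $$ (a, i))\<^sup>2) \<le> G $$ (i, i)" .
  show "a < m \<Longrightarrow> i < n \<Longrightarrow> \<bar>T $$ (a, i)\<bar> \<le> sqrt (1 / d)"
  proof -
    assume ai: "a < m" "i < n"
    have "(T $$ (a, i))\<^sup>2 \<le> (\<Sum>a<m. (T $$ (a, i))\<^sup>2)" using ai by (intro member_le_sum) auto
    also have "\<dots> \<le> 1 / d" using Tle[OF ai(2)] Gb[OF ai(2) ai(2)] by linarith
    finally show ?thesis by (metis real_sqrt_abs real_sqrt_le_iff)
  qed
  have HH: "H * transpose_mat H = H - d \<cdot>\<^sub>m (T * transpose_mat T)"
  proof -
    have HT: "transpose_mat H = M * transpose_mat T" using dims by (simp add: H_def transpose_mult_dim)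
    have TTT: "transpose_mat T = G * transpose_mat M" unfolding T_def using dims by (simp add: transpose_mult_dim r(8))
    have "H * transpose_mat H = T * ((transpose_mat M * M * G) * transpose_mat M)"
      unfolding HT unfolding TTT unfolding H_def using dims by (simp add: mult_assoc_dim)
    also have "\<dots> = H - d \<cdot>\<^sub>m (T * transpose_mat T)" unfolding r(6) TTT H_def using dims
      by (simp add: mult_diff_dim diff_mult_dim one_mult_dim mult_smult_dim smult_mult_dim)
    finally show ?thesis .
  qed
  \<comment> \<open>The squared norm of a row of \<open>H\<close> is at most its diagonal entry;
    this forces that entry, and then the whole row, to be bounded by 1.\<close>
  have Hs: "(\<Sum>c<m. (H $$ (a, c))\<^sup>2) \<le> H $$ (a, a)" if a: "a < m" for a
  proof -
    have "(\<Sum>c<m. (H $$ (a, c))\<^sup>2) = (H * transpose_mat H) $$ (a, a)"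
      unfolding mult_transpose_index[OF H H a a] by (simp add: power2_eq_square)
    also have "\<dots> = H $$ (a, a) - d * (T * transpose_mat T) $$ (a, a)"
      unfolding HH using a dims by (simp del: index_mult_mat(1))
    also have "(T * transpose_mat T) $$ (a, a) = (\<Sum>l<n. (T $$ (a, l))\<^sup>2)"
      unfolding mult_transpose_index[OF T T a a] by (simp add: power2_eq_square)
    finally show ?thesis using d by (simp add: sum_nonneg)
  qed
  show "a < m \<Longrightarrow> c < m \<Longrightarrow> \<bar>H $$ (a, c)\<bar> \<le> 1"
  proof -
    assume ac: "a < m" "c < m"
    have e: "(H $$ (a, c))\<^sup>2 \<le> H $$ (a, a)" if "c < m" for c
      using Hs[OF ac(1)] member_le_sum[of c "{..<m}" "\<lambda>c. (H $$ (a, c))\<^sup>2"] that by simp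
    have "H $$ (a, a) \<le> 1"
    proof (rule ccontr)
      assume "\<not> H $$ (a, a) \<le> 1"
      then have "H $$ (a, a) * 1 < H $$ (a, a) * H $$ (a, a)" by (intro mult_strict_left_mono) auto
      then show False using e[OF ac(1)] by (simp add: power2_eq_square)
    qed
    then have "(H $$ (a, c))\<^sup>2 \<le> 1" using e[OF ac(2)] by linarith
    then show ?thesis by (simp add: abs_square_le_1)
  qed
  have MT: "(\<Sum>a<m. M $$ (a, i) * T $$ (a, i)) = 1 - d * G $$ (i, i)" if i: "i < n" for i
  proof -
    have "transpose_mat M * T = 1\<^sub>m n - d \<cdot>\<^sub>m G"
      unfolding r(6)[symmetric] T_def using dims by (simp add: mult_assoc_dim)
    then show ?thesis using transpose_mult_index[OF M T i i] i dims by simp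
  qed
  then show "i < n \<Longrightarrow> (\<Sum>a<m. M $$ (a, i) * T $$ (a, i)) = 1 - d * G $$ (i, i)" .
  have "(\<Sum>a<m. H $$ (a, a)) = (\<Sum>a<m. \<Sum>i<n. M $$ (a, i) * T $$ (a, i))"
    unfolding H_def using mult_transpose_index[OF T M] by (simp add: mult.commute)
  also have "\<dots> = (\<Sum>i<n. \<Sum>a<m. M $$ (a, i) * T $$ (a, i))" by (rule sum.swap)
  also have "\<dots> = (\<Sum>i<n. 1 - d * G $$ (i, i))" using MT by simp
  also have "\<dots> \<le> (\<Sum>i<n. 1)"
  proof (intro sum_mono)
    fix i assume "i \<in> {..<n}"
    then have "0 \<le> G $$ (i, i)" using Tle[of i] sum_nonneg[of "{..<m}" "\<lambda>a. (T $$ (a, i))\<^sup>2"] by auto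
    then show "1 - d * G $$ (i, i) \<le> 1" using d by simp
  qed
  finally show "(\<Sum>a<m. H $$ (a, a)) \<le> n" by simp
qed

subsection \<open>Inverse moments of Gaussian Gram matrices\<close>

text \<open>The sample space consists of the raw entries of \<open>X\<close>, where the coordinates
  are independent; the rotation by \<open>V\<close> enters through explicit linear combinations. The
  gap between \<open>k1\<close> and \<open>k2\<close> makes the mean of the inverse Gram matrix
  finite.\<close>

locale gaussian_frame =
  fixes n k1 k2 :: nat and V :: "real mat" and \<sigma> :: real
  assumes V: "V \<in> carrier_mat n n" "transpose_mat V * V = 1\<^sub>m n"
    and k1: "k1 \<le> n" and k2: "k1 + 1 < k2" and \<sigma>: "\<sigma> > 0"
begin

definition idx :: "(nat \<times> nat) set" where "idx = {..<n} \<times> {..<k2}"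

text \<open>Entry \<open>(j, a)\<close> of \<open>transpose_mat V * X\<close>.\<close>

definition W :: "(nat \<times> nat \<Rightarrow> real) \<Rightarrow> nat \<Rightarrow> nat \<Rightarrow> real" where
  "W x j a = (\<Sum>k<n. V $$ (k, j) * x (k, a))"

text \<open>The first \<open>k1\<close> rows of the rotated sketch, transposed into a tall matrix so
  that the results on \<open>reg_gram\<close> apply as they stand.\<close>

definition Yt :: "(nat \<times> nat \<Rightarrow> real) \<Rightarrow> real mat" where
  "Yt x = Matrix.mat k2 k1 (\<lambda>(a, i). W x i a)"

abbreviation P :: "(nat \<times> nat \<Rightarrow> real) measure" where "P \<equiv> gaussN \<sigma> idx"

lemma finite_idx: "finite idx" by (simp add: idx_def)

lemma prob_P: "prob_space P"
  by (intro prob_space_PiM prob_space_normal_density[OF \<sigma>])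

lemma Yt: "Yt x \<in> carrier_mat k2 k1" by (simp add: Yt_def)

lemma V_orth: "i < n \<Longrightarrow> j < n \<Longrightarrow> (\<Sum>k<n. V $$ (k, i) * V $$ (k, j)) = (if i = j then 1 else 0)"
  using transpose_mult_index[OF V(1) V(1), of i j] V(2) by simp

lemma W_measurable: "b < k2 \<Longrightarrow> (\<lambda>x. W x j b) \<in> borel_measurable P"
proof -
  assume b: "b < k2"
  have "(\<lambda>x. x (k, b)) \<in> borel_measurable P" if "k < n" for k
    using measurable_component_singleton[of "(k, b)" idx "\<lambda>_. gauss1 \<sigma>"] b that by (simp add: idx_def)
  then show ?thesis unfolding W_def by (intro borel_measurable_sum borel_measurable_times) auto
qed

lemma random_Yt: "random_mat P k2 k1 Yt"
  by (rule random_matI) (auto simp: Yt_def W_measurable)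

definition nrm :: "(nat \<times> nat \<Rightarrow> real) \<Rightarrow> real" where "nrm x = (\<Sum>p\<in>idx. \<bar>x p\<bar>)"

lemma nrm_nonneg: "nrm x \<ge> 0" by (simp add: nrm_def sum_nonneg)

definition c :: "nat \<Rightarrow> real" where "c j = (\<Sum>k<n. \<bar>V $$ (k, j)\<bar>)"

lemma c_nonneg: "c j \<ge> 0" by (simp add: c_def sum_nonneg)

lemma W_bound: "b < k2 \<Longrightarrow> \<bar>W x j b\<bar> \<le> c j * nrm x"
proof -
  assume b: "b < k2"
  have "\<bar>W x j b\<bar> \<le> (\<Sum>k<n. \<bar>V $$ (k, j)\<bar> * \<bar>x (k, b)\<bar>)"
    unfolding W_def by (rule order_trans[OF sum_abs]) (simp add: abs_mult)
  also have "\<dots> \<le> (\<Sum>k<n. \<bar>V $$ (k, j)\<bar> * nrm x)"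
  proof (intro sum_mono mult_left_mono)
    fix k assume "k \<in> {..<n}"
    then show "\<bar>x (k, b)\<bar> \<le> nrm x"
      unfolding nrm_def using b member_le_sum[of "(k, b)" idx "\<lambda>p. \<bar>x p\<bar>"] finite_idx by (simp add: idx_def)
  qed auto
  finally show ?thesis by (simp add: c_def sum_distrib_right)
qed

end

text \<open>The parameter \<open>d\<close> is fixed in an extension of the locale, because the
  smaller locale later uses the results for all \<open>d > 0\<close> at once.\<close>

locale gaussian_sketch = gaussian_frame +
  fixes d :: real
  assumes d: "d > 0"
begin

definition G :: "(nat \<times> nat \<Rightarrow> real) \<Rightarrow> real mat" where "G x = mat_inv (reg_gram d (Yt x))"

definition T :: "(nat \<times> nat \<Rightarrow> real) \<Rightarrow> real mat" where "T x = Yt x * G x"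

definition H :: "(nat \<times> nat \<Rightarrow> real) \<Rightarrow> real mat" where "H x = T x * transpose_mat (Yt x)"

text \<open>The partial derivative of \<open>T x $$ (b, i)\<close> with respect to the rotated entry
  \<open>W x l a\<close>.\<close>

definition \<Theta> :: "nat \<Rightarrow> nat \<Rightarrow> nat \<Rightarrow> nat \<Rightarrow> (nat \<times> nat \<Rightarrow> real) \<Rightarrow> real" where
  "\<Theta> l a b i x = ((if a = b then 1 else 0) - H x $$ (b, a)) * G x $$ (l, i) - T x $$ (b, l) * T x $$ (a, i)"

lemma G: "G x \<in> carrier_mat k1 k1" unfolding G_def by (rule reg_gram(1)[OF Yt d])

lemma T: "T x \<in> carrier_mat k2 k1" unfolding T_def by (rule mult_carrier_mat[OF Yt G])

lemma H: "H x \<in> carrier_mat k2 k2" unfolding H_def by (rule mult_carrier_mat[OF T]) (use Yt in auto)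

lemmas bounds = reg_pinv_bounds[OF Yt d, folded G_def, folded T_def, folded H_def]

lemma W_deriv:
  assumes "k < n"
  shows "((\<lambda>t. W (x((k, a) := t)) j b) has_real_derivative (if b = a then V $$ (k, j) else 0)) (at t)"
proof -
  have "((\<lambda>t. \<Sum>k'<n. V $$ (k', j) * (x((k, a) := t)) (k', b)) has_real_derivative
      (\<Sum>k'<n. if k' = k then (if b = a then V $$ (k, j) else 0) else 0)) (at t)"
  proof (rule DERIV_sum)
    fix k'
    show "((\<lambda>t. V $$ (k', j) * (x((k, a) := t)) (k', b)) has_real_derivative
      (if k' = k then (if b = a then V $$ (k, j) else 0) else 0)) (at t)"
      by (cases "k' = k \<and> b = a") (auto intro!: derivative_eq_intros)
  qed
  then show ?thesis using assms by (simp add: W_def)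
qed

text \<open>Changing one raw entry moves \<open>Yt\<close> along \<open>D\<close>, which is zero
  outside row \<open>a\<close>. The derivative of \<open>T = Yt * G\<close> is brought into a form
  where \<open>Yt\<close> occurs only inside \<open>T\<close> and \<open>H\<close>, both of which
  are bounded.\<close>

lemma mat_derivs:
  fixes k a :: nat and x :: "nat \<times> nat \<Rightarrow> real" and t :: real
  assumes k: "k < n"
  defines "D \<equiv> Matrix.mat k2 k1 (\<lambda>(b, l). if b = a then V $$ (k, l) else 0)"
  defines "y \<equiv> \<lambda>t. x((k, a) := t)"
  shows "\<exists>G'. mat_deriv k1 k1 (\<lambda>t. G (y t)) G' t" (is ?g)
    and "mat_deriv k2 k1 (\<lambda>t. T (y t)) (D * G (y t) - T (y t) * transpose_mat D * T (y t) - H (y t) * D * G (y t)) t" (is ?t)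
    and "\<exists>H'. mat_deriv k2 k2 (\<lambda>t. H (y t)) H' t" (is ?h)
proof -
  have D: "D \<in> carrier_mat k2 k1" by (simp add: D_def)
  have dY: "mat_deriv k2 k1 (\<lambda>t. Yt (y t)) D t"
    unfolding mat_deriv_def
  proof (intro conjI allI impI Yt D)
    fix b l assume "b < k2" "l < k1"
    then show "((\<lambda>s. Yt (y s) $$ (b, l)) has_real_derivative D $$ (b, l)) (at t)"
      using W_deriv[OF k, of x a l b t] by (simp add: Yt_def D_def y_def)
  qed
  note dims = carrier_matD[OF D] carrier_matD[OF Yt] carrier_matD[OF G] carrier_matD[OF T] carrier_matD[OF H]
  define S' where "S' = transpose_mat D * Yt (y t) + transpose_mat (Yt (y t)) * D"
  have dS: "mat_deriv k1 k1 (\<lambda>t. reg_gram d (Yt (y t))) S' t"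
    unfolding S'_def reg_gram_def dims(4)
    by (rule mat_deriv_add_const[OF mat_deriv_mult[OF mat_deriv_transpose[OF dY] dY]]) simp
  have dG: "mat_deriv k1 k1 (\<lambda>t. G (y t)) (- (G (y t) * S' * G (y t))) t"
    unfolding G_def by (rule mat_deriv_mat_inv[OF dS]) (rule reg_gram(9)[OF Yt d])
  show ?g using dG by blast
  have GT: "transpose_mat (G x) = G x" for x unfolding G_def by (rule reg_gram(8)[OF Yt d])
  have "mat_deriv k2 k1 (\<lambda>t. T (y t)) (D * G (y t) + Yt (y t) * - (G (y t) * S' * G (y t))) t"
    unfolding T_def by (rule mat_deriv_mult[OF dY dG])
  moreover have "D * G (y t) + Yt (y t) * - (G (y t) * S' * G (y t))
     = D * G (y t) - T (y t) * transpose_mat D * T (y t) - H (y t) * D * G (y t)"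
  proof -
    have S': "dim_row S' = k1" "dim_col S' = k1" using dims by (auto simp: S'_def)
    have "- (G (y t) * S' * G (y t)) = (- 1) \<cdot>\<^sub>m (G (y t) * S' * G (y t))"
      by (rule eq_matI) (use dims S' in \<open>auto simp del: index_mult_mat(1)\<close>)
    then have "Yt (y t) * - (G (y t) * S' * G (y t)) = (- 1) \<cdot>\<^sub>m (T (y t) * S' * G (y t))"
      using dims S' by (simp add: mult_smult_dim T_def mult_assoc_dim)
    also have "T (y t) * S' * G (y t) = T (y t) * transpose_mat D * T (y t) + H (y t) * D * G (y t)"
      unfolding S'_def using dims by (simp add: mult_add_dim add_mult_dim mult_assoc_dim H_def T_def)
    finally have e: "Yt (y t) * - (G (y t) * S' * G (y t)) = (- 1) \<cdot>\<^sub>m (T (y t) * transpose_mat D * T (y t) + H (y t) * D * G (y t))" .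
    show ?thesis unfolding e by (rule eq_matI) (use dims in \<open>auto simp del: index_mult_mat(1)\<close>)
  qed
  ultimately show t: ?t by simp
  show ?h unfolding H_def by (rule exI, rule mat_deriv_mult[OF t mat_deriv_transpose[OF dY]])
qed

lemma T_deriv:
  assumes k: "k < n" and a: "a < k2" and b: "b < k2" and i: "i < k1"
  shows "((\<lambda>t. T (x((k, a) := t)) $$ (b, i)) has_real_derivative
      (\<Sum>l<k1. V $$ (k, l) * \<Theta> l a b i (x((k, a) := t)))) (at t)"
proof -
  define y where "y = x((k, a) := t)"
  define D where "D = Matrix.mat k2 k1 (\<lambda>(b, l). if b = a then V $$ (k, l) else 0)"
  have D: "D \<in> carrier_mat k2 k1" by (simp add: D_def)
  note dims = carrier_matD[OF D] carrier_matD[OF Yt] carrier_matD[OF G] carrier_matD[OF T] carrier_matD[OF H]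
  have DG: "D * G y \<in> carrier_mat k2 k1" by (rule mult_carrier_mat[OF D G])
  have DTT: "transpose_mat D * T y \<in> carrier_mat k1 k1" using D T by simp
  define q where "q = (\<Sum>l<k1. V $$ (k, l) * G y $$ (l, i))"
  have 1: "(D * G y) $$ (c, i) = (if c = a then q else 0)" if "c < k2" for c
    unfolding mult_mat_index[OF D G that i] q_def using that by (simp add: D_def)
  have 2: "(T y * transpose_mat D * T y) $$ (b, i) = (\<Sum>l<k1. V $$ (k, l) * (T y $$ (b, l) * T y $$ (a, i)))"
  proof -
    have "T y * transpose_mat D * T y = T y * (transpose_mat D * T y)" using dims by (simp add: mult_assoc_dim)
    then have "(T y * transpose_mat D * T y) $$ (b, i) = (\<Sum>l<k1. T y $$ (b, l) * (transpose_mat D * T y) $$ (l, i))"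
      using mult_mat_index[OF T DTT b i] by simp
    also have "\<dots> = (\<Sum>l<k1. V $$ (k, l) * (T y $$ (b, l) * T y $$ (a, i)))"
    proof (intro sum.cong refl)
      fix l assume "l \<in> {..<k1}"
      then have l: "l < k1" by simp
      have "(transpose_mat D * T y) $$ (l, i) = (\<Sum>c<k2. if c = a then V $$ (k, l) * T y $$ (a, i) else 0)"
        unfolding transpose_mult_index[OF D T l i] using l by (intro sum.cong) (auto simp: D_def)
      then show "T y $$ (b, l) * (transpose_mat D * T y) $$ (l, i) = V $$ (k, l) * (T y $$ (b, l) * T y $$ (a, i))"
        using a by simp
    qed
    finally show ?thesis .
  qed
  have 3: "(H y * D * G y) $$ (b, i) = H y $$ (b, a) * q"
  proof -
    have "H y * D * G y = H y * (D * G y)" using dims by (simp add: mult_assoc_dim)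
    then have "(H y * D * G y) $$ (b, i) = (\<Sum>c<k2. H y $$ (b, c) * (D * G y) $$ (c, i))"
      using mult_mat_index[OF H DG b i] by simp
    also have "\<dots> = (\<Sum>c<k2. if c = a then H y $$ (b, a) * q else 0)"
      using 1 by (intro sum.cong) auto
    finally show ?thesis using a by simp
  qed
  have "(D * G y - T y * transpose_mat D * T y - H y * D * G y) $$ (b, i)
     = (D * G y) $$ (b, i) - (T y * transpose_mat D * T y) $$ (b, i) - (H y * D * G y) $$ (b, i)"
    using b i dims by (simp del: index_mult_mat(1))
  also have "\<dots> = ((if a = b then 1 else 0) - H y $$ (b, a)) * q - (\<Sum>l<k1. V $$ (k, l) * (T y $$ (b, l) * T y $$ (a, i)))"
    unfolding 1[OF b] 2 3 by (simp add: algebra_simps)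
  also have "\<dots> = (\<Sum>l<k1. ((if a = b then 1 else 0) - H y $$ (b, a)) * (V $$ (k, l) * G y $$ (l, i))
      - V $$ (k, l) * (T y $$ (b, l) * T y $$ (a, i)))"
    unfolding q_def sum_distrib_left sum_subtractf ..
  also have "\<dots> = (\<Sum>l<k1. V $$ (k, l) * \<Theta> l a b i y)"
    by (simp add: \<Theta>_def algebra_simps)
  finally show ?thesis
    using mat_derivD(3)[OF mat_derivs(2)[OF k, where a = a and x = x and t = t] b i] by (simp add: D_def[symmetric] y_def del: index_mult_mat(1))
qed

lemma T_isCont:
  assumes "k < n" "b < k2" "i < k1"
  shows "isCont (\<lambda>t. T (x((k, a) := t)) $$ (b, i)) t"
  using mat_derivD(4)[OF mat_derivs(2)[OF assms(1)] assms(2,3)] by blast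

lemma \<Theta>_isCont:
  assumes k: "k < n" and "a < k2" "b < k2" "i < k1" "l < k1"
  shows "isCont (\<lambda>t. \<Theta> l a b i (x((k, a) := t))) t"
proof -
  obtain G' where "mat_deriv k1 k1 (\<lambda>t. G (x((k, a) := t))) G' t" using mat_derivs(1)[OF k] by blast
  note g = mat_derivD(4)[OF this]
  obtain H' where "mat_deriv k2 k2 (\<lambda>t. H (x((k, a) := t))) H' t" using mat_derivs(3)[OF k] by blast
  note h = mat_derivD(4)[OF this]
  show ?thesis unfolding \<Theta>_def
    by (intro continuous_intros g h T_isCont) (use assms in auto)
qed

text \<open>The first product contributes \<open>2 * (1 / d)\<close>, the second
  \<open>1 / d\<close>. The bound blows up as \<open>d\<close> tends to 0, which is harmless: it
  licenses integration by parts for fixed \<open>d\<close> and enters no mean.\<close>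

lemma \<Theta>_bound:
  assumes "a < k2" "b < k2" "i < k1" "l < k1"
  shows "\<bar>\<Theta> l a b i x\<bar> \<le> 3 / d"
proof -
  have h: "\<bar>(if a = b then 1 else 0) - H x $$ (b, a)\<bar> \<le> 2"
    using bounds(5)[of b a x] assms by auto
  have g: "\<bar>G x $$ (l, i)\<bar> \<le> 1 / d" using bounds(1)[of l i x] assms by auto
  have t: "\<bar>T x $$ (b, l)\<bar> * \<bar>T x $$ (a, i)\<bar> \<le> sqrt (1 / d) * sqrt (1 / d)"
    using bounds(4)[of b l x] bounds(4)[of a i x] assms d by (intro mult_mono) auto
  have "\<bar>\<Theta> l a b i x\<bar> \<le> \<bar>(if a = b then 1 else 0) - H x $$ (b, a)\<bar> * \<bar>G x $$ (l, i)\<bar> + \<bar>T x $$ (b, l)\<bar> * \<bar>T x $$ (a, i)\<bar>"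
    unfolding \<Theta>_def by (metis abs_mult abs_triangle_ineq4)
  also have "\<dots> \<le> 2 * (1 / d) + sqrt (1 / d) * sqrt (1 / d)"
    by (intro add_mono t mult_mono h g) (use d in auto)
  also have "\<dots> = 3 / d" using d by (simp add: real_sqrt_mult_self)
  finally show ?thesis .
qed

lemma random_G: "random_mat P k1 k1 G"
  using random_mat_mat_inv[OF random_mat_reg_gram[OF random_Yt]] by (simp add: G_def[abs_def])

lemma random_T: "random_mat P k2 k1 T"
  using random_mat_mult[OF random_Yt random_G] by (simp add: T_def[abs_def])

lemma random_H: "random_mat P k2 k2 H"
  using random_mat_mult[OF random_T random_mat_transpose[OF random_Yt]] by (simp add: H_def[abs_def])

lemma \<Theta>_measurable:
  assumes "a < k2" "b < k2" "i < k1" "l < k1"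
  shows "\<Theta> l a b i \<in> borel_measurable P"
  unfolding \<Theta>_def[abs_def]
  by (intro borel_measurable_diff borel_measurable_times borel_measurable_const
      random_mat_entry[OF random_T] random_mat_entry[OF random_G] random_mat_entry[OF random_H]) (use assms in auto)

definition K :: real where "K = sqrt (1 / d)"

definition D :: real where "D = (\<Sum>k<n. \<Sum>l<k1. \<bar>V $$ (k, l)\<bar>) * (3 / d)"

lemma K_nonneg: "K \<ge> 0" and D_nonneg: "D \<ge> 0" using d by (auto simp: K_def D_def sum_nonneg)

text \<open>The partial derivative of \<open>T x $$ (b, i)\<close> with respect to the raw entry
  \<open>x (k, a)\<close>, by the chain rule through the rotation.\<close>

definition T' :: "nat \<Rightarrow> nat \<Rightarrow> nat \<Rightarrow> nat \<Rightarrow> (nat \<times> nat \<Rightarrow> real) \<Rightarrow> real" where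
  "T' k a b i x = (\<Sum>l<k1. V $$ (k, l) * \<Theta> l a b i x)"

lemma T'_bound:
  assumes "k < n" "a < k2" "b < k2" "i < k1"
  shows "\<bar>T' k a b i x\<bar> \<le> D"
proof -
  have "\<bar>T' k a b i x\<bar> \<le> (\<Sum>l<k1. \<bar>V $$ (k, l)\<bar> * \<bar>\<Theta> l a b i x\<bar>)"
    unfolding T'_def by (rule order_trans[OF sum_abs]) (simp add: abs_mult)
  also have "\<dots> \<le> (\<Sum>l<k1. \<bar>V $$ (k, l)\<bar> * (3 / d))"
    by (intro sum_mono mult_left_mono \<Theta>_bound) (use assms in auto)
  also have "\<dots> = (\<Sum>l<k1. \<bar>V $$ (k, l)\<bar>) * (3 / d)" by (simp only: sum_distrib_right)
  also have "\<dots> \<le> D" unfolding D_def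
    using assms(1) member_le_sum[of k "{..<n}" "\<lambda>k. \<Sum>l<k1. \<bar>V $$ (k, l)\<bar>"] d
    by (intro mult_right_mono) (auto simp: sum_nonneg)
  finally show ?thesis .
qed

lemma T_bound: "b < k2 \<Longrightarrow> i < k1 \<Longrightarrow> \<bar>T x $$ (b, i)\<bar> \<le> K"
  unfolding K_def by (rule bounds(4))

lemma T'_measurable: "a < k2 \<Longrightarrow> b < k2 \<Longrightarrow> i < k1 \<Longrightarrow> T' k a b i \<in> borel_measurable P"
  unfolding T'_def[abs_def] by (intro borel_measurable_sum borel_measurable_times borel_measurable_const \<Theta>_measurable) auto

lemma T'_isCont: "k < n \<Longrightarrow> a < k2 \<Longrightarrow> b < k2 \<Longrightarrow> i < k1 \<Longrightarrow> isCont (\<lambda>t. T' k a b i (x((k, a) := t))) t"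
  unfolding T'_def by (intro continuous_intros \<Theta>_isCont) auto

text \<open>Orthonormality of the columns of \<open>V\<close> singles out one rotated direction. For
  \<open>j \<ge> k1\<close> the derivative vanishes, since \<open>T\<close> depends on the first
  \<open>k1\<close> rotated rows alone; this stands in for independence of the row blocks.\<close>

lemma V_T':
  assumes "j < n"
  shows "(\<Sum>k<n. V $$ (k, j) * T' k a b i x) = (if j < k1 then \<Theta> j a b i x else 0)"
proof -
  have "(\<Sum>k<n. V $$ (k, j) * T' k a b i x) = (\<Sum>k<n. \<Sum>l<k1. V $$ (k, j) * V $$ (k, l) * \<Theta> l a b i x)"
    by (simp add: T'_def sum_distrib_left mult.assoc)
  also have "\<dots> = (\<Sum>l<k1. \<Sum>k<n. V $$ (k, j) * V $$ (k, l) * \<Theta> l a b i x)" by (rule sum.swap)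
  also have "\<dots> = (\<Sum>l<k1. (\<Sum>k<n. V $$ (k, j) * V $$ (k, l)) * \<Theta> l a b i x)" by (simp add: sum_distrib_right)
  also have "\<dots> = (\<Sum>l<k1. if l = j then \<Theta> j a b i x else 0)"
    using V_orth[OF assms] k1 by (intro sum.cong) auto
  finally show ?thesis by simp
qed

text \<open>The coordinate identities, summed over \<open>k\<close> with weights
  \<open>V $$ (k, j)\<close>: the rotated entry \<open>W x j a\<close> behaves in integration by
  parts like a single Gaussian variable.\<close>

lemma stein_direction:
  assumes j: "j < n" and a: "a < k2"
    and mF: "F \<in> borel_measurable P" and mF': "\<And>k. k < n \<Longrightarrow> F' k \<in> borel_measurable P"
    and dF: "\<And>k x t. k < n \<Longrightarrow> ((\<lambda>t. F (x((k, a) := t))) has_real_derivative F' k (x((k, a) := t))) (at t)"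
    and cF: "\<And>k x t. k < n \<Longrightarrow> isCont (\<lambda>t. F' k (x((k, a) := t))) t"
    and bF: "\<And>x. \<bar>F x\<bar> \<le> C * (1 + nrm x)" and bF': "\<And>k x. k < n \<Longrightarrow> \<bar>F' k x\<bar> \<le> C * (1 + nrm x)"
  shows "integrable P (\<lambda>x. W x j a * F x)" "integrable P (\<lambda>x. \<Sum>k<n. V $$ (k, j) * F' k x)"
    "(\<integral>x. W x j a * F x \<partial>P) = \<sigma>\<^sup>2 * (\<integral>x. (\<Sum>k<n. V $$ (k, j) * F' k x) \<partial>P)"
proof -
  have I: "(k, a) \<in> idx" if "k < n" for k using that a by (simp add: idx_def)
  have i1: "integrable P (\<lambda>x. x (k, a) * F x)" if "k < n" for k
    by (rule integrable_gaussN_linear_growth(2)[OF \<sigma> finite_idx I[OF that] mF bF[unfolded nrm_def]])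
  have i2: "integrable P (F' k)" if "k < n" for k
    by (rule integrable_gaussN_linear_growth(1)[OF \<sigma> finite_idx I[OF that] mF'[OF that] bF'[OF that, unfolded nrm_def]])
  have st: "(\<integral>x. x (k, a) * F x \<partial>P) = \<sigma>\<^sup>2 * (\<integral>x. F' k x \<partial>P)" if k: "k < n" for k
    by (rule stein_coordinate[OF \<sigma> finite_idx I[OF k] mF mF'[OF k] dF[OF k] cF[OF k] bF[unfolded nrm_def] bF'[OF k, unfolded nrm_def]])
  have W: "W x j a * F x = (\<Sum>k<n. V $$ (k, j) * (x (k, a) * F x))" for x
    by (simp add: W_def sum_distrib_right mult.assoc)
  show "integrable P (\<lambda>x. W x j a * F x)" unfolding W using i1 by auto
  show "integrable P (\<lambda>x. \<Sum>k<n. V $$ (k, j) * F' k x)" using i2 by auto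
  have "(\<integral>x. W x j a * F x \<partial>P) = (\<Sum>k<n. V $$ (k, j) * (\<integral>x. x (k, a) * F x \<partial>P))"
    unfolding W using i1 by (subst Bochner_Integration.integral_sum) auto
  also have "\<dots> = \<sigma>\<^sup>2 * (\<Sum>k<n. V $$ (k, j) * (\<integral>x. F' k x \<partial>P))"
    using st by (simp add: sum_distrib_left mult_ac)
  also have "(\<Sum>k<n. V $$ (k, j) * (\<integral>x. F' k x \<partial>P)) = (\<integral>x. (\<Sum>k<n. V $$ (k, j) * F' k x) \<partial>P)"
    using i2 by (subst Bochner_Integration.integral_sum) auto
  finally show "(\<integral>x. W x j a * F x \<partial>P) = \<sigma>\<^sup>2 * (\<integral>x. (\<Sum>k<n. V $$ (k, j) * F' k x) \<partial>P)" .
qed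

lemma integrable_bounded_P:
  fixes B :: real
  shows "f \<in> borel_measurable P \<Longrightarrow> (\<And>x. \<bar>f x\<bar> \<le> B) \<Longrightarrow> integrable P f"
proof -
  interpret prob_space P by (rule prob_P)
  show "f \<in> borel_measurable P \<Longrightarrow> (\<And>x. \<bar>f x\<bar> \<le> B) \<Longrightarrow> integrable P f"
    by (rule integrable_const_bound[where B = B]) auto
qed

lemma integrable_G: "i < k1 \<Longrightarrow> integrable P (\<lambda>x. G x $$ (i, i))"
  by (rule integrable_bounded_P[OF random_mat_entry[OF random_G]]) (auto intro: bounds(1))

text \<open>Integrate by parts against \<open>T x $$ (a, i)\<close> and sum over \<open>a\<close>.
  The left sides add up to \<open>1 - d * G x $$ (i, i)\<close>; the derivatives add up to
  \<open>k2\<close> minus the trace of \<open>H\<close>, times \<open>G x $$ (i, i)\<close>, minus a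
  column square sum of \<open>T\<close>. The trace is at most \<open>k1\<close> and the square sum
  at most \<open>G x $$ (i, i)\<close>, whence the factor \<open>k2 - k1 - 1\<close>.\<close>

lemma expectation_G_diag:
  assumes i: "i < k1"
  shows "\<sigma>\<^sup>2 * (real k2 - real k1 - 1) * (\<integral>x. G x $$ (i, i) \<partial>P) \<le> 1"
proof -
  interpret prob_space P by (rule prob_P)
  have i': "i < n" using i k1 by simp
  have C: "K \<le> (K + D) * (1 + nrm x)" "D \<le> (K + D) * (1 + nrm x)" for x
  proof -
    have "K + D \<le> (K + D) * (1 + nrm x)"
      using mult_left_mono[of 1 "1 + nrm x" "K + D"] nrm_nonneg K_nonneg D_nonneg by simp
    then show "K \<le> (K + D) * (1 + nrm x)" "D \<le> (K + D) * (1 + nrm x)" using K_nonneg D_nonneg by linarith+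
  qed
  have st: "integrable P (\<lambda>x. W x i a * T x $$ (a, i))" "integrable P (\<Theta> i a a i)"
    "(\<integral>x. W x i a * T x $$ (a, i) \<partial>P) = \<sigma>\<^sup>2 * (\<integral>x. \<Theta> i a a i x \<partial>P)" if a: "a < k2" for a
  proof -
    note s = stein_direction[OF i' a, where F = "\<lambda>x. T x $$ (a, i)" and F' = "\<lambda>k. T' k a a i" and C = "K + D"]
    have dF: "((\<lambda>t. T (x((k, a) := t)) $$ (a, i)) has_real_derivative T' k a a i (x((k, a) := t))) (at t)" if "k < n" for k x t
      unfolding T'_def by (rule T_deriv[OF that a a i])
    have prem: "\<bar>T x $$ (a, i)\<bar> \<le> (K + D) * (1 + nrm x)" "k < n \<Longrightarrow> \<bar>T' k a a i x\<bar> \<le> (K + D) * (1 + nrm x)" for x k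
      using order_trans[OF T_bound[OF a i] C(1)] order_trans[OF T'_bound[OF _ a a i] C(2)] by auto
    note s = s[OF random_mat_entry[OF random_T a i] T'_measurable[OF a a i] dF T'_isCont[OF _ a a i] prem]
    show "integrable P (\<lambda>x. W x i a * T x $$ (a, i))" by (rule s(1))
    show "integrable P (\<Theta> i a a i)" using s(2) i unfolding V_T'[OF i'] by simp
    show "(\<integral>x. W x i a * T x $$ (a, i) \<partial>P) = \<sigma>\<^sup>2 * (\<integral>x. \<Theta> i a a i x \<partial>P)" using s(3) i unfolding V_T'[OF i'] by simp
  qed
  have L: "(\<Sum>a<k2. W x i a * T x $$ (a, i)) = 1 - d * G x $$ (i, i)" for x
    using bounds(7)[OF i, of x] i by (simp add: Yt_def)
  have R: "(real k2 - real k1 - 1) * G x $$ (i, i) \<le> (\<Sum>a<k2. \<Theta> i a a i x)" for x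
  proof -
    have "(\<Sum>a<k2. \<Theta> i a a i x) = (\<Sum>a<k2. (1 - H x $$ (a, a)) * G x $$ (i, i) - (T x $$ (a, i))\<^sup>2)"
      by (simp add: \<Theta>_def power2_eq_square)
    also have "\<dots> = (real k2 - (\<Sum>a<k2. H x $$ (a, a))) * G x $$ (i, i) - (\<Sum>a<k2. (T x $$ (a, i))\<^sup>2)"
      by (simp add: sum_subtractf flip: sum_distrib_right)
    finally have e: "(\<Sum>a<k2. \<Theta> i a a i x) = (real k2 - (\<Sum>a<k2. H x $$ (a, a))) * G x $$ (i, i) - (\<Sum>a<k2. (T x $$ (a, i))\<^sup>2)" .
    have g: "(\<Sum>a<k2. (T x $$ (a, i))\<^sup>2) \<le> G x $$ (i, i)" by (rule bounds(3)[OF i])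
    have "0 \<le> (\<Sum>a<k2. (T x $$ (a, i))\<^sup>2)" by (simp add: sum_nonneg)
    then have g0: "0 \<le> G x $$ (i, i)" using g by linarith
    have "(real k2 - real k1) * G x $$ (i, i) \<le> (real k2 - (\<Sum>a<k2. H x $$ (a, a))) * G x $$ (i, i)"
      using bounds(6)[of x] by (intro mult_right_mono g0) simp
    moreover have "(real k2 - real k1 - 1) * G x $$ (i, i) = (real k2 - real k1) * G x $$ (i, i) - G x $$ (i, i)"
      by (simp add: algebra_simps)
    ultimately show ?thesis unfolding e using g by linarith
  qed
  have "\<sigma>\<^sup>2 * (real k2 - real k1 - 1) * (\<integral>x. G x $$ (i, i) \<partial>P) = \<sigma>\<^sup>2 * (\<integral>x. (real k2 - real k1 - 1) * G x $$ (i, i) \<partial>P)"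
    by simp
  also have "\<dots> \<le> \<sigma>\<^sup>2 * (\<integral>x. (\<Sum>a<k2. \<Theta> i a a i x) \<partial>P)"
    by (intro mult_left_mono integral_mono R) (use integrable_G[OF i] st(2) in auto)
  also have "\<dots> = (\<integral>x. (\<Sum>a<k2. W x i a * T x $$ (a, i)) \<partial>P)"
    using st by (subst (1 2) Bochner_Integration.integral_sum) (auto simp: sum_distrib_left)
  also have "\<dots> = (\<integral>x. 1 - d * G x $$ (i, i) \<partial>P)" by (simp add: L)
  also have "\<dots> \<le> (\<integral>x. 1 \<partial>P)"
  proof (rule integral_mono)
    fix x
    have "0 \<le> (\<Sum>a<k2. (T x $$ (a, i))\<^sup>2)" by (simp add: sum_nonneg)
    then have "0 \<le> G x $$ (i, i)" using bounds(3)[OF i, of x] by linarith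
    then show "1 - d * G x $$ (i, i) \<le> 1" using d by simp
  qed (use integrable_G[OF i] in auto)
  finally show ?thesis by (simp add: prob_space)
qed

text \<open>Entry \<open>(j, i)\<close> of \<open>transpose_mat V * X * T x\<close>. For
  \<open>k1 \<le> j < n\<close> and \<open>i < r\<close> it is the regularised version of an entry
  of \<open>B\<close>.\<close>

definition w :: "nat \<Rightarrow> nat \<Rightarrow> (nat \<times> nat \<Rightarrow> real) \<Rightarrow> real" where
  "w j i x = (\<Sum>b<k2. W x j b * T x $$ (b, i))"

text \<open>Expand one factor of the square as a sum over \<open>a\<close> and integrate by parts
  along column \<open>j\<close> of \<open>V\<close>. As \<open>T\<close> does not change in that
  direction, only the explicit \<open>W x j a\<close> inside \<open>w\<close> is differentiated,
  which leaves a column square sum of \<open>T\<close>.\<close>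

lemma expectation_w_square:
  assumes j: "k1 \<le> j" "j < n" and i: "i < k1"
  shows "integrable P (\<lambda>x. (w j i x)\<^sup>2)" "(\<integral>x. (w j i x)\<^sup>2 \<partial>P) \<le> \<sigma>\<^sup>2 * (\<integral>x. G x $$ (i, i) \<partial>P)"
proof -
  interpret prob_space P by (rule prob_P)
  have mw: "w j i \<in> borel_measurable P" unfolding w_def[abs_def]
    by (intro borel_measurable_sum borel_measurable_times W_measurable random_mat_entry[OF random_T]) (use i in auto)
  \<comment> \<open>\<open>w'\<close> and \<open>F'\<close> are the raw partial derivatives of
    \<open>w\<close> and of an entry of \<open>T\<close> times \<open>w\<close>. Since
    \<open>w\<close> is unbounded, the constants that follow certify linear growth.\<close>
  define w' where "w' k a x = V $$ (k, j) * T x $$ (a, i) + (\<Sum>b<k2. W x j b * T' k a b i x)" for k a x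
  define F' where "F' a k x = T' k a a i x * w j i x + T x $$ (a, i) * w' k a x" for a k x
  define B where "B = real k2 * (c j * K)"
  define B' where "B' = real k2 * (c j * D)"
  have B0: "B \<ge> 0" "B' \<ge> 0" using c_nonneg K_nonneg D_nonneg by (auto simp: B_def B'_def)
  have wb: "\<bar>w j i x\<bar> \<le> B * nrm x" for x
  proof -
    have "\<bar>w j i x\<bar> \<le> (\<Sum>b<k2. \<bar>W x j b\<bar> * \<bar>T x $$ (b, i)\<bar>)"
      unfolding w_def by (rule order_trans[OF sum_abs]) (simp add: abs_mult)
    also have "\<dots> \<le> (\<Sum>b<k2. (c j * nrm x) * K)"
      by (intro sum_mono mult_mono W_bound T_bound i) (use c_nonneg nrm_nonneg in auto)
    finally show ?thesis by (simp add: B_def mult_ac)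
  qed
  have Vc: "\<bar>V $$ (k, j)\<bar> \<le> c j" if "k < n" for k
    unfolding c_def using that member_le_sum[of k "{..<n}" "\<lambda>k. \<bar>V $$ (k, j)\<bar>"] by auto
  have w'b: "\<bar>w' k a x\<bar> \<le> c j * K + B' * nrm x" if k: "k < n" and a: "a < k2" for k a x
  proof -
    have "\<bar>w' k a x\<bar> \<le> \<bar>V $$ (k, j)\<bar> * \<bar>T x $$ (a, i)\<bar> + (\<Sum>b<k2. \<bar>W x j b\<bar> * \<bar>T' k a b i x\<bar>)"
      unfolding w'_def by (rule order_trans[OF abs_triangle_ineq], rule add_mono, simp add: abs_mult,
        rule order_trans[OF sum_abs], simp add: abs_mult)
    also have "\<dots> \<le> c j * K + (\<Sum>b<k2. (c j * nrm x) * D)"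
      by (intro add_mono sum_mono mult_mono W_bound T'_bound T_bound Vc k a i) (use c_nonneg nrm_nonneg in auto)
    finally show ?thesis by (simp add: B'_def mult_ac)
  qed
  define C where "C = K * B + D * B + K * (c j * K) + K * B'"
  have Cparts: "K * B \<ge> 0" "D * B \<ge> 0" "K * (c j * K) \<ge> 0" "K * B' \<ge> 0"
    using B0 K_nonneg D_nonneg c_nonneg by auto
  have C1: "\<bar>T x $$ (a, i) * w j i x\<bar> \<le> C * (1 + nrm x)" if a: "a < k2" for a x
  proof -
    have "\<bar>T x $$ (a, i) * w j i x\<bar> \<le> K * (B * nrm x)"
      unfolding abs_mult by (intro mult_mono T_bound a i wb) (use K_nonneg in auto)
    also have "\<dots> \<le> C * (1 + nrm x)"
      using Cparts nrm_nonneg[of x] mult_nonneg_nonneg[OF Cparts(2) nrm_nonneg[of x]]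
        mult_nonneg_nonneg[OF Cparts(3) nrm_nonneg[of x]] mult_nonneg_nonneg[OF Cparts(4) nrm_nonneg[of x]]
      by (simp add: C_def algebra_simps)
    finally show ?thesis .
  qed
  have C2: "\<bar>F' a k x\<bar> \<le> C * (1 + nrm x)" if a: "a < k2" and k: "k < n" for a k x
  proof -
    have "\<bar>F' a k x\<bar> \<le> \<bar>T' k a a i x\<bar> * \<bar>w j i x\<bar> + \<bar>T x $$ (a, i)\<bar> * \<bar>w' k a x\<bar>"
      unfolding F'_def by (metis abs_mult abs_triangle_ineq)
    also have "\<dots> \<le> D * (B * nrm x) + K * (c j * K + B' * nrm x)"
      by (intro add_mono mult_mono T_bound T'_bound a k i wb w'b) (use K_nonneg D_nonneg in auto)
    also have "\<dots> \<le> C * (1 + nrm x)"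
      using Cparts nrm_nonneg[of x] mult_nonneg_nonneg[OF Cparts(1) nrm_nonneg[of x]]
        mult_nonneg_nonneg[OF Cparts(3) nrm_nonneg[of x]]
      by (simp add: C_def algebra_simps)
    finally show ?thesis .
  qed
  have mF': "F' a k \<in> borel_measurable P" if a: "a < k2" for a k
    unfolding F'_def[abs_def] w'_def
    by (intro borel_measurable_add borel_measurable_times borel_measurable_sum borel_measurable_const mw
        W_measurable T'_measurable random_mat_entry[OF random_T]) (use a i in auto)
  have dw: "((\<lambda>t. w j i (x((k, a) := t))) has_real_derivative w' k a (x((k, a) := t))) (at t)"
    if k: "k < n" and a: "a < k2" for k a x t
  proof -
    let ?y = "x((k, a) := t)"
    have "((\<lambda>t. \<Sum>b<k2. W (x((k, a) := t)) j b * T (x((k, a) := t)) $$ (b, i)) has_real_derivative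
        (\<Sum>b<k2. (if b = a then V $$ (k, j) else 0) * T ?y $$ (b, i) + T' k a b i ?y * W ?y j b)) (at t)"
    proof (rule DERIV_sum)
      fix b assume "b \<in> {..<k2}"
      then have "((\<lambda>t. T (x((k, a) := t)) $$ (b, i)) has_real_derivative T' k a b i ?y) (at t)"
        unfolding T'_def using T_deriv[OF k a _ i, of b] by simp
      from DERIV_mult[OF W_deriv[OF k, of x a j b t] this]
      show "((\<lambda>t. W (x((k, a) := t)) j b * T (x((k, a) := t)) $$ (b, i)) has_real_derivative
        (if b = a then V $$ (k, j) else 0) * T ?y $$ (b, i) + T' k a b i ?y * W ?y j b) (at t)" .
    qed
    moreover have "(\<Sum>b<k2. (if b = a then V $$ (k, j) else 0) * T ?y $$ (b, i) + T' k a b i ?y * W ?y j b) = w' k a ?y"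
    proof -
      have "(\<Sum>b<k2. (if b = a then V $$ (k, j) else 0) * T ?y $$ (b, i)) = (\<Sum>b<k2. if b = a then V $$ (k, j) * T ?y $$ (a, i) else 0)"
        by (intro sum.cong) auto
      then show ?thesis using a by (simp add: w'_def sum.distrib mult.commute)
    qed
    ultimately show ?thesis by (simp add: w_def)
  qed
  have cw: "isCont (\<lambda>t. w j i (x((k, a) := t))) t" if "k < n" "a < k2" for k a x t
    using dw[OF that] DERIV_isCont by blast
  have cw': "isCont (\<lambda>t. w' k a (x((k, a) := t))) t" if k: "k < n" and a: "a < k2" for k a x t
    unfolding w'_def using DERIV_isCont[OF W_deriv[OF k]]
    by (intro continuous_intros T_isCont T'_isCont) (use k a i in auto)
  have st: "integrable P (\<lambda>x. W x j a * (T x $$ (a, i) * w j i x))" "integrable P (\<lambda>x. (T x $$ (a, i))\<^sup>2)"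
    "(\<integral>x. W x j a * (T x $$ (a, i) * w j i x) \<partial>P) = \<sigma>\<^sup>2 * (\<integral>x. (T x $$ (a, i))\<^sup>2 \<partial>P)" if a: "a < k2" for a
  proof -
    have mF: "(\<lambda>x. T x $$ (a, i) * w j i x) \<in> borel_measurable P"
      by (intro borel_measurable_times mw random_mat_entry[OF random_T a i])
    have dF: "((\<lambda>t. T (x((k, a) := t)) $$ (a, i) * w j i (x((k, a) := t))) has_real_derivative F' a k (x((k, a) := t))) (at t)"
      if k: "k < n" for k x t
      unfolding F'_def using DERIV_mult[OF T_deriv[OF k a a i, folded T'_def, of x t] dw[OF k a, of x t]]
      by (simp add: mult.commute)
    have cF: "isCont (\<lambda>t. F' a k (x((k, a) := t))) t" if k: "k < n" for k x t
      unfolding F'_def by (intro continuous_intros cw cw' T_isCont T'_isCont) (use a k i in auto)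
    note s = stein_direction[OF j(2) a mF mF'[OF a] dF cF C1[OF a] C2[OF a]]
    \<comment> \<open>Contraction with column \<open>j\<close> of \<open>V\<close> removes every
      derivative of \<open>T\<close> by \<open>V_T'\<close>; what remains is multiplied by the
      squared norm 1 of that column.\<close>
    have e: "(\<Sum>k<n. V $$ (k, j) * F' a k x) = (T x $$ (a, i))\<^sup>2" for x
    proof -
      have "(\<Sum>k<n. V $$ (k, j) * F' a k x)
        = (\<Sum>k<n. V $$ (k, j) * T' k a a i x) * w j i x + T x $$ (a, i) * (T x $$ (a, i) * (\<Sum>k<n. V $$ (k, j) * V $$ (k, j))
           + (\<Sum>b<k2. W x j b * (\<Sum>k<n. V $$ (k, j) * T' k a b i x)))"
      proof -
        have "(\<Sum>k<n. \<Sum>b<k2. V $$ (k, j) * (T x $$ (a, i) * (W x j b * T' k a b i x)))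
          = (\<Sum>b<k2. \<Sum>k<n. V $$ (k, j) * (T x $$ (a, i) * (W x j b * T' k a b i x)))" by (rule sum.swap)
        then show ?thesis unfolding F'_def w'_def
          by (simp add: sum.distrib sum_distrib_left sum_distrib_right distrib_left mult_ac)
      qed
      then show ?thesis using V_T'[OF j(2)] j V_orth[OF j(2) j(2)] by (simp add: power2_eq_square)
    qed
    show "integrable P (\<lambda>x. W x j a * (T x $$ (a, i) * w j i x))" by (rule s(1))
    show "integrable P (\<lambda>x. (T x $$ (a, i))\<^sup>2)" using s(2) unfolding e .
    show "(\<integral>x. W x j a * (T x $$ (a, i) * w j i x) \<partial>P) = \<sigma>\<^sup>2 * (\<integral>x. (T x $$ (a, i))\<^sup>2 \<partial>P)" using s(3) unfolding e .
  qed
  have sq: "(w j i x)\<^sup>2 = (\<Sum>a<k2. W x j a * (T x $$ (a, i) * w j i x))" for x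
    by (simp add: power2_eq_square w_def sum_distrib_right mult.assoc)
  show "integrable P (\<lambda>x. (w j i x)\<^sup>2)" unfolding sq using st(1) by auto
  have "(\<integral>x. (w j i x)\<^sup>2 \<partial>P) = \<sigma>\<^sup>2 * (\<integral>x. (\<Sum>a<k2. (T x $$ (a, i))\<^sup>2) \<partial>P)"
    unfolding sq using st by (subst (1 2) Bochner_Integration.integral_sum) (auto simp: sum_distrib_left)
  also have "\<dots> \<le> \<sigma>\<^sup>2 * (\<integral>x. G x $$ (i, i) \<partial>P)"
    by (intro mult_left_mono integral_mono bounds(3)[OF i] integrable_G[OF i]) (use st(2) in auto)
  finally show "(\<integral>x. (w j i x)\<^sup>2 \<partial>P) \<le> \<sigma>\<^sup>2 * (\<integral>x. G x $$ (i, i) \<partial>P)" .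
qed

end

text \<open>Pair \<open>reg_gram d M * z\<close> with \<open>z\<close> and apply Cauchy-Schwarz. The
  constant is free of \<open>d\<close>, so it survives the limit at matrices of full rank.\<close>

lemma reg_gram_coercive:
  assumes M: "M \<in> carrier_mat m n" and d: "d \<ge> 0" and c: "c \<ge> 0"
    and co: "c * frob_norm z \<le> frob_norm (M * z)" and z: "z \<in> carrier_mat n p"
  shows "c\<^sup>2 * frob_norm z \<le> frob_norm (reg_gram d M * z)"
proof (cases "frob_norm z = 0")
  case False
  then have pos: "frob_norm z > 0" using frob_norm_nonneg[of z] by linarith
  have S: "reg_gram d M \<in> carrier_mat n n" using M by (simp add: reg_gram_def)
  have Mz: "M * z \<in> carrier_mat m p" using M z by simp
  have MMz: "transpose_mat M * (M * z) \<in> carrier_mat n p" using M Mz by simp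
  have e: "reg_gram d M * z = transpose_mat M * (M * z) + d \<cdot>\<^sub>m z"
    using M z by (simp add: reg_gram_def add_mult_dim smult_mult_dim one_mult_dim mult_assoc_dim)
  have i1: "frob_inner z (transpose_mat M * (M * z)) = (frob_norm (M * z))\<^sup>2"
    using frob_inner_mult_left[of z n p "transpose_mat M" m "M * z"] M z Mz by (simp add: frob_norm_square)
  have i2: "frob_inner z (d \<cdot>\<^sub>m z) = d * (frob_norm z)\<^sup>2"
    using frob_inner_smult_right[OF z z] by (simp add: frob_norm_square)
  have "(c * frob_norm z)\<^sup>2 \<le> (frob_norm (M * z))\<^sup>2"
    by (rule power_mono[OF co]) (use c in auto)
  also have "\<dots> \<le> frob_inner z (reg_gram d M * z)"
    unfolding e using frob_inner_add_right[OF z MMz, of "d \<cdot>\<^sub>m z"] z i1 i2 d by simp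
  also have "\<dots> \<le> frob_norm z * frob_norm (reg_gram d M * z)"
    by (rule frob_cauchy_schwarz[OF z]) (use S z in simp)
  finally have "frob_norm z * (c\<^sup>2 * frob_norm z) \<le> frob_norm z * frob_norm (reg_gram d M * z)"
    by (simp add: power_mult_distrib power2_eq_square mult_ac)
  then show ?thesis using pos by simp
qed simp

lemma emeasure_gauss1_interval_pos:
  assumes s: "\<sigma> > 0" and ab: "a < b"
  shows "emeasure (gauss1 \<sigma>) {a<..<b} > 0"
proof (rule ccontr)
  assume "\<not> ?thesis"
  then have "emeasure (gauss1 \<sigma>) {a<..<b} = 0" by simp
  then have "{a<..<b} \<in> null_sets (gauss1 \<sigma>)" by (intro null_setsI) auto
  then have "AE x in lborel. x \<in> {a<..<b} \<longrightarrow> ennreal (normal_density 0 \<sigma> x) = 0"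
    by (subst (asm) null_sets_density_iff) auto
  then have "AE x in lborel. x \<notin> {a<..<b}"
    by (rule AE_mp) (use normal_density_pos[OF s, of 0] in \<open>auto simp: ennreal_eq_0_iff not_le intro!: AE_I2\<close>, meson not_le)
  then have "emeasure lborel {a<..<b} = 0"
    by (subst (asm) AE_iff_measurable[of "{a<..<b}"]) auto
  then show False using ab by simp
qed

lemma (in gaussian_sketch) T_transpose:
  "b < k2 \<Longrightarrow> i < k1 \<Longrightarrow> T x $$ (b, i) = (mat_inv (reg_gram d (Yt x)) * transpose_mat (Yt x)) $$ (i, b)"
proof -
  assume "b < k2" "i < k1"
  have "mat_inv (reg_gram d (Yt x)) * transpose_mat (Yt x) = transpose_mat (T x)"
    using carrier_matD[OF Yt[of x]] carrier_matD[OF G[of x]] reg_gram(8)[OF Yt d, of x]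
    unfolding T_def G_def by (simp add: transpose_mult_dim)
  then show ?thesis using carrier_matD[OF T[of x]] \<open>b < k2\<close> \<open>i < k1\<close> by simp
qed

context gaussian_frame
begin

text \<open>The inverse Wishart constant: the diagonal of the mean inverse Gram matrix of a
  \<open>k1\<close> by \<open>k2\<close> standard Gaussian matrix. In the end \<open>b\<close> is
  \<open>real r * \<kappa>\<close>.\<close>

definition \<kappa> :: real where "\<kappa> = 1 / (real k2 - real k1 - 1)"

lemma \<kappa>_pos: "\<kappa> > 0" using k2 by (simp add: \<kappa>_def)

lemma sketch: "d > 0 \<Longrightarrow> gaussian_sketch n k1 k2 V \<sigma> d"
  by unfold_locales

lemma expectation_reg_inverse:
  assumes d: "d > 0" and i: "i < k1"
  shows "integrable P (\<lambda>x. mat_inv (reg_gram d (Yt x)) $$ (i, i))"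
    "(\<integral>x. mat_inv (reg_gram d (Yt x)) $$ (i, i) \<partial>P) \<le> \<kappa> / \<sigma>\<^sup>2"
proof -
  interpret s: gaussian_sketch n k1 k2 V \<sigma> d by (rule sketch[OF d])
  show "integrable P (\<lambda>x. mat_inv (reg_gram d (Yt x)) $$ (i, i))"
    using s.integrable_G[OF i] by (simp add: s.G_def)
  have p: "real k2 - real k1 - 1 > 0" "\<sigma>\<^sup>2 > 0" using k2 \<sigma> by auto
  have "\<sigma>\<^sup>2 * (real k2 - real k1 - 1) * (\<integral>x. mat_inv (reg_gram d (Yt x)) $$ (i, i) \<partial>P) \<le> 1"
    using s.expectation_G_diag[OF i] by (simp add: s.G_def)
  then have "(\<integral>x. mat_inv (reg_gram d (Yt x)) $$ (i, i) \<partial>P) \<le> 1 / (\<sigma>\<^sup>2 * (real k2 - real k1 - 1))"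
    using p by (simp add: pos_le_divide_eq mult.commute)
  also have "\<dots> = \<kappa> / \<sigma>\<^sup>2" by (simp add: \<kappa>_def mult.commute)
  finally show "(\<integral>x. mat_inv (reg_gram d (Yt x)) $$ (i, i) \<partial>P) \<le> \<kappa> / \<sigma>\<^sup>2" .
qed

text \<open>A kernel vector of the Gram matrix is an eigenvector of \<open>G\<close> with eigenvalue
  \<open>1 / d\<close>. So the Frobenius norm of \<open>G\<close> is at least \<open>1 / d\<close>,
  while its square is at most the trace divided by \<open>d\<close>.\<close>

lemma singular_reg_inverse_trace:
  assumes d: "d > 0" and sing: "det (transpose_mat (Yt x) * Yt x) = 0"
  shows "1 / d \<le> (\<Sum>i<k1. mat_inv (reg_gram d (Yt x)) $$ (i, i))"
proof -
  define A where "A = transpose_mat (Yt x) * Yt x"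
  define G where "G = mat_inv (reg_gram d (Yt x))"
  note r = reg_gram[OF Yt d, of x, folded A_def G_def]
  have A: "A \<in> carrier_mat k1 k1" using Yt[of x] by (simp add: A_def)
  obtain v where v: "v \<in> carrier_vec k1" "v \<noteq> 0\<^sub>v k1" "A *\<^sub>v v = 0\<^sub>v k1"
    using det_0_iff_vec_prod_zero_field[OF A] sing by (auto simp: A_def)
  define X where "X = Matrix.mat k1 1 (\<lambda>(i, j). v $ i)"
  have X: "X \<in> carrier_mat k1 1" by (simp add: X_def)
  have AX: "A * X = 0\<^sub>m k1 1"
  proof (rule eq_matI)
    fix i j assume "i < dim_row (0\<^sub>m k1 1 :: real mat)" "j < dim_col (0\<^sub>m k1 1 :: real mat)"
    then have ij: "i < k1" "j = 0" by auto
    have "(A * X) $$ (i, j) = (A *\<^sub>v v) $ i"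
      using ij A v(1) by (auto simp: X_def scalar_prod_def intro!: sum.cong)
    then show "(A * X) $$ (i, j) = 0\<^sub>m k1 1 $$ (i, j)" using v(3) ij by simp
  qed (use A X in auto)
  have Xpos: "frob_norm X > 0"
  proof (rule ccontr)
    assume "\<not> frob_norm X > 0"
    then have "frob_norm X = 0" using frob_norm_nonneg[of X] by linarith
    from frob_norm_eq_0[OF X this] have X0: "X = 0\<^sub>m k1 1" .
    have "v $ i = 0" if "i < k1" for i
    proof -
      have "v $ i = X $$ (i, 0)" using that by (simp add: X_def)
      then show ?thesis using X0 that by simp
    qed
    then show False using v by auto
  qed
  have "G * A * X = 0\<^sub>m k1 1" using r(1) A X AX by (simp add: mult_assoc_dim)
  then have "(1\<^sub>m k1 - d \<cdot>\<^sub>m G) * X = 0\<^sub>m k1 1" unfolding r(7) .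
  then have z: "X - d \<cdot>\<^sub>m (G * X) = 0\<^sub>m k1 1"
    using r(1) X by (simp add: diff_mult_dim one_mult_dim smult_mult_dim)
  have "X = d \<cdot>\<^sub>m (G * X)"
  proof (rule eq_matI)
    fix i j assume "i < dim_row (d \<cdot>\<^sub>m (G * X))" "j < dim_col (d \<cdot>\<^sub>m (G * X))"
    then have ij: "i < k1" "j < 1" using r(1) X by auto
    have "(X - d \<cdot>\<^sub>m (G * X)) $$ (i, j) = 0" unfolding z using ij by simp
    then show "X $$ (i, j) = (d \<cdot>\<^sub>m (G * X)) $$ (i, j)" using ij r(1) X by (simp del: index_mult_mat(1))
  qed (use r(1) X in auto)
  then have "frob_norm X = d * frob_norm (G * X)" using d frob_norm_smult[of d "G * X"] by simp
  also have "\<dots> \<le> d * (frob_norm G * frob_norm X)" using frob_norm_mult[OF r(1) X] d by simp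
  finally have "1 \<le> d * frob_norm G" using Xpos by (simp add: mult.assoc[symmetric])
  then have "1 / d \<le> frob_norm G" using d by (simp add: field_simps)
  then have "(1 / d)\<^sup>2 \<le> (frob_norm G)\<^sup>2" by (rule power_mono) (use d in simp)
  also have "\<dots> = (\<Sum>i<k1. \<Sum>l<k1. (G $$ (i, l))\<^sup>2)" by (rule frob_norm_square_sum[OF r(1)])
  also have "\<dots> \<le> (\<Sum>i<k1. G $$ (i, i) / d)"
  proof (rule sum_mono)
    fix i assume "i \<in> {..<k1}"
    then have "d * (\<Sum>l<k1. (G $$ (i, l))\<^sup>2) \<le> G $$ (i, i)"
      using reg_pinv_bounds(8)[OF Yt d, of i x] by (simp add: G_def)
    then show "(\<Sum>l<k1. (G $$ (i, l))\<^sup>2) \<le> G $$ (i, i) / d" using d by (simp add: field_simps)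
  qed
  also have "\<dots> = (\<Sum>i<k1. G $$ (i, i)) / d" by (simp add: sum_divide_distrib)
  finally show ?thesis using d by (simp add: power2_eq_square field_simps G_def)
qed

text \<open>A Markov argument for the trace of the regularised inverse: it is at least
  \<open>1 / d\<close> on the singular set, and its mean is bounded independently of
  \<open>d\<close>, so the probability of that set is at most a multiple of
  \<open>d\<close>.\<close>

lemma AE_full_rank: "AE x in P. det (transpose_mat (Yt x) * Yt x) \<noteq> 0"
proof -
  interpret prob_space P by (rule prob_P)
  have [measurable]: "(\<lambda>x. det (transpose_mat (Yt x) * Yt x)) \<in> borel_measurable P"
    by (rule borel_measurable_det[OF random_mat_mult[OF random_mat_transpose[OF random_Yt] random_Yt]])
  define S where "S = {x \<in> space P. det (transpose_mat (Yt x) * Yt x) = 0}"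
  have S: "S \<in> sets P" unfolding S_def by measurable
  define C where "C = real k1 * (\<kappa> / \<sigma>\<^sup>2)"
  have le: "prob S \<le> d * C" if d: "d > 0" for d
  proof -
    have "1 / d * prob S = (\<integral>x. 1 / d * indicator S x \<partial>P)" using S by simp
    also have "\<dots> \<le> (\<integral>x. (\<Sum>i<k1. mat_inv (reg_gram d (Yt x)) $$ (i, i)) \<partial>P)"
    proof (rule integral_mono)
      show "integrable P (\<lambda>x. 1 / d * indicator S x)" using S by (intro integrable_mult_right) (simp add: integrable_indicator_iff less_top[symmetric])
      show "integrable P (\<lambda>x. \<Sum>i<k1. mat_inv (reg_gram d (Yt x)) $$ (i, i))"
        using expectation_reg_inverse(1)[OF d] by auto
      fix x
      have "0 \<le> (\<Sum>i<k1. mat_inv (reg_gram d (Yt x)) $$ (i, i))"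
      proof (rule sum_nonneg)
        fix i assume "i \<in> {..<k1}"
        then show "0 \<le> mat_inv (reg_gram d (Yt x)) $$ (i, i)"
          using reg_pinv_bounds(3)[OF Yt d, of i x]
            sum_nonneg[of "{..<k2}" "\<lambda>a. ((Yt x * mat_inv (reg_gram d (Yt x))) $$ (a, i))\<^sup>2"]
          by (simp del: index_mult_mat(1))
      qed
      then show "1 / d * indicator S x \<le> (\<Sum>i<k1. mat_inv (reg_gram d (Yt x)) $$ (i, i))"
        using singular_reg_inverse_trace[OF d, of x] by (cases "x \<in> S") (auto simp: S_def)
    qed
    also have "\<dots> = (\<Sum>i<k1. \<integral>x. mat_inv (reg_gram d (Yt x)) $$ (i, i) \<partial>P)"
      using expectation_reg_inverse(1)[OF d] by (subst Bochner_Integration.integral_sum) auto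
    also have "\<dots> \<le> (\<Sum>i<k1. \<kappa> / \<sigma>\<^sup>2)" by (intro sum_mono expectation_reg_inverse(2)[OF d]) auto
    finally show ?thesis using d by (simp add: C_def field_simps)
  qed
  have C0: "C \<ge> 0" using \<kappa>_pos by (simp add: C_def)
  have "prob S = 0"
  proof (rule ccontr)
    assume "prob S \<noteq> 0"
    then have p: "prob S > 0" by (simp add: less_le)
    \<comment> \<open>Any positive \<open>d\<close> with \<open>d * C < prob S\<close> contradicts
      \<open>le\<close>; the added 1 covers \<open>C = 0\<close>.\<close>
    have "prob S \<le> prob S / (2 * (C + 1)) * C" by (rule le) (use p C0 in auto)
    also have "\<dots> = prob S * (C / (2 * (C + 1)))" by simp
    also have "\<dots> < prob S * 1" by (rule mult_strict_left_mono[OF _ p]) (use C0 in \<open>simp add: field_simps\<close>)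
    finally show False by simp
  qed
  then have "emeasure P S = 0" by (simp add: emeasure_eq_measure)
  then show ?thesis by (subst AE_iff_measurable[OF S]) (auto simp: S_def)
qed

text \<open>Entry \<open>(j, i)\<close> of \<open>transpose_mat V * X\<close> times the transposed
  pseudoinverse of \<open>Yt\<close>; for \<open>j \<ge> k1\<close> and \<open>i < r\<close> an
  entry of \<open>B\<close> on the full-rank event.\<close>

definition w0 :: "nat \<Rightarrow> nat \<Rightarrow> (nat \<times> nat \<Rightarrow> real) \<Rightarrow> real" where
  "w0 j i x = (\<Sum>b<k2. W x j b * pinv (Yt x) $$ (i, b))"

text \<open>For \<open>d > 0\<close> the same as \<open>w\<close> of the locale
  \<open>gaussian_sketch\<close>, with \<open>d\<close> as an argument so that it can run through a
  sequence.\<close>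

definition wreg :: "real \<Rightarrow> nat \<Rightarrow> nat \<Rightarrow> (nat \<times> nat \<Rightarrow> real) \<Rightarrow> real" where
  "wreg d j i x = (\<Sum>b<k2. W x j b * (mat_inv (reg_gram d (Yt x)) * transpose_mat (Yt x)) $$ (i, b))"

lemma w0_limit: "i < k1 \<Longrightarrow> (\<lambda>m. wreg (1 / real (Suc m)) j i x) \<longlonglongrightarrow> w0 j i x"
  unfolding w0_def wreg_def by (intro tendsto_sum tendsto_mult tendsto_const pinv_limit[OF Yt]) auto

lemma wreg_eq: "d > 0 \<Longrightarrow> i < k1 \<Longrightarrow> wreg d j i x = (\<Sum>b<k2. W x j b * (Yt x * mat_inv (reg_gram d (Yt x))) $$ (b, i))"
proof -
  assume d: "d > 0" and i: "i < k1"
  interpret s: gaussian_sketch n k1 k2 V \<sigma> d by (rule sketch[OF d])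
  show ?thesis unfolding wreg_def
    by (intro sum.cong refl) (use s.T_transpose[OF _ i, of _ x] in \<open>simp add: s.T_def s.G_def del: index_mult_mat(1)\<close>)
qed

lemma expectation_wreg_square:
  assumes d: "d > 0" and j: "k1 \<le> j" "j < n" and i: "i < k1"
  shows "integrable P (\<lambda>x. (wreg d j i x)\<^sup>2)" "(\<integral>x. (wreg d j i x)\<^sup>2 \<partial>P) \<le> \<kappa>"
proof -
  interpret s: gaussian_sketch n k1 k2 V \<sigma> d by (rule sketch[OF d])
  have e: "wreg d j i x = s.w j i x" for x
    unfolding wreg_eq[OF d i] s.w_def s.T_def s.G_def ..
  note q = s.expectation_w_square[OF j i, folded e]
  show "integrable P (\<lambda>x. (wreg d j i x)\<^sup>2)" by (rule q)
  have "(\<integral>x. s.G x $$ (i, i) \<partial>P) \<le> \<kappa> / \<sigma>\<^sup>2" unfolding s.G_def by (rule expectation_reg_inverse(2)[OF d i])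
  then have "\<sigma>\<^sup>2 * (\<integral>x. s.G x $$ (i, i) \<partial>P) \<le> \<sigma>\<^sup>2 * (\<kappa> / \<sigma>\<^sup>2)" by (intro mult_left_mono) auto
  then show "(\<integral>x. (wreg d j i x)\<^sup>2 \<partial>P) \<le> \<kappa>" using q(2) \<sigma> by simp
qed

lemma w0_measurable: "i < k1 \<Longrightarrow> w0 j i \<in> borel_measurable P"
  unfolding w0_def[abs_def]
  by (intro borel_measurable_sum borel_measurable_times W_measurable random_mat_entry[OF random_mat_pinv[OF random_Yt]]) auto

text \<open>Fatou's lemma along \<open>d = 1 / (m + 1)\<close>: the bound for the regularised
  squares does not involve \<open>d\<close>. Working with nonnegative integrals makes integrability
  of the limit a consequence.\<close>

lemma nn_integral_w0_square:
  assumes j: "k1 \<le> j" "j < n" and i: "i < k1"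
  shows "(\<integral>\<^sup>+x. ennreal ((w0 j i x)\<^sup>2) \<partial>P) \<le> ennreal \<kappa>"
proof -
  define u where "u m x = ennreal ((wreg (1 / real (Suc m)) j i x)\<^sup>2)" for m x
  have int: "integrable P (\<lambda>x. (wreg (1 / real (Suc m)) j i x)\<^sup>2)" for m
    by (rule expectation_wreg_square(1)[OF _ j i]) simp
  have mu: "u m \<in> borel_measurable P" for m
    unfolding u_def[abs_def] using borel_measurable_integrable[OF int[of m]] by measurable
  have "(\<lambda>m. u m x) \<longlonglongrightarrow> ennreal ((w0 j i x)\<^sup>2)" for x
    unfolding u_def by (intro tendsto_ennrealI tendsto_power w0_limit[OF i])
  then have lim: "liminf (\<lambda>m. u m x) = ennreal ((w0 j i x)\<^sup>2)" for x
    by (intro lim_imp_Liminf) auto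
  have "(\<integral>\<^sup>+x. ennreal ((w0 j i x)\<^sup>2) \<partial>P) = (\<integral>\<^sup>+x. liminf (\<lambda>m. u m x) \<partial>P)" by (simp add: lim)
  also have "\<dots> \<le> liminf (\<lambda>m. \<integral>\<^sup>+x. u m x \<partial>P)" by (rule nn_integral_liminf[OF mu])
  also have "\<dots> \<le> liminf (\<lambda>m. ennreal \<kappa>)"
  proof (intro Liminf_mono always_eventually allI)
    fix m
    have "(\<integral>\<^sup>+x. u m x \<partial>P) = ennreal (\<integral>x. (wreg (1 / real (Suc m)) j i x)\<^sup>2 \<partial>P)"
      unfolding u_def by (rule nn_integral_eq_integral[OF int]) simp
    also have "\<dots> \<le> ennreal \<kappa>" by (intro ennreal_leI expectation_wreg_square(2)[OF _ j i]) simp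
    finally show "(\<integral>\<^sup>+x. u m x \<partial>P) \<le> ennreal \<kappa>" .
  qed
  also have "\<dots> = ennreal \<kappa>" by (simp add: Liminf_const)
  finally show ?thesis .
qed

text \<open>The event contains a box around the first \<open>k1\<close> columns of \<open>V\<close>, where \<open>Yt\<close> is close to
  an isometry and the rows of \<open>W\<close> below \<open>k1\<close> are close to zero.\<close>

lemma small_event_positive:
  assumes \<eta>: "\<eta> > 0"
  shows "emeasure P {x \<in> space P. \<forall>j\<in>{k1..<n}. \<forall>i<k1. (w0 j i x)\<^sup>2 \<le> \<eta>} > 0"
proof -
  interpret product_sigma_finite "\<lambda>_ :: nat \<times> nat. gauss1 \<sigma>"
    by (intro product_sigma_finite.intro prob_space_imp_sigma_finite prob_space_normal_density[OF \<sigma>])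
  \<comment> \<open>The centre of the box: the first \<open>k1\<close> columns of \<open>X\<close>
    are those of \<open>V\<close>, the others vanish. There \<open>Yt\<close> is exactly the
    isometry \<open>E\<close>, and all rotated rows from \<open>k1\<close> on are zero.\<close>
  define x0 where "x0 p = (if snd p < k1 then V $$ p else 0)" for p
  \<comment> \<open>The first bound puts \<open>Yt\<close> within Frobenius distance 1/2 of the
    isometry; the second makes a sum of \<open>k2\<close> terms of size at most \<open>2 * e\<close>
    smaller than \<open>sqrt \<eta>\<close>.\<close>
  define e where "e = min (1 / (2 * (real k1 * real k2 + 1))) (sqrt \<eta> / (2 * real k2 + 1))"
  have e: "e > 0" "e \<le> 1 / (2 * (real k1 * real k2 + 1))" "e \<le> sqrt \<eta> / (2 * real k2 + 1)"
    using \<eta> by (auto simp: e_def add_nonneg_pos)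
  define cm where "cm = (\<Sum>j<n. c j) + 1"
  have cm: "c j \<le> cm" if "j < n" for j
    using that c_nonneg member_le_sum[of j "{..<n}" c] by (simp add: cm_def)
  have "0 \<le> (\<Sum>j<n. c j)" using c_nonneg by (rule sum_nonneg)
  then have cm0: "cm > 0" by (simp add: cm_def)
  \<comment> \<open>\<open>cm\<close> dominates the absolute column sums of \<open>V\<close>, so a
    deviation \<open>\<delta>\<close> of the raw entries moves each rotated entry by at most
    \<open>e\<close>.\<close>
  define \<delta> where "\<delta> = e / cm"
  have \<delta>: "\<delta> > 0" using e cm0 by (simp add: \<delta>_def)
  define Box where "Box = PiE idx (\<lambda>p. {x0 p - \<delta><..<x0 p + \<delta>})"
  have "emeasure P Box = (\<Prod>p\<in>idx. emeasure (gauss1 \<sigma>) {x0 p - \<delta><..<x0 p + \<delta>})"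
    unfolding Box_def by (rule emeasure_PiM[OF finite_idx]) auto
  also have "\<dots> \<noteq> 0"
  proof
    assume "(\<Prod>p\<in>idx. emeasure (gauss1 \<sigma>) {x0 p - \<delta><..<x0 p + \<delta>}) = 0"
    then obtain p where "emeasure (gauss1 \<sigma>) {x0 p - \<delta><..<x0 p + \<delta>} = 0"
      using finite_idx by (auto simp: prod_zero_iff)
    then show False using emeasure_gauss1_interval_pos[OF \<sigma>, of "x0 p - \<delta>" "x0 p + \<delta>"] \<delta> by simp
  qed
  finally have pos: "emeasure P Box > 0" by (simp add: zero_less_iff_neq_zero)
  have W0: "W x0 j a = (if j = a \<and> a < k1 then 1 else 0)" if j: "j < n" for j a
  proof (cases "a < k1")
    case True
    then have "W x0 j a = (\<Sum>k<n. V $$ (k, j) * V $$ (k, a))" by (simp add: W_def x0_def)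
    then show ?thesis using V_orth[OF j, of a] True k1 by simp
  qed (simp add: W_def x0_def)
  define E where "E = Matrix.mat k2 k1 (\<lambda>(a, i). if a = i then 1 else 0 :: real)"
  have E: "E \<in> carrier_mat k2 k1" by (simp add: E_def)
  have EE: "transpose_mat E * E = 1\<^sub>m k1"
  proof (rule eq_matI)
    fix i j assume "i < dim_row (1\<^sub>m k1 :: real mat)" "j < dim_col (1\<^sub>m k1 :: real mat)"
    then have ij: "i < k1" "j < k1" by auto
    have "(transpose_mat E * E) $$ (i, j) = (\<Sum>a<k2. if a = i then (if i = j then 1 else 0) else 0)"
      unfolding transpose_mult_index[OF E E ij] using ij k2 by (intro sum.cong) (auto simp: E_def)
    then show "(transpose_mat E * E) $$ (i, j) = 1\<^sub>m k1 $$ (i, j)" using ij k2 by simp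
  qed (use E in auto)
  have "\<forall>j\<in>{k1..<n}. \<forall>i<k1. (w0 j i x)\<^sup>2 \<le> \<eta>" if x: "x \<in> Box" for x
  proof (intro ballI allI impI)
    fix j i assume j: "j \<in> {k1..<n}" and i: "i < k1"
    have diff: "\<bar>W x j a - W x0 j a\<bar> \<le> e" if j: "j < n" and a: "a < k2" for j a
    proof -
      have Wd: "W x j a - W x0 j a = (\<Sum>k<n. V $$ (k, j) * (x (k, a) - x0 (k, a)))"
        by (simp add: W_def right_diff_distrib sum_subtractf)
      have "\<bar>W x j a - W x0 j a\<bar> \<le> (\<Sum>k<n. \<bar>V $$ (k, j)\<bar> * \<bar>x (k, a) - x0 (k, a)\<bar>)"
        unfolding Wd by (rule order_trans[OF sum_abs]) (simp add: abs_mult)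
      also have "\<dots> \<le> (\<Sum>k<n. \<bar>V $$ (k, j)\<bar> * \<delta>)"
      proof (intro sum_mono mult_left_mono)
        fix k assume "k \<in> {..<n}"
        then have "(k, a) \<in> idx" using a by (simp add: idx_def)
        from PiE_mem[OF x[unfolded Box_def] this]
        show "\<bar>x (k, a) - x0 (k, a)\<bar> \<le> \<delta>" by (simp add: abs_le_iff)
      qed auto
      also have "\<dots> = c j * \<delta>" by (simp add: c_def sum_distrib_right)
      also have "\<dots> \<le> cm * \<delta>" using cm[OF j] \<delta> by (intro mult_right_mono) auto
      finally show ?thesis using cm0 by (simp add: \<delta>_def)
    qed
    define \<Delta> where "\<Delta> = Yt x - E"
    have \<Delta>: "\<Delta> \<in> carrier_mat k2 k1" unfolding \<Delta>_def by (rule minus_carrier_mat[OF E])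
    have \<Delta>e: "\<bar>\<Delta> $$ (a, l)\<bar> \<le> e" if "a < k2" "l < k1" for a l
    proof -
      have "\<Delta> $$ (a, l) = W x l a - W x0 l a"
        using that k1 W0[of l a] by (auto simp: \<Delta>_def Yt_def E_def)
      then show ?thesis using diff[of l a] that k1 by simp
    qed
    have f\<Delta>: "frob_norm \<Delta> \<le> 1 / 2"
    proof -
      have "frob_norm \<Delta> \<le> (\<Sum>p\<in>{..<k2} \<times> {..<k1}. \<bar>\<Delta> $$ p\<bar>)"
        unfolding frob_norm_L2_set[OF \<Delta>] by (rule L2_set_le_sum_abs)
      also have "\<dots> \<le> (\<Sum>p\<in>{..<k2} \<times> {..<k1}. e)" by (intro sum_mono) (use \<Delta>e in auto)
      also have "\<dots> = real k1 * real k2 * e" by (simp add: card_cartesian_product)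
      also have "\<dots> \<le> real k1 * real k2 * (1 / (2 * (real k1 * real k2 + 1)))"
        by (intro mult_left_mono e) simp
      also have "\<dots> \<le> 1 / 2"
      proof -
        have "m * (1 / (2 * (m + 1))) \<le> 1 / 2" if "m \<ge> 0" for m :: real
          using that by (simp add: field_simps)
        from this[of "real k1 * real k2"] show ?thesis
          by (simp only: of_nat_0_le_iff mult_nonneg_nonneg)
      qed
      finally show ?thesis .
    qed
    have co: "1 / 2 * frob_norm z \<le> frob_norm (Yt x * z)" if z: "z \<in> carrier_mat k1 p" for z p
    proof -
      have "E * z = Yt x * z - \<Delta> * z"
        unfolding \<Delta>_def using carrier_matD[OF Yt[of x]] carrier_matD[OF E] z
        by (simp add: diff_mult_dim) (rule eq_matI, auto simp del: index_mult_mat(1))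
      then have "frob_norm (E * z) \<le> frob_norm (Yt x * z) + frob_norm (\<Delta> * z)"
        using frob_norm_diff[of "Yt x * z" k2 p "\<Delta> * z"] Yt[of x] \<Delta> z by simp
      moreover have "frob_norm (\<Delta> * z) \<le> 1 / 2 * frob_norm z"
        using frob_norm_mult[OF \<Delta> z] mult_right_mono[OF f\<Delta>, of "frob_norm z"] by simp
      ultimately show ?thesis using frob_norm_orthonormal_mult[OF E EE z] by linarith
    qed
    \<comment> \<open>Coercivity 1/2 of \<open>Yt x\<close> gives 1/4 for the regularised Gram
      matrix, hence norm at most 4 for \<open>G\<close> and entries of size at most 2 for
      \<open>Yt x * G\<close>, uniformly in \<open>d\<close>.\<close>
    have wb: "\<bar>wreg d j i x\<bar> \<le> real k2 * (e * 2)" if d: "d > 0" for d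
    proof -
      define G where "G = mat_inv (reg_gram d (Yt x))"
      note r = reg_gram[OF Yt d, of x, folded G_def]
      have S: "reg_gram d (Yt x) \<in> carrier_mat k1 k1" using Yt[of x] by (simp add: reg_gram_def)
      have "op_bounded (1 / (1 / 2)\<^sup>2) G" unfolding G_def
      proof (rule coercive_inverse_bounded[OF S])
        show "(1 / 2)\<^sup>2 * frob_norm z \<le> frob_norm (reg_gram d (Yt x) * z)" if "z \<in> carrier_mat k1 m" for z m
          by (rule reg_gram_coercive[OF Yt _ _ co[OF that] that]) (use d in auto)
      qed simp
      then have G4: "\<bar>G $$ (i, i)\<bar> \<le> 4" using op_bounded_entry[OF _ r(1) i i] by (simp add: power2_eq_square)
      have T2: "\<bar>(Yt x * G) $$ (b, i)\<bar> \<le> 2" if b: "b < k2" for b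
      proof -
        have "((Yt x * G) $$ (b, i))\<^sup>2 \<le> (\<Sum>b<k2. ((Yt x * G) $$ (b, i))\<^sup>2)" using b by (intro member_le_sum) auto
        also have "\<dots> \<le> 2\<^sup>2" using reg_pinv_bounds(3)[OF Yt d i, of x, folded G_def] G4 by simp
        finally show ?thesis by (simp only: abs_le_square_iff[symmetric] abs_numeral)
      qed
      have Wb: "\<bar>W x j b\<bar> \<le> e" if b: "b < k2" for b
        using diff[of j b] W0[of j b] j b by (auto split: if_splits)
      have "\<bar>wreg d j i x\<bar> \<le> (\<Sum>b<k2. \<bar>W x j b\<bar> * \<bar>(Yt x * G) $$ (b, i)\<bar>)"
        unfolding wreg_eq[OF d i] G_def by (rule order_trans[OF sum_abs]) (simp add: abs_mult del: index_mult_mat(1))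
      also have "\<dots> \<le> (\<Sum>b<k2. e * 2)"
        by (intro sum_mono mult_mono Wb T2) (use e in auto)
      finally show ?thesis by simp
    qed
    have "\<bar>w0 j i x\<bar> \<le> real k2 * (e * 2)"
      by (rule LIMSEQ_le_const2[OF tendsto_rabs[OF w0_limit[OF i]]]) (use wb in auto)
    also have "\<dots> = (2 * real k2) * e" by simp
    also have "\<dots> \<le> (2 * real k2) * (sqrt \<eta> / (2 * real k2 + 1))" by (intro mult_left_mono e) simp
    also have "\<dots> \<le> sqrt \<eta>" using \<eta> by (simp add: field_simps)
    finally have "\<bar>w0 j i x\<bar>\<^sup>2 \<le> (sqrt \<eta>)\<^sup>2" by (rule power_mono) simp
    then show "(w0 j i x)\<^sup>2 \<le> \<eta>" using \<eta> by simp
  qed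
  moreover have "Box \<subseteq> space P" by (auto simp: Box_def space_PiM PiE_def Pi_def)
  ultimately have sub: "Box \<subseteq> {x \<in> space P. \<forall>j\<in>{k1..<n}. \<forall>i<k1. (w0 j i x)\<^sup>2 \<le> \<eta>}" by auto
  have [measurable]: "w0 j i \<in> borel_measurable P" if "i < k1" for i j using w0_measurable[OF that] .
  have "{x \<in> space P. \<forall>j\<in>{k1..<n}. \<forall>i\<in>{..<k1}. (w0 j i x)\<^sup>2 \<le> \<eta>} \<in> sets P"
    by measurable
  then have "emeasure P Box \<le> emeasure P {x \<in> space P. \<forall>j\<in>{k1..<n}. \<forall>i<k1. (w0 j i x)\<^sup>2 \<le> \<eta>}"
    by (intro emeasure_mono[OF sub]) auto
  then show ?thesis using pos by (rule less_le_trans[rotated])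
qed

end

subsection \<open>The compressed pseudoinverse\<close>

lemma orth_compl_mult_zero:
  assumes Y: "Y \<in> carrier_mat k m" and Q: "Q \<in> carrier_mat k q" and oc: "is_orth_compl Y Q"
  shows "transpose_mat Y * Q = 0\<^sub>m m q"
proof -
  interpret vec_space "TYPE(real)" k .
  have cs: "col_space Q = orthogonal_complement (col_space Y)"
    using oc Y unfolding is_orth_compl_def by simp
  have cY: "set (cols Y) \<subseteq> carrier_vec k" and cQ: "set (cols Q) \<subseteq> carrier_vec k"
    using cols_dim[of Y] cols_dim[of Q] Y Q by auto
  show ?thesis
  proof (rule eq_matI)
    fix i j assume "i < dim_row (0\<^sub>m m q :: real mat)" "j < dim_col (0\<^sub>m m q :: real mat)"
    then have ij: "i < m" "j < q" by auto
    have "col Q j \<in> set (cols Q)" using ij Q by (metis carrier_matD(2) cols_length cols_nth nth_mem)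
    then have "col Q j \<in> col_space Q" unfolding col_space_def by (rule subsetD[OF in_own_span[OF cQ]])
    then have "col Q j \<in> orthogonal_complement (col_space Y)" unfolding cs .
    moreover have "col Y i \<in> set (cols Y)" using ij Y by (metis carrier_matD(2) cols_length cols_nth nth_mem)
    then have "col Y i \<in> col_space Y" unfolding col_space_def by (rule subsetD[OF in_own_span[OF cY]])
    ultimately have "col Q j \<bullet> col Y i = 0" unfolding orthogonal_complement_def by blast
    moreover have "col Y i \<in> carrier_vec k" "col Q j \<in> carrier_vec k" using Y Q by (simp_all add: carrier_vecI)
    ultimately have "col Y i \<bullet> col Q j = 0" using comm_scalar_prod[of "col Y i" k "col Q j"] by simp
    then show "(transpose_mat Y * Q) $$ (i, j) = 0\<^sub>m m q $$ (i, j)" using ij Y Q by simp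
  qed (use Y Q in auto)
qed

text \<open>The complement is given only through its column space. Factoring through
  \<open>Q\<close> whatever \<open>transpose_mat Y\<close> annihilates is what later exhibits the
  pseudoinverse of \<open>X1 * Q\<close>.\<close>

lemma orth_compl_factor:
  assumes Y: "Y \<in> carrier_mat k m" and Q: "Q \<in> carrier_mat k q" and oc: "is_orth_compl Y Q"
    and Z: "Z \<in> carrier_mat k p" and YZ: "transpose_mat Y * Z = 0\<^sub>m m p"
  shows "\<exists>C \<in> carrier_mat q p. Z = Q * C"
proof -
  interpret vec_space "TYPE(real)" k .
  have cs: "col_space Q = orthogonal_complement (col_space Y)"
    using oc Y unfolding is_orth_compl_def by simp
  have cY: "set (cols Y) \<subseteq> carrier_vec k" using cols_dim[of Y] Y by auto
  have "\<exists>c. c \<in> carrier_vec q \<and> Q *\<^sub>v c = col Z j" if j: "j < p" for j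
  proof -
    have cZ: "col Z j \<in> carrier_vec k" using Z by (simp add: carrier_vecI)
    have "col Z j \<bullet> y = 0" if y: "y \<in> set (cols Y)" for y
    proof -
      obtain i where i': "i < dim_col Y" and i2: "y = col Y i"
        using y unfolding cols_def by auto
      have i: "i < m" "y = col Y i" using i' i2 carrier_matD(2)[OF Y] by auto
      have "(transpose_mat Y * Z) $$ (i, j) = 0" unfolding YZ using i j by simp
      then have "col Y i \<bullet> col Z j = 0" using i j Y Z by simp
      moreover have "col Y i \<in> carrier_vec k" using Y by (simp add: carrier_vecI)
      ultimately show ?thesis using comm_scalar_prod[OF cZ, of "col Y i"] i by simp
    qed
    then have "col Z j \<in> orthogonal_complement (set (cols Y))"
      using cZ unfolding orthogonal_complement_def by blast
    then have "col Z j \<in> col_space Q"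
      unfolding cs unfolding col_space_def in_orthogonal_complement_span[OF cY] .
    then show ?thesis unfolding col_space_eq[OF Q] using Q by auto
  qed
  then obtain c where c: "\<And>j. j < p \<Longrightarrow> c j \<in> carrier_vec q \<and> Q *\<^sub>v c j = col Z j" by metis
  define C where "C = Matrix.mat q p (\<lambda>(i, j). c j $ i)"
  have C: "C \<in> carrier_mat q p" by (simp add: C_def)
  have "Z = Q * C"
  proof (rule eq_matI)
    fix i j assume "i < dim_row (Q * C)" "j < dim_col (Q * C)"
    then have ij: "i < k" "j < p" using Q C by auto
    have cj: "col C j = c j" using c[OF ij(2)] ij by (intro eq_vecI) (auto simp: C_def)
    have "Z $$ (i, j) = (Q *\<^sub>v c j) $ i" using c[OF ij(2)] ij Z by simp
    also have "\<dots> = (Q * C) $$ (i, j)" using ij Q C cj by simp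
    finally show "Z $$ (i, j) = (Q * C) $$ (i, j)" .
  qed (use Q C Z in auto)
  then show ?thesis using C by blast
qed

text \<open>Multiply \<open>M * N * M = M\<close> by \<open>transpose_mat M\<close> from the left
  and cancel the invertible Gram matrix.\<close>

lemma pinv_full_column_rank:
  assumes M: "M \<in> carrier_mat m n" and det: "det (transpose_mat M * M) \<noteq> 0"
  shows "pinv M * M = 1\<^sub>m n"
proof -
  define N where "N = pinv M"
  define A where "A = transpose_mat M * M"
  have A: "A \<in> carrier_mat n n" using M by (simp add: A_def)
  have N: "N \<in> carrier_mat n m" using pinv_carrier[OF M] by (simp add: N_def)
  note inv = mat_inv[OF A det[folded A_def]]
  have p: "M * N * M = M" using is_pinv_pinv[of M] unfolding is_pinv_def N_def by simp
  note dims = carrier_matD[OF M] carrier_matD[OF N] carrier_matD[OF inv(1)] carrier_matD[OF A]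
  have "A * (N * M) = transpose_mat M * (M * N * M)" using dims by (simp add: A_def mult_assoc_dim)
  then have "A * (N * M) = A" unfolding p A_def .
  then have "mat_inv A * A * (N * M) = mat_inv A * A" using dims by (simp add: mult_assoc_dim)
  then show ?thesis unfolding inv(3) using dims by (simp add: one_mult_dim N_def)
qed

lemma sum_lessThan_split:
  "r \<le> k \<Longrightarrow> (\<Sum>i<k. f i) = (\<Sum>i<r. f i) + (\<Sum>i<k - r. f (r + i :: nat) :: real)"
proof -
  assume "r \<le> k"
  then obtain m where k: "k = r + m" using le_Suc_ex by blast
  show ?thesis unfolding k by (induction m) (auto simp: add.assoc)
qed

text \<open>On the full-rank event, the pseudoinverse of \<open>X1 Q\<close> composed with \<open>Q\<close> consists of the first
  \<open>r\<close> columns of the transposed pseudoinverse of the stacked matrix \<open>Y = [X1; X2]\<close>, here given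
  through its transpose \<open>M\<close>.\<close>

lemma pinv_compressed_block:
  assumes M: "M \<in> carrier_mat k m" and det: "det (transpose_mat M * M) \<noteq> 0" and r: "r \<le> m"
    and X1: "X1 \<in> carrier_mat r k" "\<And>i b. i < r \<Longrightarrow> b < k \<Longrightarrow> X1 $$ (i, b) = M $$ (b, i)"
    and X2: "X2 \<in> carrier_mat (m - r) k" "\<And>i b. i < m - r \<Longrightarrow> b < k \<Longrightarrow> X2 $$ (i, b) = M $$ (b, r + i)"
    and Q: "Q \<in> carrier_mat k q" and oc: "is_orth_compl (transpose_mat X2) Q"
  defines "T1 \<equiv> Matrix.mat k r (\<lambda>(b, i). pinv M $$ (i, b))"
  shows "Q * pinv (X1 * Q) = T1" "X1 * T1 = 1\<^sub>m r"
proof -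
  define N where "N = pinv M"
  have N: "N \<in> carrier_mat m k" using pinv_carrier[OF M] by (simp add: N_def)
  have NM: "N * M = 1\<^sub>m m" unfolding N_def by (rule pinv_full_column_rank[OF M det])
  have sym: "transpose_mat (M * N) = M * N" using is_pinv_pinv[of M] unfolding is_pinv_def N_def by simp
  define T2 where "T2 = Matrix.mat k (m - r) (\<lambda>(b, i). N $$ (r + i, b))"
  have T1: "T1 \<in> carrier_mat k r" and T2: "T2 \<in> carrier_mat k (m - r)" by (auto simp: T1_def T2_def)
  \<comment> \<open>The rows of the pseudoinverse are dual to the columns of \<open>M\<close>; this
    yields both \<open>X1 * T1 = 1\<close> and \<open>X2 * T1 = 0\<close>.\<close>
  have dual: "(\<Sum>b<k. M $$ (b, j) * N $$ (i, b)) = (if i = j then 1 else 0)" if "i < m" "j < m" for i j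
    using mult_mat_index[OF N M that] that unfolding NM by (simp add: mult.commute)
  show XT: "X1 * T1 = 1\<^sub>m r"
  proof (rule eq_matI)
    fix i j assume "i < dim_row (1\<^sub>m r :: real mat)" "j < dim_col (1\<^sub>m r :: real mat)"
    then have ij: "i < r" "j < r" by auto
    have "(X1 * T1) $$ (i, j) = (\<Sum>b<k. M $$ (b, i) * N $$ (j, b))"
      unfolding mult_mat_index[OF X1(1) T1 ij] using ij X1(2) by (intro sum.cong) (auto simp: T1_def N_def)
    then show "(X1 * T1) $$ (i, j) = 1\<^sub>m r $$ (i, j)" using dual[of j i] ij r by auto
  qed (use X1 T1 in auto)
  have X2T: "X2 * T1 = 0\<^sub>m (m - r) r"
  proof (rule eq_matI)
    fix i j assume "i < dim_row (0\<^sub>m (m - r) r :: real mat)" "j < dim_col (0\<^sub>m (m - r) r :: real mat)"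
    then have ij: "i < m - r" "j < r" by auto
    have "(X2 * T1) $$ (i, j) = (\<Sum>b<k. M $$ (b, r + i) * N $$ (j, b))"
      unfolding mult_mat_index[OF X2(1) T1 ij] using ij X2(2) by (intro sum.cong) (auto simp: T1_def N_def)
    then show "(X2 * T1) $$ (i, j) = 0\<^sub>m (m - r) r $$ (i, j)" using dual[of j "r + i"] ij r by auto
  qed (use X2 T1 in auto)
  have X2T': "transpose_mat X2 \<in> carrier_mat k (m - r)" using X2 by simp
  have QX2: "X2 * Q = 0\<^sub>m (m - r) q" using orth_compl_mult_zero[OF X2T' Q oc] by simp
  \<comment> \<open>\<open>X2 * T1 = 0\<close> places the columns of \<open>T1\<close> in the range
    of \<open>Q\<close>; the factor \<open>C\<close> is the candidate for the pseudoinverse of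
    \<open>X1 * Q\<close>.\<close>
  obtain C where C: "C \<in> carrier_mat q r" and TC: "T1 = Q * C"
    using orth_compl_factor[OF X2T' Q oc T1] X2T by auto
  have QQ: "transpose_mat Q * Q = 1\<^sub>m q" using oc Q unfolding is_orth_compl_def orthonormal_cols_def by simp
  note dims = carrier_matD[OF M] carrier_matD[OF N] carrier_matD[OF T1] carrier_matD[OF T2] carrier_matD[OF X1(1)]
    carrier_matD[OF X2(1)] carrier_matD[OF Q] carrier_matD[OF C]
  have CT: "C = transpose_mat Q * T1" unfolding TC using dims QQ by (simp add: mult_assoc_dim[symmetric] one_mult_dim)
  \<comment> \<open>The orthogonal projector \<open>M * N\<close>, split by row blocks.
    Multiplication by \<open>Q\<close> removes the \<open>X2\<close> part, and symmetry of the
    projector then gives the last Penrose condition.\<close>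
  have MN: "M * N = T1 * X1 + T2 * X2"
  proof (rule eq_matI)
    fix a b assume "a < dim_row (T1 * X1 + T2 * X2)" "b < dim_col (T1 * X1 + T2 * X2)"
    then have ab: "a < k" "b < k" using dims by auto
    have "(M * N) $$ (a, b) = (M * N) $$ (b, a)"
      using sym ab dims by (metis index_mult_mat(2,3) index_transpose_mat(1))
    also have "\<dots> = (\<Sum>i<m. N $$ (i, a) * M $$ (b, i))"
      unfolding mult_mat_index[OF M N ab(2,1)] by (simp add: mult.commute)
    also have "\<dots> = (\<Sum>i<r. N $$ (i, a) * M $$ (b, i)) + (\<Sum>i<m - r. N $$ (r + i, a) * M $$ (b, r + i))"
      by (rule sum_lessThan_split[OF r])
    also have "(\<Sum>i<r. N $$ (i, a) * M $$ (b, i)) = (T1 * X1) $$ (a, b)"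
      unfolding mult_mat_index[OF T1 X1(1) ab] using ab X1(2) by (intro sum.cong) (auto simp: T1_def N_def)
    also have "(\<Sum>i<m - r. N $$ (r + i, a) * M $$ (b, r + i)) = (T2 * X2) $$ (a, b)"
      unfolding mult_mat_index[OF T2 X2(1) ab] using ab X2(2) by (intro sum.cong) (auto simp: T2_def)
    finally show "(M * N) $$ (a, b) = (T1 * X1 + T2 * X2) $$ (a, b)"
      using ab dims by (simp del: index_mult_mat(1))
  qed (use dims in auto)
  have "T2 * (X2 * Q) = 0\<^sub>m k q" unfolding QX2 using T2 by simp
  moreover have "T1 * (X1 * Q) \<in> carrier_mat k q" using T1 X1 Q by simp
  ultimately have TX: "M * N * Q = T1 * (X1 * Q)"
    unfolding MN using dims by (simp add: add_mult_dim mult_assoc_dim right_add_zero_mat[of _ k q])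
  have "is_pinv (X1 * Q) C"
    unfolding is_pinv_def
  proof (intro conjI)
    show "C \<in> carrier_mat (dim_col (X1 * Q)) (dim_row (X1 * Q))" using C dims by simp
    have one: "X1 * Q * C = 1\<^sub>m r" using XT unfolding TC using dims by (simp add: mult_assoc_dim)
    show "X1 * Q * C * (X1 * Q) = X1 * Q" unfolding one using dims by (simp add: one_mult_dim)
    have "C * (X1 * Q) * C = C * (X1 * Q * C)" using dims by (simp add: mult_assoc_dim)
    then show "C * (X1 * Q) * C = C" unfolding one using dims by (simp add: mult_one_dim)
    show "transpose_mat (X1 * Q * C) = X1 * Q * C" unfolding one by simp
    have e: "C * (X1 * Q) = transpose_mat Q * (M * N * Q)"
      unfolding CT TX using dims by (simp add: mult_assoc_dim)
    have "transpose_mat (M * N * Q) = transpose_mat Q * (M * N)"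
      using dims sym by (subst transpose_mult_dim) auto
    then show "transpose_mat (C * (X1 * Q)) = C * (X1 * Q)"
      unfolding e using dims by (simp add: transpose_mult_dim mult_assoc_dim)
  qed
  then show "Q * pinv (X1 * Q) = T1" using TC pinv_eqI by simp
qed

text \<open>\<open>U\<close> and \<open>T1\<close> have the same range: \<open>T1 = U * Rh\<close>,
  and \<open>X1 * T1 = 1\<close> makes the square factor \<open>Rh\<close> invertible. The
  compressed matrix is therefore \<open>U * Z * transpose_mat U\<close> with \<open>Z\<close>
  congruent to \<open>M0\<close>. As \<open>U\<close> has orthonormal columns, inverting
  \<open>Z\<close> gives the pseudoinverse, and the factors \<open>Rh\<close> recombine with
  \<open>U\<close> to \<open>T1\<close>.\<close>

lemma pinv_projected_core:
  assumes A: "A \<in> carrier_mat n n" and X: "X \<in> carrier_mat n k" and X1: "X1 \<in> carrier_mat r k"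
    and Q: "Q \<in> carrier_mat k q" "transpose_mat Q * Q = 1\<^sub>m q"
    and qr: "is_thin_qr N Qh Rh" and N: "N \<in> carrier_mat q r"
    and T1: "T1 = Q * N" and XT: "X1 * T1 = 1\<^sub>m r"
    and M0: "M0 = transpose_mat T1 * transpose_mat X * A * X * T1" and det: "det M0 \<noteq> 0"
  defines "U \<equiv> Q * Qh"
  defines "P \<equiv> U * transpose_mat U"
  shows "pinv (P * transpose_mat X * A * X * P) = T1 * mat_inv M0 * transpose_mat T1"
proof -
  have Qh: "Qh \<in> carrier_mat q r" "transpose_mat Qh * Qh = 1\<^sub>m r" and Rh: "Rh \<in> carrier_mat r r" and NQR: "N = Qh * Rh"
    using qr N unfolding is_thin_qr_def orthonormal_cols_def by auto
  have U: "U \<in> carrier_mat k r" using Q Qh by (simp add: U_def)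
  have T1c: "T1 \<in> carrier_mat k r" using Q N by (simp add: T1)
  have M0c: "M0 \<in> carrier_mat r r"
    using carrier_matD[OF T1c] by (intro carrier_matI) (simp_all add: M0)
  note inv = mat_inv[OF M0c det]
  define S where "S = X1 * U"
  have S: "S \<in> carrier_mat r r" using X1 U by (simp add: S_def)
  note dims = carrier_matD[OF A] carrier_matD[OF X] carrier_matD[OF X1] carrier_matD[OF Q(1)] carrier_matD[OF Qh(1)]
    carrier_matD[OF Rh] carrier_matD[OF U] carrier_matD[OF T1c] carrier_matD[OF M0c] carrier_matD[OF inv(1)] carrier_matD[OF S]
  have UR: "T1 = U * Rh" unfolding T1 NQR U_def using dims by (simp add: mult_assoc_dim)
  have "S * Rh = 1\<^sub>m r" using XT unfolding UR S_def using dims by (simp add: mult_assoc_dim)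
  then have SR: "S * Rh = 1\<^sub>m r" and RS: "Rh * S = 1\<^sub>m r" using mat_mult_left_right_inverse[OF S Rh] by auto
  have "T1 * S = U * (Rh * S)" unfolding UR using dims by (simp add: mult_assoc_dim)
  then have UTS: "U = T1 * S" unfolding RS using dims by (simp add: mult_one_dim)
  have UU: "transpose_mat U * U = 1\<^sub>m r"
  proof -
    have "transpose_mat U * U = transpose_mat Qh * (transpose_mat Q * Q) * Qh"
      unfolding U_def using dims by (simp add: transpose_mult_dim mult_assoc_dim)
    then show ?thesis unfolding Q(2) using Qh dims by (simp add: mult_one_dim)
  qed
  define I0 where "I0 = mat_inv M0"
  have I0: "dim_row I0 = r" "dim_col I0 = r" using inv(1) by (auto simp: I0_def)
  define Z where "Z = transpose_mat S * M0 * S"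
  define Z' where "Z' = Rh * I0 * transpose_mat Rh"
  have Zd: "dim_row Z = r" "dim_col Z = r" "dim_row Z' = r" "dim_col Z' = r"
    using dims I0 by (auto simp: Z_def Z'_def)
  have Zc: "Z \<in> carrier_mat r r" "Z' \<in> carrier_mat r r" using Zd by (auto intro: carrier_matI)
  have "Z * Z' = transpose_mat S * M0 * (S * Rh) * I0 * transpose_mat Rh"
    unfolding Z_def Z'_def using dims I0 by (simp add: mult_assoc_dim)
  also have "\<dots> = transpose_mat S * (M0 * I0) * transpose_mat Rh"
    unfolding SR using dims I0 by (simp add: mult_assoc_dim mult_one_dim one_mult_dim)
  also have "\<dots> = transpose_mat (Rh * S)"
    unfolding I0_def inv(2) using dims by (simp add: mult_one_dim transpose_mult_dim)
  finally have ZZ: "Z * Z' = 1\<^sub>m r" unfolding RS by simp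
  then have ZZ': "Z' * Z = 1\<^sub>m r" using mat_mult_left_right_inverse[OF Zc] by simp
  have core: "P * transpose_mat X * A * X * P = U * Z * transpose_mat U"
  proof -
    have "transpose_mat U * (transpose_mat X * A * X) * U = Z"
      unfolding UTS Z_def M0 using dims by (simp add: transpose_mult_dim mult_assoc_dim)
    moreover have "P * transpose_mat X * A * X * P = U * (transpose_mat U * (transpose_mat X * A * X) * U) * transpose_mat U"
      unfolding P_def using dims by (simp add: mult_assoc_dim)
    ultimately show ?thesis by simp
  qed
  have cand: "T1 * mat_inv M0 * transpose_mat T1 = U * Z' * transpose_mat U"
    unfolding UR Z'_def I0_def[symmetric] using dims I0 by (simp add: transpose_mult_dim mult_assoc_dim)
  have mid: "U * a * transpose_mat U * (U * b * transpose_mat U) = U * (a * b) * transpose_mat U"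
    if "dim_row a = r" "dim_col a = r" "dim_row b = r" "dim_col b = r" for a b
  proof -
    have "U * a * transpose_mat U * (U * b * transpose_mat U) = U * a * (transpose_mat U * U) * b * transpose_mat U"
      using dims that by (simp add: mult_assoc_dim)
    then show ?thesis unfolding UU using dims that by (simp add: mult_assoc_dim mult_one_dim one_mult_dim)
  qed
  have P1: "U * 1\<^sub>m r * transpose_mat U = P" unfolding P_def using dims by (simp add: mult_one_dim)
  have PT: "transpose_mat P = P" unfolding P_def using dims by (simp add: transpose_mult_dim)
  show ?thesis
  proof (rule pinv_eqI, unfold core cand is_pinv_def, intro conjI)
    show "U * Z' * transpose_mat U \<in> carrier_mat (dim_col (U * Z * transpose_mat U)) (dim_row (U * Z * transpose_mat U))"
      using dims Zd by (intro carrier_matI) auto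
    show "transpose_mat (U * Z * transpose_mat U * (U * Z' * transpose_mat U)) = U * Z * transpose_mat U * (U * Z' * transpose_mat U)"
      unfolding mid[OF Zd] ZZ P1 by (rule PT)
    show "transpose_mat (U * Z' * transpose_mat U * (U * Z * transpose_mat U)) = U * Z' * transpose_mat U * (U * Z * transpose_mat U)"
      unfolding mid[OF Zd(3,4,1,2)] ZZ' P1 by (rule PT)
    show "U * Z * transpose_mat U * (U * Z' * transpose_mat U) * (U * Z * transpose_mat U) = U * Z * transpose_mat U"
      unfolding mid[OF Zd] ZZ mid[OF index_one_mat(2,3) Zd(1,2)] using Zd by (simp add: one_mult_dim)
    show "U * Z' * transpose_mat U * (U * Z * transpose_mat U) * (U * Z' * transpose_mat U) = U * Z' * transpose_mat U"
      unfolding mid[OF Zd(3,4,1,2)] ZZ' mid[OF index_one_mat(2,3) Zd(3,4)] using Zd by (simp add: one_mult_dim)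
  qed
qed

lemma nuclear_norm_orthogonal_conj:
  assumes V: "V \<in> carrier_mat n n" "transpose_mat V * V = 1\<^sub>m n" "V * transpose_mat V = 1\<^sub>m n"
    and E: "E \<in> carrier_mat n n" "transpose_mat E = E"
  shows "nuclear_norm (V * E * transpose_mat V) = nuclear_norm E"
proof -
  obtain U d where U: "U \<in> carrier_mat n n" "transpose_mat U * U = 1\<^sub>m n" "U * transpose_mat U = 1\<^sub>m n"
    and EU: "E = U * mat_diag n d * transpose_mat U" using spectral_theorem[OF E] by blast
  note dims = carrier_matD[OF V(1)] carrier_matD[OF U(1)]
  have "transpose_mat (V * U) * (V * U) = transpose_mat U * (transpose_mat V * V) * U"
    using dims by (simp add: transpose_mult_dim mult_assoc_dim)
  then have 1: "transpose_mat (V * U) * (V * U) = 1\<^sub>m n" unfolding V(2) using U dims by (simp add: mult_one_dim)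
  have "V * U * transpose_mat (V * U) = V * (U * transpose_mat U) * transpose_mat V"
    using dims by (simp add: transpose_mult_dim mult_assoc_dim)
  then have 2: "V * U * transpose_mat (V * U) = 1\<^sub>m n" unfolding U(3) using V dims by (simp add: mult_one_dim)
  have VU: "V * U \<in> carrier_mat n n" using V U by simp
  have "V * E * transpose_mat V = (V * U) * mat_diag n d * transpose_mat (V * U)"
    unfolding EU using dims by (simp add: transpose_mult_dim mult_assoc_dim)
  then show ?thesis using nuclear_norm_symmetric[OF VU 1 2] nuclear_norm_symmetric[OF U EU] by simp
qed

subsection \<open>The conditional expectation\<close>

text \<open>\<open>Z\<close> is at most \<open>t\<close> on \<open>F\<close> and above
  \<open>t\<close> off \<open>F\<close>, so the average over \<open>F\<close> cannot exceed that
  over the complement. The comparison is multiplied out by \<open>q\<close> and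
  \<open>1 - q\<close>, which also covers \<open>q = 1\<close>.\<close>

lemma (in prob_space) conditional_mean_le:
  fixes Z :: "'a \<Rightarrow> real"
  assumes Z: "integrable M Z" and Fdef: "F = {\<omega> \<in> space M. Z \<omega> \<le> t}" and p: "prob F > 0"
  shows "integrable (uniform_measure M F) Z" "(\<integral>\<omega>. Z \<omega> \<partial>uniform_measure M F) \<le> (\<integral>\<omega>. Z \<omega> \<partial>M)"
proof -
  have [measurable]: "Z \<in> borel_measurable M" using Z by (rule borel_measurable_integrable)
  have F_sets [measurable]: "F \<in> sets M" unfolding Fdef by measurable
  define q where "q = prob F"
  have q: "q > 0" "q \<le> 1" using p by (auto simp: q_def)
  have dens: "uniform_measure M F = density M (\<lambda>\<omega>. ennreal (indicator F \<omega> / q))"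
    unfolding uniform_measure_def emeasure_eq_measure q_def[symmetric]
    by (intro density_cong) (use q in \<open>auto simp: ennreal_indicator[symmetric] divide_ennreal split: split_indicator intro!: AE_I2\<close>)
  have i1: "integrable M (\<lambda>\<omega>. indicator F \<omega> * Z \<omega>)" and i2: "integrable M (\<lambda>\<omega>. indicator (space M - F) \<omega> * Z \<omega>)"
    using integrable_mult_indicator[OF F_sets Z] integrable_mult_indicator[of "space M - F" M Z] Z F_sets by auto
  have e: "(\<lambda>\<omega>. (indicator F \<omega> / q) *\<^sub>R Z \<omega>) = (\<lambda>\<omega>. (indicator F \<omega> * Z \<omega>) / q)" by auto
  show "integrable (uniform_measure M F) Z"
    unfolding dens using q i1 by (subst integrable_density) (auto simp: e)
  have I: "(\<integral>\<omega>. Z \<omega> \<partial>uniform_measure M F) = (\<integral>\<omega>. indicator F \<omega> * Z \<omega> \<partial>M) / q"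
    unfolding dens using q by (subst integral_density) (auto simp: e)
  have up: "(\<integral>\<omega>. indicator F \<omega> * Z \<omega> \<partial>M) \<le> t * q"
  proof -
    have "(\<integral>\<omega>. indicator F \<omega> * Z \<omega> \<partial>M) \<le> (\<integral>\<omega>. t * indicator F \<omega> \<partial>M)"
      by (rule integral_mono[OF i1]) (auto simp: Fdef integrable_indicator_iff less_top[symmetric] split: split_indicator intro!: integrable_mult_right)
    then show ?thesis by (simp add: q_def)
  qed
  have "prob (space M - F) = 1 - q" using prob_compl[OF F_sets] by (simp add: q_def)
  have lo: "t * (1 - q) \<le> (\<integral>\<omega>. indicator (space M - F) \<omega> * Z \<omega> \<partial>M)"
  proof -
    have "(\<integral>\<omega>. t * indicator (space M - F) \<omega> \<partial>M) \<le> (\<integral>\<omega>. indicator (space M - F) \<omega> * Z \<omega> \<partial>M)"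
      by (rule integral_mono[OF _ i2]) (auto simp: Fdef integrable_indicator_iff less_top[symmetric] split: split_indicator intro!: integrable_mult_right)
    then show ?thesis using \<open>prob (space M - F) = 1 - q\<close> by (simp add: Int_absorb1)
  qed
  have "(\<integral>\<omega>. Z \<omega> \<partial>M) = (\<integral>\<omega>. indicator F \<omega> * Z \<omega> + indicator (space M - F) \<omega> * Z \<omega> \<partial>M)"
    by (intro Bochner_Integration.integral_cong) (auto split: split_indicator)
  also have "\<dots> = (\<integral>\<omega>. indicator F \<omega> * Z \<omega> \<partial>M) + (\<integral>\<omega>. indicator (space M - F) \<omega> * Z \<omega> \<partial>M)"
    by (rule Bochner_Integration.integral_add[OF i1 i2])
  finally have tot: "(\<integral>\<omega>. Z \<omega> \<partial>M) = (\<integral>\<omega>. indicator F \<omega> * Z \<omega> \<partial>M) + (\<integral>\<omega>. indicator (space M - F) \<omega> * Z \<omega> \<partial>M)" .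
  have "(\<integral>\<omega>. indicator F \<omega> * Z \<omega> \<partial>M) * (1 - q) \<le> t * q * (1 - q)"
    using up q by (intro mult_right_mono) auto
  also have "\<dots> = q * (t * (1 - q))" by simp
  also have "\<dots> \<le> q * (\<integral>\<omega>. indicator (space M - F) \<omega> * Z \<omega> \<partial>M)" using lo q by (intro mult_left_mono) auto
  finally have "(\<integral>\<omega>. indicator F \<omega> * Z \<omega> \<partial>M) \<le> q * (\<integral>\<omega>. Z \<omega> \<partial>M)"
    unfolding tot by (simp add: algebra_simps)
  then show "(\<integral>\<omega>. Z \<omega> \<partial>uniform_measure M F) \<le> (\<integral>\<omega>. Z \<omega> \<partial>M)"
    unfolding I using q by (simp add: pos_divide_le_eq mult.commute)
qed

text \<open>Independence and the common density identify the law of the entries with a product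
  measure, on which the moments are computed. Positive sizes keep the index set nonempty.\<close>

lemma gaussian_mat_distr:
  assumes "prob_space M" and X: "gaussian_mat M n k X" and nk: "n > 0" "k > 0"
  shows "\<exists>\<sigma>>0. distr M (gaussN \<sigma> ({..<n} \<times> {..<k})) (\<lambda>\<omega>. \<lambda>p\<in>{..<n} \<times> {..<k}. X \<omega> $$ p) = gaussN \<sigma> ({..<n} \<times> {..<k})
    \<and> (\<lambda>\<omega>. \<lambda>p\<in>{..<n} \<times> {..<k}. X \<omega> $$ p) \<in> measurable M (gaussN \<sigma> ({..<n} \<times> {..<k}))"
proof -
  interpret prob_space M by fact
  let ?I = "{..<n} \<times> {..<k}"
  obtain \<sigma> where s: "\<sigma> > 0" and d: "\<And>i j. i < n \<Longrightarrow> j < k \<Longrightarrow> distributed M lborel (\<lambda>\<omega>. X \<omega> $$ (i, j)) (normal_density 0 \<sigma>)"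
    using X unfolding gaussian_mat_def by auto
  have m: "(\<lambda>\<omega>. X \<omega> $$ p) \<in> borel_measurable M" if "p \<in> ?I" for p
    using X that unfolding gaussian_mat_def random_mat_def by auto
  have dp: "distr M borel (\<lambda>\<omega>. X \<omega> $$ p) = gauss1 \<sigma>" if "p \<in> ?I" for p
  proof -
    have "distributed M lborel (\<lambda>\<omega>. X \<omega> $$ p) (normal_density 0 \<sigma>)" using d that by auto
    then have "distr M lborel (\<lambda>\<omega>. X \<omega> $$ p) = gauss1 \<sigma>" by (rule distributed_distr_eq_density[symmetric, THEN sym])
    moreover have "distr M lborel (\<lambda>\<omega>. X \<omega> $$ p) = distr M borel (\<lambda>\<omega>. X \<omega> $$ p)" by (rule distr_cong) auto
    ultimately show ?thesis by simp
  qed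
  have ne: "?I \<noteq> {}" using nk by auto
  have iv: "indep_vars (\<lambda>_. borel) (\<lambda>ij \<omega>. X \<omega> $$ ij) ?I" using X unfolding gaussian_mat_def by simp
  have "distr M (PiM ?I (\<lambda>_. borel)) (\<lambda>\<omega>. \<lambda>p\<in>?I. X \<omega> $$ p) = PiM ?I (\<lambda>p. distr M borel (\<lambda>\<omega>. X \<omega> $$ p))"
    using iffD1[OF indep_vars_iff_distr_eq_PiM'[OF ne, where M' = "\<lambda>_. borel" and X = "\<lambda>ij \<omega>. X \<omega> $$ ij"] iv] m by simp
  also have "\<dots> = gaussN \<sigma> ?I" by (rule PiM_cong) (use dp in auto)
  finally have D: "distr M (PiM ?I (\<lambda>_. borel)) (\<lambda>\<omega>. \<lambda>p\<in>?I. X \<omega> $$ p) = gaussN \<sigma> ?I" .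
  have se: "sets (gaussN \<sigma> ?I) = sets (PiM ?I (\<lambda>_. borel))" by (rule sets_PiM_cong) auto
  have "distr M (gaussN \<sigma> ?I) (\<lambda>\<omega>. \<lambda>p\<in>?I. X \<omega> $$ p) = distr M (PiM ?I (\<lambda>_. borel)) (\<lambda>\<omega>. \<lambda>p\<in>?I. X \<omega> $$ p)"
    by (rule distr_cong) (use se in auto)
  moreover have "(\<lambda>\<omega>. \<lambda>p\<in>?I. X \<omega> $$ p) \<in> measurable M (PiM ?I (\<lambda>_. borel))"
    by (rule measurable_restrict) (use m in auto)
  then have "(\<lambda>\<omega>. \<lambda>p\<in>?I. X \<omega> $$ p) \<in> measurable M (gaussN \<sigma> ?I)"
    by (simp add: measurable_cong_sets[OF refl se])
  ultimately show ?thesis using s D by auto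
qed

lemma diag_blocks_of_mat_diag:
  fixes l :: "nat \<Rightarrow> 'a :: zero"
  assumes "L1 \<in> carrier_mat r r" "L2 \<in> carrier_mat (k - r) (k - r)" "L3 \<in> carrier_mat (n - k) (n - k)"
    and r: "r \<le> k" "k \<le> n" and e: "mat_diag n l = diag_block_mat [L1, L2, L3]"
  shows "L2 = mat_diag (k - r) (\<lambda>i. l (r + i))" "L3 = mat_diag (n - k) (\<lambda>i. l (k + i))"
proof -
  have e': "mat_diag n l $$ (i, j) = diag_block_mat [L1, L2, L3] $$ (i, j)" for i j using e by simp
  show "L2 = mat_diag (k - r) (\<lambda>i. l (r + i))"
  proof (rule eq_matI)
    fix i j assume "i < dim_row (mat_diag (k - r) (\<lambda>i. l (r + i)))" "j < dim_col (mat_diag (k - r) (\<lambda>i. l (r + i)))"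
    then have ij: "i < k - r" "j < k - r" by auto
    then have "mat_diag n l $$ (r + i, r + j) = L2 $$ (i, j)"
      unfolding e' using assms(1-3) r by (simp add: Let_def)
    then show "L2 $$ (i, j) = mat_diag (k - r) (\<lambda>i. l (r + i)) $$ (i, j)"
      using ij r by (simp add: mat_diag_def)
  qed (use assms in auto)
  show "L3 = mat_diag (n - k) (\<lambda>i. l (k + i))"
  proof (rule eq_matI)
    fix i j assume "i < dim_row (mat_diag (n - k) (\<lambda>i. l (k + i)))" "j < dim_col (mat_diag (n - k) (\<lambda>i. l (k + i)))"
    then have ij: "i < n - k" "j < n - k" by auto
    moreover have "\<not> k + i - r < k - r" "\<not> k + j - r < k - r" using r by auto
    ultimately have "mat_diag n l $$ (k + i, k + j) = L3 $$ (i, j)"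
      unfolding e' using assms(1-3) r by (simp add: Let_def)
    then show "L3 $$ (i, j) = mat_diag (n - k) (\<lambda>i. l (k + i)) $$ (i, j)"
      using ij r by (simp add: mat_diag_def)
  qed (use assms in auto)
qed

lemma nuclear_norm_nonneg:
  assumes "E \<in> carrier_mat n n" "transpose_mat E = E"
  shows "nuclear_norm E \<ge> 0"
  using spectral_theorem[OF assms] nuclear_norm_symmetric by (metis sum_nonneg abs_ge_zero)

lemma col_block_transpose_mult:
  assumes V: "V \<in> carrier_mat n m" and X: "X \<in> carrier_mat n k" and ij: "i < p" "b < k"
  shows "(transpose_mat (col_block V a p) * X) $$ (i, b) = (\<Sum>k<n. V $$ (k, a + i) * X $$ (k, b))"
  by (subst transpose_mult_index[of _ n p _ k]) (use V X ij in \<open>auto simp: col_block_def\<close>)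

text \<open>The deterministic part, for one outcome of full rank: conjugation by \<open>V\<close>
  reduces the residual to the diagonal case, with
  \<open>J = transpose_mat V * X * T1\<close>.\<close>

lemma sample_residual:
  fixes l :: "nat \<Rightarrow> real"
  assumes r: "r > 0" "r \<le> k1" "k1 < n"
    and l: "\<And>i j. i \<le> j \<Longrightarrow> j < n \<Longrightarrow> \<bar>l j\<bar> \<le> \<bar>l i\<bar>" and nz: "l (r - 1) \<noteq> 0"
    and V: "V \<in> carrier_mat n n" "transpose_mat V * V = 1\<^sub>m n" "V * transpose_mat V = 1\<^sub>m n"
    and A: "A = V * mat_diag n l * transpose_mat V"
    and X: "X \<in> carrier_mat n k2" and Q: "Q \<in> carrier_mat k2 q"
    and X1: "X1 = transpose_mat (col_block V 0 r) * X"
    and X2: "X2 = transpose_mat (col_block V r (k1 - r)) * X"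
    and X3: "X3 = transpose_mat (col_block V k1 (n - k1)) * X"
    and W: "\<And>j b. b < k2 \<Longrightarrow> W j b = (\<Sum>k<n. V $$ (k, j) * X $$ (k, b))"
    and M: "M = Matrix.mat k2 k1 (\<lambda>(b, i). W i b)" and det: "det (transpose_mat M * M) \<noteq> 0"
    and w: "\<And>i j. w i j = (\<Sum>b<k2. W i b * pinv M $$ (j, b))"
    and oc: "is_orth_compl (transpose_mat X2) Q" and qr: "is_thin_qr (pinv (X1 * Q)) Qh Rh"
  defines "z \<equiv> \<Sum>i\<in>{k1..<n}. \<Sum>j<r. \<bar>l i\<bar> * (w i j)\<^sup>2"
  defines "P \<equiv> Q * Qh * transpose_mat (Q * Qh)"
  shows "(frob_norm (mat_diag (n - k1) (\<lambda>i. sqrt \<bar>l (k1 + i)\<bar>) * (X3 * Q * pinv (X1 * Q))))\<^sup>2 = z"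
    and "z \<le> \<bar>l (r - 1)\<bar> / 2 \<Longrightarrow>
      nuclear_norm (A - A * X * pinv (P * transpose_mat X * A * X * P) * transpose_mat X * A)
        \<le> (\<Sum>i\<in>{r..<n}. \<bar>l i\<bar>) + 2 * (1 + \<bar>l k1\<bar> / \<bar>l (r - 1)\<bar>) * z
           + 4 * sqrt z * sqrt (\<Sum>i\<in>{k1..<n}. \<bar>l i\<bar>)"
proof -
  have cb: "col_block V a p \<in> carrier_mat n p" for a p using V by (simp add: col_block_def)
  have Mc: "M \<in> carrier_mat k2 k1" by (simp add: M)
  have X1c: "X1 \<in> carrier_mat r k2" and X2c: "X2 \<in> carrier_mat (k1 - r) k2" and X3c: "X3 \<in> carrier_mat (n - k1) k2"
    using cb X unfolding X1 X2 X3 by (auto intro!: mult_carrier_mat)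
  have X1e: "X1 $$ (i, b) = W i b" if "i < r" "b < k2" for i b
    unfolding X1 col_block_transpose_mult[OF V(1) X that] using W that by simp
  have X2e: "X2 $$ (i, b) = W (r + i) b" if "i < k1 - r" "b < k2" for i b
    unfolding X2 col_block_transpose_mult[OF V(1) X that] using W that by simp
  have X3e: "X3 $$ (i, b) = W (k1 + i) b" if "i < n - k1" "b < k2" for i b
    unfolding X3 col_block_transpose_mult[OF V(1) X that] using W that by simp
  define T1 where "T1 = Matrix.mat k2 r (\<lambda>(b, i). pinv M $$ (i, b))"
  have T1: "T1 \<in> carrier_mat k2 r" by (simp add: T1_def)
  have blk: "Q * pinv (X1 * Q) = T1" "X1 * T1 = 1\<^sub>m r"
    unfolding T1_def
    by (rule pinv_compressed_block[OF Mc det r(2) X1c _ X2c _ Q oc];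
        use X1e X2e r in \<open>auto simp: M\<close>)+
  define N where "N = pinv (X1 * Q)"
  have N: "N \<in> carrier_mat q r" unfolding N_def by (rule pinv_carrier) (use X1c Q in auto)
  have QN: "T1 = Q * N" using blk by (simp add: N_def)
  note dims = carrier_matD[OF V(1)] carrier_matD[OF X] carrier_matD[OF Q] carrier_matD[OF X1c] carrier_matD[OF X3c]
    carrier_matD[OF T1] carrier_matD[OF N]
  have B: "X3 * Q * pinv (X1 * Q) = X3 * T1" unfolding QN N_def[symmetric] using dims by (simp add: mult_assoc_dim)
  have X3T: "X3 * T1 \<in> carrier_mat (n - k1) r" using X3c T1 by simp
  have Be: "(X3 * T1) $$ (i, j) = w (k1 + i) j" if "i < n - k1" "j < r" for i j
    unfolding mult_mat_index[OF X3c T1 that] w using X3e that by (intro sum.cong) (auto simp: T1_def)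
  have DB: "mat_diag (n - k1) (\<lambda>i. sqrt \<bar>l (k1 + i)\<bar>) * (X3 * T1) \<in> carrier_mat (n - k1) r"
    by (rule mult_carrier_mat[OF mat_diag_dim X3T])
  have "(frob_norm (mat_diag (n - k1) (\<lambda>i. sqrt \<bar>l (k1 + i)\<bar>) * (X3 * T1)))\<^sup>2
      = (\<Sum>i<n - k1. \<Sum>j<r. \<bar>l (k1 + i)\<bar> * (w (k1 + i) j)\<^sup>2)"
    unfolding frob_norm_square_sum[OF DB] unfolding mat_diag_mult_left[OF X3T]
    by (intro sum.cong refl) (simp add: Be power_mult_distrib del: index_mult_mat(1))
  also have "\<dots> = z"
    unfolding z_def sum.atLeastLessThan_shift_0[of _ k1 n] by (simp add: atLeast0LessThan o_def)
  finally show "(frob_norm (mat_diag (n - k1) (\<lambda>i. sqrt \<bar>l (k1 + i)\<bar>) * (X3 * Q * pinv (X1 * Q))))\<^sup>2 = z"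
    unfolding B .
  assume small: "z \<le> \<bar>l (r - 1)\<bar> / 2"
  define L where "L = mat_diag n l"
  have L: "L \<in> carrier_mat n n" by (simp add: L_def)
  have VX: "transpose_mat V * X \<in> carrier_mat n k2" using V X by simp
  define J where "J = transpose_mat V * X * T1"
  have J: "J \<in> carrier_mat n r" using VX T1 by (simp add: J_def)
  have Je: "J $$ (i, j) = w i j" if "i < n" "j < r" for i j
  proof -
    have "(transpose_mat V * X) $$ (i, b) = W i b" if "b < k2" for b
      unfolding transpose_mult_index[OF V(1) X \<open>i < n\<close> that] W[OF that] ..
    then show ?thesis unfolding J_def mult_mat_index[OF VX T1 that] w using that
      by (intro sum.cong) (auto simp: T1_def simp del: index_mult_mat(1))
  qed
  \<comment> \<open>\<open>pinv M * M = 1\<close> determines the first \<open>k1\<close> rows of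
    \<open>J\<close>: the identity in the first \<open>r\<close> of them, zero in the next
    \<open>k1 - r\<close>.\<close>
  have wd: "w i j = (if i = j then 1 else 0)" if "i < k1" "j < r" for i j
  proof -
    have j: "j < k1" using that r by simp
    have "w i j = (pinv M * M) $$ (j, i)"
      unfolding w mult_mat_index[OF pinv_carrier[OF Mc] Mc j that(1)] using that by (intro sum.cong) (auto simp: M)
    then show ?thesis unfolding pinv_full_column_rank[OF Mc det] using that j by auto
  qed
  define M0 where "M0 = transpose_mat J * L * J"
  define E where "E = L - L * J * mat_inv M0 * transpose_mat J * L"
  have zJ: "z = (\<Sum>i\<in>{k1..<n}. \<Sum>j<r. \<bar>l i\<bar> * (J $$ (i, j))\<^sup>2)"
    unfolding z_def by (intro sum.cong refl) (auto simp: Je)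
  have Jt: "J $$ (i, j) = (if i = j then 1 else 0)" if "i < r" "j < r" for i j
    using that r by (simp add: Je wd)
  have Jm: "J $$ (i, j) = 0" if "r \<le> i" "i < k1" "j < r" for i j
    using that r by (simp add: Je wd)
  note res = residual_nuclear_bound[OF r l nz J Jt Jm zJ small, folded L_def, folded M0_def, folded E_def]
  have Ac: "A \<in> carrier_mat n n" using V L unfolding A L_def[symmetric] by simp
  note dims = dims carrier_matD[OF L] carrier_matD[OF J] carrier_matD[OF Ac]
  have VV: "transpose_mat V * (V * Y) = Y" "V * (transpose_mat V * Y) = Y" if "dim_row Y = n" for Y
    using V that dims by (simp_all add: mult_assoc_dim[symmetric] one_mult_dim)
  have AXT: "A * X * T1 = V * (L * J)"
    unfolding A L_def[symmetric] J_def using dims by (simp add: mult_assoc_dim)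
  have TXA: "transpose_mat T1 * transpose_mat X * A = transpose_mat J * L * transpose_mat V"
    unfolding A L_def[symmetric] J_def using dims by (simp add: mult_assoc_dim transpose_mult_dim)
  have M0: "M0 = transpose_mat T1 * transpose_mat X * A * X * T1"
  proof -
    have "transpose_mat T1 * transpose_mat X * A * X * T1 = (transpose_mat T1 * transpose_mat X * A) * (X * T1)"
      using dims by (simp add: mult_assoc_dim)
    also have "\<dots> = transpose_mat J * L * (transpose_mat V * X * T1)"
      unfolding TXA using dims by (simp add: mult_assoc_dim)
    finally show ?thesis by (simp add: M0_def J_def[symmetric])
  qed
  have QQ: "transpose_mat Q * Q = 1\<^sub>m q" using oc Q unfolding is_orth_compl_def orthonormal_cols_def by simp
  have core: "pinv (P * transpose_mat X * A * X * P) = T1 * mat_inv M0 * transpose_mat T1"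
    unfolding P_def by (rule pinv_projected_core[OF Ac X X1c Q QQ qr[folded N_def] N QN blk(2) M0 res(1)])
  have M0c: "M0 \<in> carrier_mat r r" using J L by (simp add: M0_def)
  note inv = mat_inv[OF M0c res(1)]
  note dims = dims carrier_matD[OF inv(1)]
  have Ec: "E \<in> carrier_mat n n" unfolding E_def using dims by (intro carrier_matI) auto
  have "A * X * (T1 * mat_inv M0 * transpose_mat T1) * transpose_mat X * A
    = (A * X * T1) * mat_inv M0 * (transpose_mat T1 * transpose_mat X * A)"
    using dims by (simp add: mult_assoc_dim)
  also have "\<dots> = V * (L * J * mat_inv M0 * transpose_mat J * L) * transpose_mat V"
    unfolding AXT TXA using dims by (simp add: mult_assoc_dim)
  finally have "A - A * X * (T1 * mat_inv M0 * transpose_mat T1) * transpose_mat X * A = V * E * transpose_mat V"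
    unfolding E_def using dims unfolding A L_def[symmetric] by (simp add: mult_diff_dim diff_mult_dim)
  then show "nuclear_norm (A - A * X * pinv (P * transpose_mat X * A * X * P) * transpose_mat X * A)
        \<le> (\<Sum>i\<in>{r..<n}. \<bar>l i\<bar>) + 2 * (1 + \<bar>l k1\<bar> / \<bar>l (r - 1)\<bar>) * z
           + 4 * sqrt z * sqrt (\<Sum>i\<in>{k1..<n}. \<bar>l i\<bar>)"
    unfolding core using nuclear_norm_orthogonal_conj[OF V Ec res(2)] res(3) by simp
qed

context gaussian_frame
begin

lemma w0_square:
  assumes j: "k1 \<le> j" "j < n" and i: "i < k1"
  shows "integrable P (\<lambda>x. (w0 j i x)\<^sup>2)" "(\<integral>x. (w0 j i x)\<^sup>2 \<partial>P) \<le> \<kappa>"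
proof -
  have m [measurable]: "w0 j i \<in> borel_measurable P" by (rule w0_measurable[OF i])
  note nn = nn_integral_w0_square[OF j i]
  show "integrable P (\<lambda>x. (w0 j i x)\<^sup>2)"
    by (rule integrableI_bounded) (use nn in \<open>auto intro: le_less_trans\<close>)
  have "(\<integral>x. (w0 j i x)\<^sup>2 \<partial>P) = enn2real (\<integral>\<^sup>+x. ennreal ((w0 j i x)\<^sup>2) \<partial>P)"
    by (rule integral_eq_nn_integral) auto
  also have "\<dots> \<le> \<kappa>" using enn2real_mono[OF nn] \<kappa>_pos by simp
  finally show "(\<integral>x. (w0 j i x)\<^sup>2 \<partial>P) \<le> \<kappa>" .
qed

lemma weighted_w0_square:
  fixes l :: "nat \<Rightarrow> real"
  assumes r: "r \<le> k1"
  defines "z \<equiv> \<lambda>x. \<Sum>i\<in>{k1..<n}. \<Sum>j<r. \<bar>l i\<bar> * (w0 i j x)\<^sup>2"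
  shows "integrable P z" "(\<integral>x. z x \<partial>P) \<le> real r * \<kappa> * (\<Sum>i\<in>{k1..<n}. \<bar>l i\<bar>)"
    and "t > 0 \<Longrightarrow> emeasure P {x \<in> space P. z x \<le> t} > 0"
proof -
  have int: "integrable P (\<lambda>x. (w0 i j x)\<^sup>2)" if "i \<in> {k1..<n}" "j \<in> {..<r}" for i j
    using w0_square(1)[of i j] that r by auto
  show iz: "integrable P z" unfolding z_def
    by (intro Bochner_Integration.integrable_sum integrable_mult_right int)
  have "(\<integral>x. z x \<partial>P) = (\<Sum>i\<in>{k1..<n}. \<integral>x. (\<Sum>j<r. \<bar>l i\<bar> * (w0 i j x)\<^sup>2) \<partial>P)"
    unfolding z_def by (intro Bochner_Integration.integral_sum Bochner_Integration.integrable_sum integrable_mult_right int)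
  also have "\<dots> = (\<Sum>i\<in>{k1..<n}. \<Sum>j<r. \<integral>x. \<bar>l i\<bar> * (w0 i j x)\<^sup>2 \<partial>P)"
    by (intro sum.cong refl Bochner_Integration.integral_sum integrable_mult_right int)
  also have "\<dots> = (\<Sum>i\<in>{k1..<n}. \<Sum>j<r. \<bar>l i\<bar> * (\<integral>x. (w0 i j x)\<^sup>2 \<partial>P))" by simp
  also have "\<dots> \<le> (\<Sum>i\<in>{k1..<n}. \<Sum>j<r. \<bar>l i\<bar> * \<kappa>)"
    by (intro sum_mono mult_left_mono w0_square(2)) (use r in auto)
  also have "\<dots> = real r * \<kappa> * (\<Sum>i\<in>{k1..<n}. \<bar>l i\<bar>)" by (simp add: sum_distrib_left mult_ac)
  finally show "(\<integral>x. z x \<partial>P) \<le> real r * \<kappa> * (\<Sum>i\<in>{k1..<n}. \<bar>l i\<bar>)" .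
  assume t: "t > 0"
  define L where "L = (\<Sum>i\<in>{k1..<n}. \<bar>l i\<bar>)"
  have L: "L \<ge> 0" by (simp add: L_def sum_nonneg)
  \<comment> \<open>The weights add up to \<open>L * real r\<close>; the added 1 keeps the quotient
    meaningful when all trailing eigenvalues vanish.\<close>
  define \<eta> where "\<eta> = t / (L * real r + 1)"
  have Lr: "L * real r \<ge> 0" using L by simp
  have \<eta>: "\<eta> > 0" using t Lr by (simp add: \<eta>_def add_nonneg_pos)
  have "z x \<le> t" if h: "\<forall>j\<in>{k1..<n}. \<forall>i<k1. (w0 j i x)\<^sup>2 \<le> \<eta>" for x
  proof -
    have "z x \<le> (\<Sum>i\<in>{k1..<n}. \<Sum>j<r. \<bar>l i\<bar> * \<eta>)"
      unfolding z_def by (intro sum_mono mult_left_mono) (use h r in auto)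
    also have "\<dots> = L * real r * \<eta>" by (simp add: L_def sum_distrib_left mult_ac)
    also have "\<dots> \<le> (L * real r + 1) * \<eta>" using \<eta> by (intro mult_right_mono) auto
    also have "\<dots> = t" using Lr by (simp add: \<eta>_def)
    finally show ?thesis .
  qed
  then have sub: "{x \<in> space P. \<forall>j\<in>{k1..<n}. \<forall>i<k1. (w0 j i x)\<^sup>2 \<le> \<eta>} \<subseteq> {x \<in> space P. z x \<le> t}" by auto
  have [measurable]: "z \<in> borel_measurable P" using iz by (rule borel_measurable_integrable)
  have "{x \<in> space P. z x \<le> t} \<in> sets P" by measurable
  then have "emeasure P {x \<in> space P. \<forall>j\<in>{k1..<n}. \<forall>i<k1. (w0 j i x)\<^sup>2 \<le> \<eta>} \<le> emeasure P {x \<in> space P. z x \<le> t}"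
    by (rule emeasure_mono[OF sub])
  then show "emeasure P {x \<in> space P. z x \<le> t} > 0"
    using small_event_positive[OF \<eta>] by (rule less_le_trans[rotated])
qed

end

theorem theorem3p1:
  fixes n r k1 k2 :: nat and c1 c2 b \<epsilon> :: real
    and A Ar V V1 V2 V3 \<Lambda> \<Lambda>1 \<Lambda>2 \<Lambda>3 :: "real mat" and lam :: "nat \<Rightarrow> real"
    and M :: "'w measure" and X X1 X2 X3 Qp B Qh Rh U P E :: "'w \<Rightarrow> real mat"
    and \<Omega>F :: "'w set"
  assumes "n > 0" and "r > 0"
    and "1 < c1" and "c1 < c2" and "c2 < real n / real r - 1"
    and "c1 * real r = real k1" and "c2 * real r = real k2" and "k1 > 0" and "k2 > 0"
    and "(c2 - c1) * real r - 1 \<noteq> 0"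
    and "A \<in> carrier_mat n n" and "transpose_mat A = A"
    and "V \<in> carrier_mat n n" and "orthonormal_cols V"
    and "V1 = col_block V 0 r" and "V2 = col_block V r (k1 - r)" and "V3 = col_block V k1 (n - k1)"
    and "\<Lambda> = mat_diag n (\<lambda>i. lam (i + 1))"
    and "\<Lambda>1 \<in> carrier_mat r r" and "\<Lambda>2 \<in> carrier_mat (k1 - r) (k1 - r)"
    and "\<Lambda>3 \<in> carrier_mat (n - k1) (n - k1)" and "\<Lambda> = diag_block_mat [\<Lambda>1, \<Lambda>2, \<Lambda>3]"
    and "A = V * \<Lambda> * transpose_mat V"
    and "\<And>i j. 1 \<le> i \<Longrightarrow> i \<le> j \<Longrightarrow> j \<le> n \<Longrightarrow> \<bar>lam j\<bar> \<le> \<bar>lam i\<bar>"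
    and "lam r \<noteq> 0"
    and "is_truncated_svd r A Ar"
    and "prob_space M"
    and "gaussian_mat M n k2 X"
    and "\<And>\<omega>. X1 \<omega> = transpose_mat V1 * X \<omega>"
    and "\<And>\<omega>. X2 \<omega> = transpose_mat V2 * X \<omega>"
    and "\<And>\<omega>. X3 \<omega> = transpose_mat V3 * X \<omega>"
    and "random_mat M k2 (k2 - k1 + r) Qp"
    and "AE \<omega> in M. is_orth_compl (transpose_mat (X2 \<omega>)) (Qp \<omega>)"
    and "\<And>\<omega>. B \<omega> = X3 \<omega> * Qp \<omega> * pinv (X1 \<omega> * Qp \<omega>)"
    and "random_mat M (k2 - k1 + r) r Qh"
    and "AE \<omega> in M. is_thin_qr (pinv (X1 \<omega> * Qp \<omega>)) (Qh \<omega>) (Rh \<omega>)"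
    and "\<And>\<omega>. U \<omega> = Qp \<omega> * Qh \<omega>"
    and "\<And>\<omega>. P \<omega> = U \<omega> * transpose_mat (U \<omega>)"
    and "\<And>\<omega>. E \<omega> = A - A * X \<omega> * pinv (P \<omega> * transpose_mat (X \<omega>) * A * X \<omega> * P \<omega>)
                          * transpose_mat (X \<omega>) * A"
    and "\<Omega>F = {\<omega> \<in> space M.
            (frob_norm (map_mat (\<lambda>x. sqrt \<bar>x\<bar>) \<Lambda>3 * B \<omega>))\<^sup>2 \<le> 0.5 * \<bar>lam r\<bar>}"
    and "b = real r / ((c2 - c1) * real r - 1)"
    and "\<epsilon> = 2 * b * sqrt (real r) * (1 + \<bar>lam (k1 + 1)\<bar> / \<bar>lam r\<bar> + 2 / sqrt b)
               * (nuclear_norm \<Lambda>3 / (nuclear_norm \<Lambda>2 + nuclear_norm \<Lambda>3))"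
  shows "\<Omega>F \<in> sets M \<and> measure M \<Omega>F > 0
    \<and> integrable (uniform_measure M \<Omega>F) (\<lambda>\<omega>. nuclear_norm (E \<omega>))
    \<and> cond_expectation M (\<lambda>\<omega>. nuclear_norm (E \<omega>)) \<Omega>F
        \<le> (1 + \<epsilon>) * nuclear_norm (A - Ar)"
proof -

  \<comment> \<open>Integer sizes, spectral data and the optimal error\<close>
  interpret prob_space M by (rule assms(27))
  note Xg = assms(28)
  have r: "r > 0" by (rule assms(2))
  have "1 * real r < c1 * real r" by (rule mult_strict_right_mono) (use assms(3) r in auto)
  then have rk: "r < k1" using assms(6) by simp
  have "c1 * real r < c2 * real r" by (rule mult_strict_right_mono) (use assms(4) r in auto)
  then have k12: "k1 < k2" using assms(6,7) by simp
  have "c2 * real r < (real n / real r - 1) * real r" by (rule mult_strict_right_mono) (use assms(5) r in auto)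
  also have "\<dots> = real n - real r" using r by (simp add: field_simps)
  finally have "k2 < n" using assms(7) by simp
  then have k1n: "k1 < n" using k12 by simp
  have p: "(c2 - c1) * real r = real k2 - real k1" using assms(6,7) by (simp add: left_diff_distrib)
  \<comment> \<open>\<open>k1\<close> and \<open>k2\<close> are integers with
    \<open>k1 < k2\<close>, so a nonzero denominator of \<open>b\<close> already means
    \<open>k1 + 1 < k2\<close>, and \<open>b\<close> is positive.\<close>
  have "real k2 \<noteq> real (k1 + 1)" using assms(10) unfolding p by simp
  then have k2: "k1 + 1 < k2" using k12 by linarith
  \<comment> \<open>Shift from the 1-based \<open>lam\<close> to the 0-based \<open>l\<close>:
    \<open>lam r\<close> is \<open>l (r - 1)\<close> and \<open>lam (k1 + 1)\<close> is
    \<open>l k1\<close>.\<close>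
  define l where "l i = lam (i + 1)" for i
  have l: "\<bar>l j\<bar> \<le> \<bar>l i\<bar>" if "i \<le> j" "j < n" for i j
    unfolding l_def by (rule assms(24)) (use that in auto)
  have lr: "l (r - 1) = lam r" using r by (simp add: l_def)
  have nz: "l (r - 1) \<noteq> 0" using assms(25) unfolding lr .
  have V: "V \<in> carrier_mat n n" "transpose_mat V * V = 1\<^sub>m n" "V * transpose_mat V = 1\<^sub>m n"
    using assms(13,14) mat_mult_left_right_inverse[of "transpose_mat V" n V] by (auto simp: orthonormal_cols_def)
  have Ad: "A = V * mat_diag n l * transpose_mat V" unfolding assms(23) assms(18) l_def ..
  have blocks: "mat_diag n l = diag_block_mat [\<Lambda>1, \<Lambda>2, \<Lambda>3]" using assms(22) unfolding assms(18) l_def .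
  note \<Lambda>23 = diag_blocks_of_mat_diag[OF assms(19-21) less_imp_le[OF rk] less_imp_le[OF k1n] blocks]
  define L where "L = (\<Sum>i\<in>{k1..<n}. \<bar>l i\<bar>)"
  define N where "N = (\<Sum>i\<in>{r..<n}. \<bar>l i\<bar>)"
  have L0: "L \<ge> 0" by (simp add: L_def sum_nonneg)
  have shift: "(\<Sum>i<c - a. \<bar>l (a + i)\<bar>) = (\<Sum>i\<in>{a..<c}. \<bar>l i\<bar>)" for a c
    unfolding sum.atLeastLessThan_shift_0[of _ a c] by (simp add: atLeast0LessThan o_def)
  have n3: "nuclear_norm \<Lambda>3 = L" unfolding \<Lambda>23(2) nuclear_norm_mat_diag L_def by (rule shift)
  have n2: "nuclear_norm \<Lambda>2 = (\<Sum>i\<in>{r..<k1}. \<bar>l i\<bar>)" unfolding \<Lambda>23(1) nuclear_norm_mat_diag by (rule shift)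
  have "{r..<n} = {r..<k1} \<union> {k1..<n}" using rk k1n by auto
  then have n23: "nuclear_norm \<Lambda>2 + nuclear_norm \<Lambda>3 = N"
    unfolding n2 n3 L_def N_def by (simp add: sum.union_disjoint)
  have LN: "L \<le> N" unfolding n23[symmetric] n2 n3 by (simp add: sum_nonneg)
  have opt: "nuclear_norm (A - Ar) = N"
    unfolding N_def by (rule nuclear_norm_truncation_error[OF V(1) assms(14) Ad l assms(26)]) (use rk k1n in auto)

  \<comment> \<open>Transfer to the space of Gaussian entries\<close>
  obtain \<sigma> where \<sigma>: "\<sigma> > 0"
    and D: "distr M (gaussN \<sigma> ({..<n} \<times> {..<k2})) (\<lambda>\<omega>. \<lambda>p\<in>{..<n} \<times> {..<k2}. X \<omega> $$ p) = gaussN \<sigma> ({..<n} \<times> {..<k2})"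
    and \<phi>m: "(\<lambda>\<omega>. \<lambda>p\<in>{..<n} \<times> {..<k2}. X \<omega> $$ p) \<in> measurable M (gaussN \<sigma> ({..<n} \<times> {..<k2}))"
    using gaussian_mat_distr[OF assms(27) Xg assms(1,9)] by blast
  interpret fr: gaussian_frame n k1 k2 V \<sigma>
    by unfold_locales (use V k1n k2 \<sigma> in auto)
  define \<phi> where "\<phi> \<omega> = (\<lambda>p\<in>fr.idx. X \<omega> $$ p)" for \<omega>
  have D: "distr M fr.P \<phi> = fr.P" and \<phi>m: "\<phi> \<in> measurable M fr.P"
    using D \<phi>m by (auto simp: \<phi>_def[abs_def] fr.idx_def)
  define z where "z x = (\<Sum>i\<in>{k1..<n}. \<Sum>j<r. \<bar>l i\<bar> * (fr.w0 i j x)\<^sup>2)" for x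
  define Z where "Z \<omega> = (frob_norm (map_mat (\<lambda>x. sqrt \<bar>x\<bar>) \<Lambda>3 * B \<omega>))\<^sup>2" for \<omega>
  define t where "t = \<bar>l (r - 1)\<bar> / 2"
  have t: "t > 0" using nz by (simp add: t_def)
  define \<rho> where "\<rho> = \<bar>l k1\<bar> / \<bar>l (r - 1)\<bar>"
  have \<rho>0: "\<rho> \<ge> 0" by (simp add: \<rho>_def)
  have Om: "\<Omega>F = {\<omega> \<in> space M. Z \<omega> \<le> t}" unfolding assms(40) Z_def t_def unfolding lr by simp
  have map3: "map_mat (\<lambda>x. sqrt \<bar>x\<bar>) \<Lambda>3 = mat_diag (n - k1) (\<lambda>i. sqrt \<bar>l (k1 + i)\<bar>)"
    unfolding \<Lambda>23(2) by (rule eq_matI) (auto simp: mat_diag_def)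
  have rk': "AE \<omega> in M. det (transpose_mat (fr.Yt (\<phi> \<omega>)) * fr.Yt (\<phi> \<omega>)) \<noteq> 0"
    by (rule AE_distrD[OF \<phi>m]) (unfold D, rule fr.AE_full_rank)
  \<comment> \<open>Full rank and the almost sure properties of the complement and of the QR factors
    hold outside a common null set; there the estimate for a single outcome applies.\<close>
  have good: "AE \<omega> in M. Z \<omega> = z (\<phi> \<omega>) \<and> (z (\<phi> \<omega>) \<le> t \<longrightarrow>
      nuclear_norm (E \<omega>) \<le> N + 2 * (1 + \<rho>) * z (\<phi> \<omega>) + 4 * sqrt (z (\<phi> \<omega>)) * sqrt L)"
    using AE_space rk' assms(33) assms(36)
  proof eventually_elim
    case (elim \<omega>)
    have Xc: "X \<omega> \<in> carrier_mat n k2" using Xg elim(1) unfolding gaussian_mat_def random_mat_def by auto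
    have Qc: "Qp \<omega> \<in> carrier_mat k2 (k2 - k1 + r)" by (rule random_mat_carrier[OF assms(32) elim(1)])
    have W: "fr.W (\<phi> \<omega>) j b = (\<Sum>k<n. V $$ (k, j) * X \<omega> $$ (k, b))" if "b < k2" for j b
      unfolding fr.W_def \<phi>_def fr.idx_def using that by (intro sum.cong) auto
    have X1e: "X1 \<omega> = transpose_mat (col_block V 0 r) * X \<omega>" unfolding assms(29) assms(15) ..
    have X2e: "X2 \<omega> = transpose_mat (col_block V r (k1 - r)) * X \<omega>" unfolding assms(30) assms(16) ..
    have X3e: "X3 \<omega> = transpose_mat (col_block V k1 (n - k1)) * X \<omega>" unfolding assms(31) assms(17) ..
    note s = sample_residual[OF r less_imp_le[OF rk] k1n l nz V Ad Xc Qc X1e X2e X3e W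
        fr.Yt_def[of "\<phi> \<omega>"] elim(2) fr.w0_def[of _ _ "\<phi> \<omega>"] elim(3,4), folded z_def L_def N_def t_def \<rho>_def]
    have "Z \<omega> = z (\<phi> \<omega>)" unfolding Z_def map3 assms(34) by (rule s(1))
    moreover have "z (\<phi> \<omega>) \<le> t \<Longrightarrow> nuclear_norm (E \<omega>) \<le> N + 2 * (1 + \<rho>) * z (\<phi> \<omega>) + 4 * sqrt (z (\<phi> \<omega>)) * sqrt L"
      unfolding assms(39) assms(38) assms(37) by (rule s(2))
    ultimately show ?case by blast
  qed

  \<comment> \<open>Measurability and symmetry of the residual\<close>
  have rX: "random_mat M n k2 X" using Xg by (simp add: gaussian_mat_def)
  note rQ = assms(32) and rQh = assms(35)
  have cb: "col_block V a q \<in> carrier_mat n q" for a q using V by (simp add: col_block_def)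
  have rX1: "random_mat M r k2 X1" and rX3: "random_mat M (n - k1) k2 X3"
    unfolding assms(29)[abs_def] assms(31)[abs_def] assms(15) assms(17)
    by (intro random_mat_mult[OF random_mat_const rX] transpose_carrier_mat[THEN iffD2] cb)+
  have rB: "random_mat M (n - k1) r B"
    unfolding assms(34)[abs_def]
    by (intro random_mat_mult[OF random_mat_mult[OF rX3 rQ]] random_mat_pinv random_mat_mult[OF rX1 rQ])
  have D3c: "map_mat (\<lambda>x. sqrt \<bar>x\<bar>) \<Lambda>3 \<in> carrier_mat (n - k1) (n - k1)" using assms(21) by simp
  have Zm [measurable]: "Z \<in> borel_measurable M"
    unfolding Z_def[abs_def]
    by (intro borel_measurable_power borel_measurable_frob_norm[OF random_mat_mult[OF random_mat_const[OF D3c] rB]])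
  have OF_sets [measurable]: "\<Omega>F \<in> sets M" unfolding Om by measurable
  have rU: "random_mat M k2 r U" unfolding assms(37)[abs_def] by (rule random_mat_mult[OF rQ rQh])
  have rP: "random_mat M k2 k2 P" unfolding assms(38)[abs_def] by (rule random_mat_mult[OF rU random_mat_transpose[OF rU]])
  have rA: "random_mat M n n (\<lambda>_. A)" by (rule random_mat_const[OF assms(11)])
  have rcore: "random_mat M k2 k2 (\<lambda>\<omega>. P \<omega> * transpose_mat (X \<omega>) * A * X \<omega> * P \<omega>)"
    by (intro random_mat_mult[OF _ rP] random_mat_mult[OF _ rX] random_mat_mult[OF _ rA]
        random_mat_mult[OF rP random_mat_transpose[OF rX]])
  have rE: "random_mat M n n E"
    unfolding assms(39)[abs_def]
    by (intro random_mat_diff[OF rA] random_mat_mult[OF _ rA] random_mat_mult[OF _ random_mat_transpose[OF rX]]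
        random_mat_mult[OF _ random_mat_pinv[OF rcore]] random_mat_mult[OF rA rX])
  \<comment> \<open>Symmetry is shown on the whole space, also off the full-rank event, because
    measurability of the nuclear norm is available for random matrices that are symmetric
    everywhere.\<close>
  have symE: "transpose_mat (E \<omega>) = E \<omega>" if w: "\<omega> \<in> space M" for \<omega>
  proof -
    define C where "C = P \<omega> * transpose_mat (X \<omega>) * A * X \<omega> * P \<omega>"
    note cd = carrier_matD[OF random_mat_carrier[OF rX w]] carrier_matD[OF random_mat_carrier[OF rP w]]
      carrier_matD[OF assms(11)]
    have PT: "transpose_mat (P \<omega>) = P \<omega>"
      unfolding assms(38) using carrier_matD[OF random_mat_carrier[OF rU w]] by (simp add: transpose_mult_dim)
    have "transpose_mat C = C" unfolding C_def using cd by (simp add: transpose_mult_dim mult_assoc_dim PT assms(12))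
    then have pT: "transpose_mat (pinv C) = pinv C" by (rule pinv_symmetric)
    have "pinv C \<in> carrier_mat k2 k2"
      unfolding C_def by (rule random_mat_carrier[OF random_mat_pinv[OF rcore] w])
    note cd = cd carrier_matD[OF this]
    have "transpose_mat (A * X \<omega> * pinv C * transpose_mat (X \<omega>) * A) = A * X \<omega> * pinv C * transpose_mat (X \<omega>) * A"
      using cd by (simp add: transpose_mult_dim mult_assoc_dim pT assms(12))
    then show ?thesis unfolding assms(39) C_def[symmetric] using cd by (simp add: transpose_diff_dim assms(12))
  qed
  have Em [measurable]: "(\<lambda>\<omega>. nuclear_norm (E \<omega>)) \<in> borel_measurable M"
    by (rule borel_measurable_nuclear_norm_symmetric[OF rE symE])
  have E0: "nuclear_norm (E \<omega>) \<ge> 0" if "\<omega> \<in> space M" for \<omega>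
    by (rule nuclear_norm_nonneg[OF random_mat_carrier[OF rE that] symE[OF that]])

  \<comment> \<open>Mean of \<open>Z\<close> and positive probability of the event\<close>
  note wz = fr.weighted_w0_square[OF less_imp_le[OF rk], where l = l, folded z_def, folded L_def]
  have AEZ: "AE \<omega> in M. Z \<omega> = z (\<phi> \<omega>)" using good by eventually_elim simp
  have zi: "integrable fr.P z" using wz(1) by simp
  then have zm [measurable]: "z \<in> borel_measurable fr.P" by (rule borel_measurable_integrable)
  have "integrable (distr M fr.P \<phi>) z" unfolding D by (rule zi)
  then have zpi: "integrable M (\<lambda>\<omega>. z (\<phi> \<omega>))" using integrable_distr[OF \<phi>m] by blast
  have Zi: "integrable M Z"
    by (rule integrable_cong_AE_imp[OF zpi Zm]) (use AEZ in eventually_elim, simp)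
  define bL where "bL = real r * fr.\<kappa> * L"
  have \<kappa>0: "fr.\<kappa> > 0" by (rule fr.\<kappa>_pos)
  have bL0: "bL \<ge> 0" using \<kappa>0 L0 by (simp add: bL_def)
  have EZ: "(\<integral>\<omega>. Z \<omega> \<partial>M) \<le> bL"
  proof -
    have "(\<integral>\<omega>. Z \<omega> \<partial>M) = (\<integral>\<omega>. z (\<phi> \<omega>) \<partial>M)"
      by (rule integral_cong_AE) (use AEZ borel_measurable_integrable[OF zpi] in auto)
    also have "\<dots> = (\<integral>x. z x \<partial>distr M fr.P \<phi>)" by (rule integral_distr[OF \<phi>m zm, symmetric])
    finally show ?thesis unfolding D bL_def using wz(2) by simp
  qed
  have prob_pos: "prob \<Omega>F > 0"
  proof -
    have m: "{x \<in> space fr.P. z x \<le> t} \<in> sets fr.P" by measurable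
    have "emeasure M \<Omega>F = emeasure M {\<omega> \<in> space M. z (\<phi> \<omega>) \<le> t}"
      by (rule emeasure_eq_AE) (use AEZ borel_measurable_integrable[OF zpi] OF_sets in \<open>auto simp: Om\<close>)
    also have "{\<omega> \<in> space M. z (\<phi> \<omega>) \<le> t} = \<phi> -` {x \<in> space fr.P. z x \<le> t} \<inter> space M"
      using measurable_space[OF \<phi>m] by auto
    also have "emeasure M \<dots> = emeasure (distr M fr.P \<phi>) {x \<in> space fr.P. z x \<le> t}"
      by (rule emeasure_distr[OF \<phi>m m, symmetric])
    also have "\<dots> > 0" unfolding D using wz(3)[OF t] by simp
    finally show ?thesis by (simp add: emeasure_eq_measure)
  qed

  \<comment> \<open>Integration under the conditional measure\<close>
  define \<nu> where "\<nu> = uniform_measure M \<Omega>F"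
  interpret \<nu>: prob_space \<nu>
    unfolding \<nu>_def by (rule prob_space_uniform_measure) (use prob_pos in \<open>auto simp: emeasure_eq_measure\<close>)
  have ms: "measurable \<nu> N' = measurable M N'" for N' :: "real measure"
    by (rule measurable_cong_sets) (auto simp: \<nu>_def)
  have Z\<nu>: "integrable \<nu> Z" "(\<integral>\<omega>. Z \<omega> \<partial>\<nu>) \<le> bL"
    using conditional_mean_le[OF Zi Om prob_pos] EZ by (auto simp: \<nu>_def)
  have Z0: "Z \<omega> \<ge> 0" for \<omega> by (simp add: Z_def)
  \<comment> \<open>With this weight the bound
    \<open>2 * sqrt (Z \<omega>) \<le> Z \<omega> / a + a\<close> integrates to at most
    \<open>2 * a\<close>, the value that Jensen's inequality would give; at the same time it
    provides the integrable majorant \<open>g\<close>.\<close>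
  define a where "a = sqrt bL"
  have a0: "a \<ge> 0" using bL0 by (simp add: a_def)
  define g where "g \<omega> = N + 2 * (1 + \<rho>) * Z \<omega> + 2 * sqrt L * (Z \<omega> / a + a)" for \<omega>
  have gi: "integrable \<nu> g" unfolding g_def[abs_def]
    using Z\<nu>(1) by (intro Bochner_Integration.integrable_add integrable_mult_right integrable_divide) auto
  \<comment> \<open>If \<open>L = 0\<close>, then \<open>a = 0\<close> too, and the factor
    \<open>sqrt L\<close> makes both sides vanish.\<close>
  have amgm: "4 * sqrt x * sqrt L \<le> 2 * sqrt L * (x / a + a)" if x: "x \<ge> 0" for x
  proof (cases "L = 0")
    case False
    then have "bL > 0" using L0 \<kappa>0 r by (simp add: bL_def)
    then have a: "a > 0" by (simp add: a_def)
    have "0 \<le> (sqrt x)\<^sup>2 + a\<^sup>2 - 2 * sqrt x * a"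
      using zero_le_power2[of "sqrt x - a"] unfolding power2_diff .
    then have "2 * sqrt x * a \<le> x + a * a" using x by (simp add: power2_eq_square)
    then have "2 * sqrt x \<le> x / a + a" using a by (simp add: field_simps)
    then have "2 * sqrt L * (2 * sqrt x) \<le> 2 * sqrt L * (x / a + a)" by (intro mult_left_mono) (use L0 in auto)
    then show ?thesis by (simp add: mult_ac)
  qed simp
  have AEg: "AE \<omega> in \<nu>. nuclear_norm (E \<omega>) \<le> g \<omega>"
    unfolding \<nu>_def
  proof (rule AE_uniform_measureI[OF OF_sets])
    show "AE \<omega> in M. \<omega> \<in> \<Omega>F \<longrightarrow> nuclear_norm (E \<omega>) \<le> g \<omega>"
      using good
    proof eventually_elim
      case (elim \<omega>)
      show ?case
      proof
        assume "\<omega> \<in> \<Omega>F"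
        then have "Z \<omega> \<le> t" by (simp add: Om)
        then have "nuclear_norm (E \<omega>) \<le> N + 2 * (1 + \<rho>) * Z \<omega> + 4 * sqrt (Z \<omega>) * sqrt L" using elim by simp
        then show "nuclear_norm (E \<omega>) \<le> g \<omega>" using amgm[OF Z0, of \<omega>] unfolding g_def by linarith
      qed
    qed
  qed
  have Em\<nu>: "(\<lambda>\<omega>. nuclear_norm (E \<omega>)) \<in> borel_measurable \<nu>" unfolding ms by (rule Em)
  have Ei: "integrable \<nu> (\<lambda>\<omega>. nuclear_norm (E \<omega>))"
  proof (rule Bochner_Integration.integrable_bound[OF gi Em\<nu>])
    show "AE \<omega> in \<nu>. norm (nuclear_norm (E \<omega>)) \<le> norm (g \<omega>)"
      using AEg AE_space
    proof eventually_elim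
      case (elim \<omega>)
      then show ?case using E0[of \<omega>] by (simp add: \<nu>_def)
    qed
  qed
  have int_g: "(\<integral>\<omega>. g \<omega> \<partial>\<nu>) = N + 2 * (1 + \<rho>) * (\<integral>\<omega>. Z \<omega> \<partial>\<nu>) + 2 * sqrt L * ((\<integral>\<omega>. Z \<omega> \<partial>\<nu>) / a + a)"
    unfolding g_def using Z\<nu>(1) by (simp add: \<nu>.prob_space)
  \<comment> \<open>\<open>b\<close> collects one bound \<open>\<kappa>\<close> for each of the
    \<open>r\<close> columns of \<open>B\<close>.\<close>
  have b: "b = real r * fr.\<kappa>" unfolding assms(41) p fr.\<kappa>_def by simp
  have b0: "b > 0" unfolding b using r \<kappa>0 by simp
  have bL: "bL = b * L" by (simp add: bL_def b)
  have "(\<integral>\<omega>. nuclear_norm (E \<omega>) \<partial>\<nu>) \<le> (\<integral>\<omega>. g \<omega> \<partial>\<nu>)"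
    by (rule integral_mono_AE[OF Ei gi AEg])
  also have "\<dots> \<le> N + 2 * (1 + \<rho>) * bL + 2 * sqrt L * (bL / a + a)"
    unfolding int_g using Z\<nu>(2) \<rho>0 a0 L0
    by (intro add_mono mult_left_mono divide_right_mono) auto
  also have "bL / a = a" using bL0 by (simp add: a_def real_div_sqrt)
  also have "2 * sqrt L * (a + a) = 4 * sqrt b * L"
    using L0 by (simp add: a_def bL real_sqrt_mult)
  also have "N + 2 * (1 + \<rho>) * bL + 4 * sqrt b * L \<le> (1 + \<epsilon>) * N"
  proof -
    have "b * (2 / sqrt b) = 2 * (b / sqrt b)" by simp
    also have "\<dots> = 2 * sqrt b" using b0 by (simp only: real_div_sqrt less_imp_le)
    finally have bb: "b * (2 / sqrt b) = 2 * sqrt b" .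
    \<comment> \<open>If \<open>N = 0\<close>, then \<open>L = 0\<close> as well, so the quotient in
      \<open>\<epsilon>\<close> cancels against \<open>N\<close> in every case.\<close>
    have LNN: "L / N * N = L" using LN L0 by (cases "N = 0") auto
    have "\<epsilon> = 2 * b * sqrt (real r) * (1 + \<rho> + 2 / sqrt b) * (L / N)"
      unfolding assms(42) n23 unfolding n3 \<rho>_def lr by (simp add: l_def)
    then have "\<epsilon> * N = 2 * b * sqrt (real r) * (1 + \<rho> + 2 / sqrt b) * (L / N * N)"
      by (simp only: mult.assoc)
    then have "\<epsilon> * N = 2 * b * sqrt (real r) * (1 + \<rho> + 2 / sqrt b) * L"
      unfolding LNN .
    also have "\<dots> = sqrt (real r) * (2 * (1 + \<rho>) * (b * L) + 2 * (b * (2 / sqrt b)) * L)"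
      by (simp add: algebra_simps)
    finally have e: "\<epsilon> * N = sqrt (real r) * (2 * (1 + \<rho>) * bL + 4 * sqrt b * L)"
      unfolding bb bL by simp
    have "0 \<le> 2 * (1 + \<rho>) * bL + 4 * sqrt b * L" using \<rho>0 bL0 b0 L0 by simp
    \<comment> \<open>Since \<open>r \<ge> 1\<close>, passing to the factor
      \<open>sqrt (real r)\<close> of \<open>\<epsilon>\<close> can only enlarge the nonnegative
      error term.\<close>
    then have "1 * (2 * (1 + \<rho>) * bL + 4 * sqrt b * L) \<le> sqrt (real r) * (2 * (1 + \<rho>) * bL + 4 * sqrt b * L)"
      by (rule mult_right_mono[rotated]) (use r in simp)
    then show ?thesis using e by (simp add: distrib_right)
  qed
  finally have "(\<integral>\<omega>. nuclear_norm (E \<omega>) \<partial>\<nu>) \<le> (1 + \<epsilon>) * N" .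
  then show ?thesis
    using OF_sets prob_pos Ei unfolding cond_expectation_def opt \<nu>_def by simp
qed

end
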